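(* Let $L_1$ be an analytic Jordan curve, $h$ a positive analytic weight on $L_1$, and let $P_n$, $\gamma_n$, $\phi$, $\Delta_e$, $\Delta_i$, $\rho$, $\Omega_s$, $G_s$, $L_s$ and $W$ be as defined in the context. Fix $r$ with $\rho<r<1$ and let $g_n^{(k)}$, $\Lambda_r$, $\Lambda_r'$, $M_r$ be as defined in the context. Then for every integer $n\ge 0$ such that $$\frac{\Lambda_r\Lambda'_rM_rr^{2n}}{1/r-r}<1,$$ we have (all series being convergent) $$ \frac{\gamma_n^2P_n(z)}{\Delta_e(\infty)[\phi'(\infty)]^{n+1/2}}=\begin{cases} \displaystyle \Delta_e(z)\sqrt{\phi'(z)}\,[\phi(z)]^n\sum_{k=0}^\infty g_n^{(2k)}(z), & z\in \Omega_{1/r},\\[2mm] \displaystyle \Delta_e(z)\sqrt{\phi'(z)}\,[\phi(z)]^n\sum_{k=0}^\infty g_n^{(2k)}(z)-\frac{1}{\Delta_i(z)}\sum_{k=0}^\infty g_n^{(2k+1)}(z), & z\in \Omega_{r}\cap G_{1/r},\\[2mm] \displaystyle -\frac{1}{\Delta_i(z)}\sum_{k=0}^\infty g_n^{(2k+1)}(z), & z\in G_{r}. \end{cases} $$ In particular, $$\gamma_n^2=\Delta_e(\infty)^2[\phi'(\infty)]^{2n+1}\sum_{k=0}^\infty g_n^{(2k)}(\infty).$$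
   Context: Notation: $\mathbb{T}_s=\{|w|=s\}$, $\mathbb{E}_s=\{w: s<|w|\le\infty\}$, $\mathbb{D}_s=\{|w|<s\}$. A function is called analytic on a closed set if it is analytic on a neighborhood of it (possibly after analytic continuation). Contours are positively oriented. Orthogonal polynomials. $L_1$ is an analytic Jordan curve in $\mathbb{C}$ and $h$ is analytic in a neighborhood of $L_1$ with $h(z)>0$ for all $z\in L_1$. $p_n(z)=\gamma_nz^n+\cdots$, $\gamma_n>0$, $n\ge0$, are the orthonormal polynomials: $\frac{1}{2\pi}\oint_{L_1}p_n(z)\overline{p_m(z)}h(z)|dz|=\delta_{nm}$. $P_n=\gamma_n^{-1}p_n$ is the monic orthogonal polynomial. Exterior map. $\Omega_1$ is the unbounded component of $\overline{\mathbb{C}}\setminus L_1$; $\psi$ is the conformal map of $\mathbb{E}_1$ onto $\Omega_1$ with $\psi(\infty)=\infty$, $\psi'(\infty)>0$. $\widehat\rho\ge0$ is the smallest number such that $\psi$ has an analytic and univalent continuation to $\mathbb{E}_{\widehat\rho}$ (so $\widehat\rho<1$). For $\widehat\rho\le s<\infty$: $\Omega_s=\psi(\mathbb{E}_s)$, $L_s=\partial\Omega_s$, $G_s=\mathbb{C}\setminus\overline{\Omega}_s$; if $s=1/0=\infty$, $G_\infty=\mathbb{C}$. $\phi:\Omega_{\widehat\rho}\to\mathbb{E}_{\widehat\rho}$ is the inverse of $\psi$; $\sqrt{\phi'}$ is the analytic branch on $\Omega_{\widehat\rho}$ with $\sqrt{\phi'(\infty)}>0$. The Schwarz reflection about $L_1$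 is $z^*=\psi\big(1/\overline{\phi(z)}\big)$, $z\in\Omega_{\widehat\rho}\cap G_{1/\widehat\rho}$. Szegő functions. The exterior Szegő function $\Delta_e$ for $h$ is the unique function analytic and never zero on $\overline{\Omega}_1$ with $\Delta_e(\infty)>0$ and $|\Delta_e(z)|^{-2}=h(z)$ on $L_1$. An interior Szegő function $\Delta_i$ is a function analytic and never zero on $\overline{G}_1$ with $|\Delta_i(z)|^2=h(z)$ on $L_1$; it is unique up to a multiplicative constant of modulus 1, and one is fixed. $\rho$ is the smallest number $\ge\widehat\rho$ such that $\Delta_e$ is analytic on $\Omega_\rho$ (so $\widehat\rho\le\rho<1$). The function $1/\Delta_i$ has an analytic continuation from $\overline{G}_1$ to $G_{1/\rho}$, given by $\frac1{\Delta_i(z)}:=\Delta_e(z)\overline{\Delta_e(z^* )}\,\overline{\Delta_i(z^* )}$ for $z\in G_{1/\rho}\setminus\overline{G}_1$; this is the meaning of $1/\Delta_i$ outside $\overline G_1$. Kernel. For a conformal map $\varphi$ of $G_1$ onto $\mathbb{D}_1$, $W(\zeta,z)=\frac{\sqrt{\varphi'(z)}\sqrt{\varphi'(\zeta)}}{\varphi(\zeta)-\varphi(z)}$, $\zeta,z\in G_1$ (same branch of $\sqrt{\varphi'}$ in both factors); it does not depend on the choice of $\varphi$. Choosing $\varphi$ with no zero in $\Omega_{\widehat\rho}\cap G_1$, $\varphi$ extends analytically and univalently to $G_{1/\widehat\rho}$ by $\varphi(z)=1/\overline{\varphi(z^* )}$, $z\in G_{1/\widehat\rho}\setminus\overline{G}_1$,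 and so $W$ extends by the same formula to $G_{1/\widehat\rho}\times G_{1/\widehat\rho}$; for fixed $z$ it is analytic in $\zeta\neq z$ with a simple pole at $\zeta=z$ of residue 1. Integral transforms. For fixed $\rho<r<1$ and each integer $n\ge0$: $g_n^{(0)}(z)=1$ for $z\in\overline{\mathbb{C}}$, and for $k\ge0$, $$g_n^{(2k+1)}(z)=-\frac{1}{2\pi i}\oint_{L_r}g_n^{(2k)}(\zeta)\Delta_e(\zeta)\Delta_i(\zeta)W(\zeta,z)\sqrt{\phi'(\zeta)}\,[\phi(\zeta)]^nd\zeta,\quad z\in G_{1/\rho}\setminus L_r,$$ $$g_n^{(2k+2)}(z)=\frac{\phi(z)}{2\pi i}\oint_{L_{1/r}}\frac{g_n^{(2k+1)}(\zeta)\sqrt{\phi'(\zeta)}\,[\phi(\zeta)]^{-n-1}d\zeta}{\Delta_e(\zeta)\Delta_i(\zeta)[\phi(\zeta)-\phi(z)]},\quad z\in\Omega_\rho\setminus L_{1/r}$$ (the value at $z=\infty$ being the limit). Constants: $$\Lambda_r=\max_{\zeta\in L_r}\left|\frac{\Delta_e(\zeta)\Delta_i(\zeta)}{\sqrt{\phi'(\zeta)}}\right|,\quad \Lambda'_r=\max_{\zeta\in L_{1/r}}\left|\sqrt{\phi'(\zeta)}\Delta_e(\zeta)\Delta_i(\zeta)\right|^{-1},\quad M_r=\max_{(\zeta,z)\in L_r\times L_{1/r}}|W(\zeta,z)|.$$ Formulas for $P_n(z)$ are understood for finite $z$. *)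

theory Defs
  imports "HOL-Complex_Analysis.Complex_Analysis" "HOL-Computational_Algebra.Polynomial"
begin

text \<open>
  Subsets of the Riemann sphere are represented by their finite parts, and the value at the point
  at infinity of a function defined near it by its limit along the filter \<open>at_infinity\<close>.
  A function possessing an analytic continuation is represented by one function that already is
  the continuation; outside the stated domains its values are arbitrary and never used.
\<close>

definition at_inf :: "(complex \<Rightarrow> complex) \<Rightarrow> complex" where
  "at_inf f = Lim at_infinity f"

definition positive_at_inf :: "(complex \<Rightarrow> complex) \<Rightarrow> bool" where
  "positive_at_inf f \<longleftrightarrow> (\<exists>c::real. c > 0 \<and> (f \<longlongrightarrow> of_real c) at_infinity)"

definition conformal_onto :: "(complex \<Rightarrow> complex) \<Rightarrow> complex set \<Rightarrow> complex set \<Rightarrow> bool" where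
  "conformal_onto f A B \<longleftrightarrow> f holomorphic_on A \<and> inj_on f A \<and> f ` A = B"

definition analytic_jordan_curve :: "complex set \<Rightarrow> bool" where
  "analytic_jordan_curve L \<longleftrightarrow>
     (\<exists>f A. open A \<and> sphere 0 1 \<subseteq> A \<and> f holomorphic_on A \<and> inj_on f A \<and> L = f ` sphere 0 1)"

definition positive_weight :: "complex set \<Rightarrow> (complex \<Rightarrow> complex) \<Rightarrow> bool" where
  "positive_weight L h \<longleftrightarrow>
     h analytic_on L \<and> (\<forall>z\<in>L. \<exists>x::real. x > 0 \<and> h z = of_real x)"


subsection \<open>The exterior map and the associated level sets\<close>

definition Ext :: "real \<Rightarrow> complex set" where
  "Ext s = {w. s < cmod w}"

definition rho_hat :: "(complex \<Rightarrow> complex) \<Rightarrow> real" where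
  "rho_hat \<psi> = (LEAST s. 0 \<le> s \<and>
     (\<exists>F. F holomorphic_on Ext s \<and> inj_on F (Ext s) \<and> (\<forall>w\<in>Ext 1. F w = \<psi> w)))"

text \<open>\<open>rho_hat \<psi>\<close> only depends on the restriction of \<open>\<psi>\<close> to \<open>Ext 1\<close>; the last two conjuncts say that
  \<open>\<psi>\<close> denotes its own maximal univalent continuation. The derivative of \<open>\<psi>\<close> at infinity, where
  \<open>\<psi>\<close> has a simple pole, is the limit of \<open>\<psi>'\<close> (equivalently, of \<open>\<psi>(w)/w\<close>).\<close>

definition exterior_map :: "complex set \<Rightarrow> (complex \<Rightarrow> complex) \<Rightarrow> bool" where
  "exterior_map L \<psi> \<longleftrightarrow>
     conformal_onto \<psi> (Ext 1) (outside L) \<and>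
     filterlim \<psi> at_infinity at_infinity \<and> positive_at_inf (deriv \<psi>) \<and>
     \<psi> holomorphic_on Ext (rho_hat \<psi>) \<and> inj_on \<psi> (Ext (rho_hat \<psi>))"

definition Omega :: "(complex \<Rightarrow> complex) \<Rightarrow> real \<Rightarrow> complex set" where
  "Omega \<psi> s = \<psi> ` Ext s"

definition Lev :: "(complex \<Rightarrow> complex) \<Rightarrow> real \<Rightarrow> complex set" where
  "Lev \<psi> s = frontier (Omega \<psi> s)"

definition G :: "(complex \<Rightarrow> complex) \<Rightarrow> real \<Rightarrow> complex set" where
  "G \<psi> s = - closure (Omega \<psi> s)"

text \<open>\<open>G_recip \<psi> s\<close> is the set \<open>G\<close> with index \<open>1/s\<close>, where \<open>1/0\<close> means infinity
  (and not \<open>0\<close> as for the HOL division).\<close>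

definition G_recip :: "(complex \<Rightarrow> complex) \<Rightarrow> real \<Rightarrow> complex set" where
  "G_recip \<psi> s = (if s = 0 then UNIV else G \<psi> (1 / s))"

text \<open>The standard parametrization of \<open>Lev \<psi> s\<close> for \<open>s > rho_hat \<psi>\<close>. It is positively oriented,
  because \<open>\<psi>\<close> is univalent outside the circle and has positive derivative at infinity.\<close>

definition Lev_path :: "(complex \<Rightarrow> complex) \<Rightarrow> real \<Rightarrow> real \<Rightarrow> complex" where
  "Lev_path \<psi> s = \<psi> \<circ> circlepath 0 s"

definition phi :: "(complex \<Rightarrow> complex) \<Rightarrow> complex \<Rightarrow> complex" where
  "phi \<psi> = inv_into (Ext (rho_hat \<psi>)) \<psi>"

definition sqrt_phi_deriv :: "(complex \<Rightarrow> complex) \<Rightarrow> (complex \<Rightarrow> complex) \<Rightarrow> bool" where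
  "sqrt_phi_deriv \<psi> sq \<longleftrightarrow>
     sq holomorphic_on Omega \<psi> (rho_hat \<psi>) \<and>
     (\<forall>z\<in>Omega \<psi> (rho_hat \<psi>). (sq z)\<^sup>2 = deriv (phi \<psi>) z) \<and> positive_at_inf sq"

definition refl_star :: "(complex \<Rightarrow> complex) \<Rightarrow> complex \<Rightarrow> complex" where
  "refl_star \<psi> z = \<psi> (1 / cnj (phi \<psi> z))"


subsection \<open>Orthogonal polynomials\<close>

definition arclength_integral :: "(real \<Rightarrow> complex) \<Rightarrow> (complex \<Rightarrow> complex) \<Rightarrow> complex" where
  "arclength_integral c f =
     integral {0..1} (\<lambda>t. f (c t) * of_real (cmod (vector_derivative c (at t within {0..1}))))"

definition orthonormal_polys ::
  "(complex \<Rightarrow> complex) \<Rightarrow> (complex \<Rightarrow> complex) \<Rightarrow> (nat \<Rightarrow> complex poly) \<Rightarrow> bool" where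
  "orthonormal_polys \<psi> h p \<longleftrightarrow>
     (\<forall>n. degree (p n) = n \<and> (\<exists>c::real. c > 0 \<and> lead_coeff (p n) = of_real c)) \<and>
     (\<forall>n m. 1 / (2 * of_real pi) *
         arclength_integral (Lev_path \<psi> 1) (\<lambda>z. poly (p n) z * cnj (poly (p m) z) * h z) =
       (if n = m then 1 else 0))"

definition monic_poly :: "(nat \<Rightarrow> complex poly) \<Rightarrow> nat \<Rightarrow> complex poly" where
  "monic_poly p n = smult (inverse (lead_coeff (p n))) (p n)"


subsection \<open>Szego functions\<close>

definition rho :: "(complex \<Rightarrow> complex) \<Rightarrow> (complex \<Rightarrow> complex) \<Rightarrow> real" where
  "rho \<psi> De = (LEAST s. rho_hat \<psi> \<le> s \<and>
     (\<exists>F. F holomorphic_on Omega \<psi> s \<and> (\<forall>z\<in>Omega \<psi> 1. F z = De z)))"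

text \<open>Again \<open>De\<close> denotes its own continuation, to \<open>Omega \<psi> (rho \<psi> De)\<close>. Analyticity at infinity
  is contained in the existence of the limit there.\<close>

definition exterior_szego ::
  "complex set \<Rightarrow> (complex \<Rightarrow> complex) \<Rightarrow> (complex \<Rightarrow> complex) \<Rightarrow> (complex \<Rightarrow> complex) \<Rightarrow> bool" where
  "exterior_szego L h \<psi> De \<longleftrightarrow>
     De analytic_on closure (Omega \<psi> 1) \<and> (\<forall>z\<in>closure (Omega \<psi> 1). De z \<noteq> 0) \<and>
     positive_at_inf De \<and>
     (\<forall>z\<in>L. of_real (1 / (cmod (De z))\<^sup>2) = h z) \<and>
     De holomorphic_on Omega \<psi> (rho \<psi> De)"

definition interior_szego ::
  "complex set \<Rightarrow> (complex \<Rightarrow> complex) \<Rightarrow> (complex \<Rightarrow> complex) \<Rightarrow> (complex \<Rightarrow> complex) \<Rightarrow> bool" where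
  "interior_szego L h \<psi> Di \<longleftrightarrow>
     Di analytic_on closure (G \<psi> 1) \<and> (\<forall>z\<in>closure (G \<psi> 1). Di z \<noteq> 0) \<and>
     (\<forall>z\<in>L. of_real ((cmod (Di z))\<^sup>2) = h z)"

text \<open>The continuation of \<open>1/Di\<close>; it may vanish outside \<open>closure (G \<psi> 1)\<close>, so it is not
  written as a reciprocal there.\<close>

definition inv_Di ::
  "(complex \<Rightarrow> complex) \<Rightarrow> (complex \<Rightarrow> complex) \<Rightarrow> (complex \<Rightarrow> complex) \<Rightarrow> complex \<Rightarrow> complex" where
  "inv_Di \<psi> De Di z =
     (if z \<in> closure (G \<psi> 1) then 1 / Di z
      else De z * cnj (De (refl_star \<psi> z)) * cnj (Di (refl_star \<psi> z)))"


subsection \<open>The kernel\<close>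

text \<open>\<open>f\<close> is a conformal map of the interior onto the unit disk without zeros where the reflection is
  defined, already extended by reflection.\<close>

definition interior_map :: "(complex \<Rightarrow> complex) \<Rightarrow> (complex \<Rightarrow> complex) \<Rightarrow> bool" where
  "interior_map \<psi> f \<longleftrightarrow>
     conformal_onto f (G \<psi> 1) (ball 0 1) \<and>
     (\<forall>z\<in>Omega \<psi> (rho_hat \<psi>) \<inter> G \<psi> 1. f z \<noteq> 0) \<and>
     f holomorphic_on G_recip \<psi> (rho_hat \<psi>) \<and> inj_on f (G_recip \<psi> (rho_hat \<psi>)) \<and>
     (\<forall>z\<in>G_recip \<psi> (rho_hat \<psi>) - closure (G \<psi> 1). f z = 1 / cnj (f (refl_star \<psi> z)))"

definition is_kernel ::
  "(complex \<Rightarrow> complex) \<Rightarrow> (complex \<Rightarrow> complex \<Rightarrow> complex) \<Rightarrow> bool" where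
  "is_kernel \<psi> W \<longleftrightarrow>
     (\<exists>f q. interior_map \<psi> f \<and> q holomorphic_on G_recip \<psi> (rho_hat \<psi>) \<and>
        (\<forall>z\<in>G_recip \<psi> (rho_hat \<psi>). (q z)\<^sup>2 = deriv f z) \<and>
        (\<forall>\<zeta>\<in>G_recip \<psi> (rho_hat \<psi>). \<forall>z\<in>G_recip \<psi> (rho_hat \<psi>). W \<zeta> z = q z * q \<zeta> / (f \<zeta> - f z)))"


subsection \<open>The integral transforms and the constants\<close>

primrec gtr ::
  "(complex \<Rightarrow> complex) \<Rightarrow> (complex \<Rightarrow> complex) \<Rightarrow> (complex \<Rightarrow> complex) \<Rightarrow> (complex \<Rightarrow> complex) \<Rightarrow>
   (complex \<Rightarrow> complex \<Rightarrow> complex) \<Rightarrow> real \<Rightarrow> nat \<Rightarrow> nat \<Rightarrow> complex \<Rightarrow> complex" where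
  "gtr \<psi> sq De Di W r n 0 = (\<lambda>z. 1)"
| "gtr \<psi> sq De Di W r n (Suc k) =
     (if even k then
        (\<lambda>z. - (1 / (2 * of_real pi * \<i>)) * contour_integral (Lev_path \<psi> r)
           (\<lambda>\<zeta>. gtr \<psi> sq De Di W r n k \<zeta> * De \<zeta> * Di \<zeta> * W \<zeta> z * sq \<zeta> * phi \<psi> \<zeta> ^ n))
      else
        (\<lambda>z. phi \<psi> z / (2 * of_real pi * \<i>) * contour_integral (Lev_path \<psi> (1 / r))
           (\<lambda>\<zeta>. gtr \<psi> sq De Di W r n k \<zeta> * sq \<zeta> * inv_Di \<psi> De Di \<zeta>
                / (phi \<psi> \<zeta> ^ (n + 1) * De \<zeta> * (phi \<psi> \<zeta> - phi \<psi> z)))))"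

text \<open>The maxima below are taken over compact sets, hence are suprema.\<close>

definition Lam ::
  "(complex \<Rightarrow> complex) \<Rightarrow> (complex \<Rightarrow> complex) \<Rightarrow> (complex \<Rightarrow> complex) \<Rightarrow> (complex \<Rightarrow> complex) \<Rightarrow>
   real \<Rightarrow> real" where
  "Lam \<psi> sq De Di r = (SUP \<zeta>\<in>Lev \<psi> r. cmod (De \<zeta> * Di \<zeta> / sq \<zeta>))"

definition Lam' ::
  "(complex \<Rightarrow> complex) \<Rightarrow> (complex \<Rightarrow> complex) \<Rightarrow> (complex \<Rightarrow> complex) \<Rightarrow> (complex \<Rightarrow> complex) \<Rightarrow>
   real \<Rightarrow> real" where
  "Lam' \<psi> sq De Di r = (SUP \<zeta>\<in>Lev \<psi> (1 / r). cmod (inv_Di \<psi> De Di \<zeta> / (sq \<zeta> * De \<zeta>)))"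

definition Mker :: "(complex \<Rightarrow> complex) \<Rightarrow> (complex \<Rightarrow> complex \<Rightarrow> complex) \<Rightarrow> real \<Rightarrow> real" where
  "Mker \<psi> W r = (SUP (\<zeta>, z)\<in>Lev \<psi> r \<times> Lev \<psi> (1 / r). cmod (W \<zeta> z))"

end

theory Submission
  imports Defs
begin

text \<open>
  In the coordinate \<open>w = phi z\<close> both transforms are Cauchy-type integrals over circles, and the smallness
  condition makes their composition a contraction on \<open>\<bar>w\<bar> = r\<close>. The two series therefore converge to
  functions \<open>eta\<close> (of \<open>w\<close>) and \<open>beta\<close> (of \<open>z\<close>) that solve a coupled pair of singular integral equations.
  By the residue at the pole of each kernel, the jumps of the three expressions in the formula across
  \<open>\<bar>w\<bar> = r\<close> and \<open>\<bar>w\<bar> = 1 / r\<close> cancel, so the expressions are restrictions of a single entire function \<open>Q\<close>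
  with \<open>Q z = O(z ^ n)\<close>, hence a polynomial of degree at most \<open>n\<close>. On the curve, the \<open>eta\<close> part of \<open>Q\<close> pairs
  with a polynomial \<open>u\<close> of degree at most \<open>n\<close> to a residue at \<open>w = 0\<close>, which only sees the coefficient of
  \<open>z ^ n\<close> in \<open>u\<close>; the \<open>beta\<close> part is orthogonal to all polynomials, because \<open>cnj W \<bar>dz\<bar>\<close> is a holomorphic
  differential in the interior domain. This identifies \<open>Q\<close> as a multiple of \<open>p n\<close>.
\<close>

subsection \<open>Circle integrals and gluing\<close>

text \<open>The unit circle is the meeting place of the two transforms. The density
  \<open>k1\<close> is controlled from \<open>|w| = r\<close> up to it, because \<open>Di\<close> is
  given near the closed interior; \<open>k2\<close> is controlled from it up to
  \<open>|w| = 1 / r\<close>, because \<open>De\<close> may vanish further in. Hence both contours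
  are moved to the unit circle and no further. The residues fit together because of the square
  roots: \<open>deriv F = q^2 \<psi>'\<close> and \<open>\<psi>' = 1 / S^2\<close>, so each pole
  crossed produces exactly the other term of the middle formula. The prefactor \<open>phi\<close> in
  the even transform forces \<open>eta 0 = 1\<close> whatever \<open>beta\<close> is, so the pairing
  of \<open>Q\<close> with a polynomial depends on nothing but its coefficient of
  \<open>z ^ n\<close>. The resulting constant \<open>kap\<close> is the reciprocal of
  \<open>De(\<infinity>) phi'(\<infinity>)^(n + 1/2)\<close>, the denominator in the theorem.
  \<open>Q\<close> is computed twice: the pairing gives its multiple of \<open>p n\<close>, and its
  growth at infinity gives its top coefficient in terms of \<open>eta_inf\<close>. Equating the two
  gives the formula for the squared leading coefficient.\<close>

text \<open>\<open>LEAST\<close> over the reals is informative only if the infimum is attained.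
  Upward closure puts every number above the infimum into \<open>P\<close>, and
  \<open>closed\<close> then adds the infimum itself. Both \<open>rho_hat\<close> and
  \<open>rho\<close> are handled this way.\<close>

lemma Least_real_attained:
  fixes P :: "real \<Rightarrow> bool"
  assumes t0: "P t0" and low: "\<And>t. P t \<Longrightarrow> b \<le> t"
    and up: "\<And>s t. P s \<Longrightarrow> s \<le> t \<Longrightarrow> P t"
    and closed: "\<And>s. b \<le> s \<Longrightarrow> s < t0 \<Longrightarrow> (\<And>t. s < t \<Longrightarrow> P t) \<Longrightarrow> P s"
  shows "P (LEAST t. P t)" "(LEAST t. P t) \<le> t0"
proof -
  define s where "s = Inf (Collect P)"
  have bdd: "bdd_below (Collect P)"
    using low by (intro bdd_belowI[of _ b]) auto
  have "P t" if "s < t" for t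
    using cInf_less_iff[of "Collect P" t] bdd t0 that up unfolding s_def
    by (metis empty_Collect_eq less_imp_le mem_Collect_eq)
  moreover have "b \<le> s"
    unfolding s_def using t0 low by (intro cInf_greatest) auto
  ultimately have "P s"
    using closed up t0 by (metis not_le)
  moreover have "s \<le> t" if "P t" for t
    unfolding s_def using bdd that by (intro cInf_lower) auto
  ultimately show "P (LEAST t. P t)" "(LEAST t. P t) \<le> t0"
    using t0 by (metis LeastI_ex Least_equality)+
qed

text \<open>The domains grow as \<open>t\<close> decreases to \<open>s\<close>. All
  \<open>F t\<close> equal \<open>g\<close> on the open set \<open>B\<close>, so the identity
  theorem on the smaller, connected domain makes any two of them agree there. This is the closure
  step for both least radii.\<close>

lemma holomorphic_glue_decreasing:
  fixes U :: "real \<Rightarrow> complex set" and s :: real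
  assumes op: "\<And>t. s < t \<Longrightarrow> open (U t)" and con: "\<And>t. s < t \<Longrightarrow> connected (U t)"
    and mono: "\<And>t t'. s < t \<Longrightarrow> t \<le> t' \<Longrightarrow> U t' \<subseteq> U t"
    and B: "open B" "\<And>t. s < t \<Longrightarrow> B \<inter> U t \<noteq> {}"
    and F: "\<And>t. s < t \<Longrightarrow> F t holomorphic_on U t"
    and Fg: "\<And>t z. s < t \<Longrightarrow> z \<in> B \<inter> U t \<Longrightarrow> F t z = g z"
  obtains H where "H holomorphic_on (\<Union>t\<in>{s<..}. U t)"
    "\<And>t z. s < t \<Longrightarrow> z \<in> U t \<Longrightarrow> H z = F t z"
proof -
  have agree: "F t z = F t' z" if "s < t" "t \<le> t'" "z \<in> U t'" for t t' z
  proof (rule analytic_continuation_open[where s = "B \<inter> U t'" and s' = "U t'" and f = "F t"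
        and g = "F t'" and z = z])
    have t': "s < t'" using that by simp
    show "open (B \<inter> U t')" "open (U t')" "B \<inter> U t' \<noteq> {}" "connected (U t')"
      "F t' holomorphic_on U t'"
      using op[OF t'] B(1) B(2)[OF t'] con[OF t'] F[OF t'] by auto
    show "F t holomorphic_on U t'"
      using F[of t] mono[of t t'] that holomorphic_on_subset by blast
    show "F t x = F t' x" if x: "x \<in> B \<inter> U t'" for x
    proof -
      have "x \<in> B \<inter> U t"
        using mono[OF \<open>s < t\<close> \<open>t \<le> t'\<close>] x by blast
      then show ?thesis
        using Fg[OF \<open>s < t\<close>, of x] Fg[OF t' x] by simp
    qed
  qed (use that in auto)
  \<comment> \<open>Any admissible radius will do; by \<open>agree\<close> the value does not depend
    on the choice.\<close>
  define T where "T z = (SOME t. s < t \<and> z \<in> U t)" for z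
  define H where "H z = F (T z) z" for z
  have H: "H z = F t z" if "s < t" "z \<in> U t" for t z
  proof -
    have "s < T z \<and> z \<in> U (T z)"
      unfolding T_def by (rule someI[of _ t]) (use that in auto)
    then show ?thesis
      unfolding H_def using agree that by (metis linear)
  qed
  have "H holomorphic_on (\<Union>t\<in>{s<..}. U t)"
  proof (rule holomorphic_on_UN_open)
    fix t assume "t \<in> {s<..}"
    then have t: "s < t" by simp
    show "H holomorphic_on U t"
      by (rule holomorphic_transform[OF F[OF t]]) (rule H[OF t, symmetric])
    show "open (U t)"
      by (rule op[OF t])
  qed
  then show ?thesis by (rule that) (rule H)
qed

text \<open>The straight homotopy moves each point along its ray, so the modulus stays between
  \<open>r1\<close> and \<open>r2\<close>.\<close>

lemma circlepath_integral_shift: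
  assumes "open S" "g holomorphic_on S" "0 \<le> r1" "r1 \<le> r2"
    and "{w. r1 \<le> cmod w \<and> cmod w \<le> r2} \<subseteq> S"
  shows "contour_integral (circlepath 0 r1) g = contour_integral (circlepath 0 r2) g"
proof (rule Cauchy_theorem_homotopic_loops[OF homotopic_loops_linear assms(1,2)])
  fix t :: real
  show "closed_segment (circlepath 0 r1 t) (circlepath 0 r2 t) \<subseteq> S"
  proof
    fix x assume "x \<in> closed_segment (circlepath 0 r1 t) (circlepath 0 r2 t)"
    then obtain u where u: "0 \<le> u" "u \<le> 1"
      and x: "x = of_real ((1 - u) * r1 + u * r2) * exp (2 * of_real pi * \<i> * of_real t)"
      by (auto simp: closed_segment_def circlepath scaleR_conv_of_real algebra_simps)
    have "cmod x = \<bar>(1 - u) * r1 + u * r2\<bar>"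
      unfolding x norm_mult norm_of_real by simp
    also have "\<dots> = (1 - u) * r1 + u * r2"
      using u assms(3,4) by simp
    finally have *: "cmod x = r1 + u * (r2 - r1)"
      by (simp add: algebra_simps)
    have "0 \<le> u * (r2 - r1)" "u * (r2 - r1) \<le> 1 * (r2 - r1)"
      using u assms(3,4) mult_right_mono[of u 1 "r2 - r1"] by auto
    with * show "x \<in> S"
      using assms(5) by auto
  qed
qed auto

lemma continuous_on_contour_integrable_circlepath:
  assumes "continuous_on (sphere z r) f" "0 \<le> r"
  shows "f contour_integrable_on circlepath z r"
proof -
  have "continuous_on {0..1} (circlepath z r)"
    using path_circlepath path_def by blast
  then have "continuous_on {0..1} (\<lambda>t. f (circlepath z r t) * vector_derivative (circlepath z r) (at t))"
    unfolding vector_derivative_circlepath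
    using assms
    by (intro continuous_intros continuous_on_compose2[OF assms(1)])
       (auto simp: path_defs simp flip: path_image_circlepath_nonneg)
  then show ?thesis
    unfolding contour_integrable_on by (rule integrable_continuous_real)
qed

lemma contour_integral_circlepath_bound:
  assumes "continuous_on (sphere 0 s) f" "0 < s" "\<And>w. cmod w = s \<Longrightarrow> cmod (f w) \<le> B"
  shows "cmod (contour_integral (circlepath 0 s) f) \<le> B * (2 * pi * s)"
proof (rule has_contour_integral_bound_circlepath[OF has_contour_integral_integral])
  show "f contour_integrable_on circlepath 0 s"
    using assms by (intro continuous_on_contour_integrable_circlepath) auto
  show "0 \<le> B"
    using assms(2) assms(3)[of "of_real s"] norm_ge_zero order_trans
    by (metis abs_of_pos norm_of_real)
qed (use assms in auto)

text \<open>The majorant \<open>M\<close> gives uniform convergence on the circle, hence termwise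
  integration against the bounded factor \<open>K\<close>. All interchanges of sum and integral go
  through this lemma.\<close>

lemma sums_contour_integral_circlepath:
  fixes a :: "nat \<Rightarrow> complex \<Rightarrow> complex"
  assumes a: "\<And>k. continuous_on (sphere 0 s) (a k)" and K: "continuous_on (sphere 0 s) K"
    and s: "0 < s" and bound: "\<And>k w. cmod w = s \<Longrightarrow> cmod (a k w) \<le> M k" and M: "summable M"
  shows "(\<lambda>k. contour_integral (circlepath 0 s) (\<lambda>w. a k w * K w)) sums
           contour_integral (circlepath 0 s) (\<lambda>w. (\<Sum>k. a k w) * K w)" (is ?sums)
    and "continuous_on (sphere 0 s) (\<lambda>w. \<Sum>k. a k w)" (is ?cont)
proof -
  have ul: "uniform_limit (sphere 0 s) (\<lambda>n w. \<Sum>k<n. a k w) (\<lambda>w. \<Sum>k. a k w) sequentially"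
    using bound M by (intro Weierstrass_m_test) auto
  show cont: ?cont
    by (rule uniform_limit_theorem[OF _ ul]) (auto intro!: always_eventually continuous_intros a)
  have img: "path_image (circlepath 0 s) = sphere 0 s"
    using s by (intro path_image_circlepath_nonneg) auto
  have "bounded ((\<lambda>w. \<Sum>k. a k w) ` sphere 0 s)" "bounded (K ` sphere 0 s)"
    by (intro compact_imp_bounded compact_continuous_image cont K compact_sphere)+
  then have ul2: "uniform_limit (path_image (circlepath 0 s)) (\<lambda>n w. (\<Sum>k<n. a k w) * K w)
      (\<lambda>w. (\<Sum>k. a k w) * K w) sequentially"
    unfolding img by (intro uniform_lim_mult[OF ul] uniform_limit_const)
  have int: "(\<lambda>w. a k w * K w) contour_integrable_on circlepath 0 s" for k
    using s by (intro continuous_on_contour_integrable_circlepath continuous_intros a K) auto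
  have "(\<lambda>n. contour_integral (circlepath 0 s) (\<lambda>w. (\<Sum>k<n. a k w) * K w)) \<longlonglongrightarrow>
           contour_integral (circlepath 0 s) (\<lambda>w. (\<Sum>k. a k w) * K w)"
  proof (rule contour_integral_uniform_limit(2)[OF _ ul2])
    show "\<forall>\<^sub>F n in sequentially. (\<lambda>w. (\<Sum>k<n. a k w) * K w) contour_integrable_on circlepath 0 s"
      using s by (intro always_eventually allI continuous_on_contour_integrable_circlepath
          continuous_intros a K) auto
    show "cmod (vector_derivative (circlepath 0 s) (at t)) \<le> 2 * pi * s" for t
      using s by (simp add: vector_derivative_circlepath norm_mult)
  qed auto
  moreover have "contour_integral (circlepath 0 s) (\<lambda>w. (\<Sum>k<n. a k w) * K w) =
      (\<Sum>k<n. contour_integral (circlepath 0 s) (\<lambda>w. a k w * K w))" for n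
    unfolding sum_distrib_right by (rule contour_integral_sum) (use int in auto)
  ultimately show ?sums
    unfolding sums_def by simp
qed

text \<open>\<open>F\<close> is left free so that one statement serves the Cauchy kernel in
  \<open>w\<close> and, with \<open>F = f \<circ> \<psi>\<close>, the kernel
  \<open>W\<close>.\<close>

lemma holomorphic_contour_integral_param:
  fixes g F :: "complex \<Rightarrow> complex"
  assumes g: "continuous_on (sphere 0 s) g" and F: "continuous_on (sphere 0 s) F"
    and s: "0 \<le> s" and U: "open U" "F ` sphere 0 s \<inter> U = {}"
  shows "(\<lambda>u. contour_integral (circlepath 0 s) (\<lambda>w. g w / (F w - u))) holomorphic_on U"
proof -
  define c where "c = circlepath 0 s"
  have c: "c t \<in> sphere 0 s" if "t \<in> {0..1}" for t
    using that s path_image_circlepath_nonneg[of s 0] unfolding c_def path_image_def by blast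
  have cc: "continuous_on {0..1} c" "continuous_on {0..1} (\<lambda>t. vector_derivative c (at t))"
    using path_circlepath path_def unfolding c_def vector_derivative_circlepath
    by (blast, intro continuous_intros)
  have gc: "continuous_on {0..1} (\<lambda>t. g (c t))" "continuous_on {0..1} (\<lambda>t. F (c t))"
    using c by (auto intro: continuous_on_compose2[OF g cc(1)] continuous_on_compose2[OF F cc(1)])
  have ne: "F (c t) \<noteq> u" if "t \<in> {0..1}" "u \<in> U" for t u
  proof
    assume "F (c t) = u"
    then have "u \<in> F ` sphere 0 s \<inter> U"
      using imageI[OF c[OF that(1)], of F] that(2) by simp
    then show False unfolding U(2) by simp
  qed
  \<comment> \<open>The Leibniz rule asks for a convex parameter set, so holomorphy is shown on
    balls first.\<close>
  have loc: "(\<lambda>u. contour_integral c (\<lambda>w. g w / (F w - u))) holomorphic_on V"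
    if V: "V \<subseteq> U" "convex V" for V
  proof -
    have "(\<lambda>u. integral (cbox 0 1) (\<lambda>t. g (c t) / (F (c t) - u) * vector_derivative c (at t)))
             holomorphic_on V"
    proof (rule leibniz_rule_holomorphic[where
          fx = "\<lambda>u t. g (c t) / (F (c t) - u)\<^sup>2 * vector_derivative c (at t)"])
      fix u t assume "u \<in> V" "t \<in> cbox (0::real) 1"
      then have "F (c t) \<noteq> u"
        using ne[OF _ subsetD[OF V(1)]] by simp
      then show "((\<lambda>u. g (c t) / (F (c t) - u) * vector_derivative c (at t)) has_field_derivative
          g (c t) / (F (c t) - u)\<^sup>2 * vector_derivative c (at t)) (at u within V)"
        by (auto intro!: derivative_eq_intros simp: power2_eq_square divide_simps)
    next
      fix u assume "u \<in> V"
      then have "\<And>t. t \<in> {0..1} \<Longrightarrow> F (c t) - u \<noteq> 0"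
        using ne[OF _ subsetD[OF V(1)]] by simp
      then show "(\<lambda>t. g (c t) / (F (c t) - u) * vector_derivative c (at t)) integrable_on cbox 0 1"
        by (intro integrable_continuous continuous_intros) (use gc cc in auto)
    next
      have 1: "continuous_on (V \<times> cbox 0 1) (\<lambda>x. g (c (snd x)))"
        "continuous_on (V \<times> cbox 0 1) (\<lambda>x. F (c (snd x)))"
        "continuous_on (V \<times> cbox 0 1) (\<lambda>x. vector_derivative c (at (snd x)))"
        by (rule continuous_on_compose2[OF gc(1)] continuous_on_compose2[OF gc(2)]
            continuous_on_compose2[OF cc(2)], auto intro!: continuous_intros)+
      have "\<And>x. x \<in> V \<times> cbox 0 1 \<Longrightarrow> F (c (snd x)) - fst x \<noteq> 0"
        using ne[OF _ subsetD[OF V(1)]] by (simp add: mem_Times_iff)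
      then show "continuous_on (V \<times> cbox 0 1)
         (\<lambda>(u, t). g (c t) / (F (c t) - u)\<^sup>2 * vector_derivative c (at t))"
        unfolding case_prod_beta
        by (intro continuous_intros 1) auto
    qed (use V in auto)
    then show ?thesis
      by (simp add: contour_integral_integral)
  qed
  have "(\<lambda>u. contour_integral c (\<lambda>w. g w / (F w - u))) field_differentiable at u" if u: "u \<in> U" for u
  proof -
    obtain e where "0 < e" "ball u e \<subseteq> U"
      using openE[OF U(1) u] by metis
    then show ?thesis
      using holomorphic_on_imp_differentiable_at[OF loc[OF _ convex_ball], of u e u] by simp
  qed
  then show ?thesis
    unfolding c_def[symmetric] holomorphic_on_def
    by (blast intro: field_differentiable_at_within)
qed

lemma contour_integral_comp_circlepath:
  assumes "open A" "\<psi> holomorphic_on A" "sphere 0 s \<subseteq> A" "0 \<le> s"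
  shows "contour_integral (\<psi> \<circ> circlepath 0 s) f =
         contour_integral (circlepath 0 s) (\<lambda>w. f (\<psi> w) * deriv \<psi> w)"
  unfolding contour_integral_integral
proof (rule integral_cong)
  fix t :: real assume "t \<in> {0..1}"
  then have "circlepath 0 s t \<in> A"
    using assms(3,4) path_image_circlepath_nonneg[of s 0] unfolding path_image_def by blast
  then have "\<psi> field_differentiable at (circlepath 0 s t)"
    using assms holomorphic_on_imp_differentiable_at by blast
  moreover have "circlepath 0 s differentiable at t"
    using has_vector_derivative_circlepath differentiableI_vector by blast
  ultimately show "f ((\<psi> \<circ> circlepath 0 s) t) * vector_derivative (\<psi> \<circ> circlepath 0 s) (at t) =
      f (\<psi> (circlepath 0 s t)) * deriv \<psi> (circlepath 0 s t) * vector_derivative (circlepath 0 s) (at t)"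
    by (simp add: vector_derivative_chain_at_general)
qed

text \<open>The denominator \<open>F v - F w\<close> covers both kernels: \<open>F\<close> is the identity for the Cauchy kernel and
  \<open>f \<circ> \<psi>\<close> for \<open>W\<close>.\<close>

lemma circlepath_integral_jump:
  assumes S: "open S" and g: "g holomorphic_on S" and F: "F holomorphic_on S" "inj_on F S"
    and r: "0 < r1" "r1 < cmod w" "cmod w < r2"
    and sub: "{v. r1 \<le> cmod v \<and> cmod v \<le> r2} \<subseteq> S"
  shows "contour_integral (circlepath 0 r2) (\<lambda>v. g v / (F v - F w)) =
         contour_integral (circlepath 0 r1) (\<lambda>v. g v / (F v - F w)) + 2 * of_real pi * \<i> * (g w / deriv F w)"
proof -
  have wS: "w \<in> S" using sub r by auto
  \<comment> \<open>The difference quotient of \<open>F\<close> at \<open>w\<close> has no zero, by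
    injectivity; dividing by it turns the general kernel into \<open>k v / (v - w)\<close> with
    \<open>k\<close> holomorphic.\<close>
  define E where "E v = (if v = w then deriv F w else (F v - F w) / (v - w))" for v
  have E: "E holomorphic_on S"
    unfolding E_def by (rule pole_lemma_open[OF F(1) S])
  have E0: "E v \<noteq> 0" if "v \<in> S" for v
    using holomorphic_injective_imp_regular[OF F(1) S F(2) wS] inj_onD[OF F(2)] that wS
    unfolding E_def by auto
  define k where "k v = g v / E v" for v
  have k: "k holomorphic_on S"
    unfolding k_def using E0 by (intro holomorphic_intros g E) auto
  \<comment> \<open>What is left after \<open>k w / (v - w)\<close> is split off has no pole, so the
    circles differ only in the integral of \<open>1 / (v - w)\<close>: 0 on the inner one,
    \<open>2 \<pi> \<i>\<close> on the outer one.\<close>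
  define K where "K v = (if v = w then deriv k w else (k v - k w) / (v - w))" for v
  have K: "K holomorphic_on S"
    unfolding K_def by (rule pole_lemma_open[OF k S])
  have split: "contour_integral (circlepath 0 s) (\<lambda>v. g v / (F v - F w)) =
      contour_integral (circlepath 0 s) K + k w * contour_integral (circlepath 0 s) (\<lambda>v. 1 / (v - w))"
    if s: "s = r1 \<or> s = r2" for s
  proof -
    have s': "0 < s" "cmod w \<noteq> s" "sphere 0 s \<subseteq> S" "path_image (circlepath 0 s) = sphere 0 s"
      using s r sub path_image_circlepath_nonneg[of s 0] by auto
    have "contour_integral (circlepath 0 s) (\<lambda>v. g v / (F v - F w)) =
       contour_integral (circlepath 0 s) (\<lambda>v. K v + k w * (1 / (v - w)))"
    proof (rule contour_integral_cong[OF refl])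
      fix v assume "v \<in> path_image (circlepath 0 s)"
      then have "v \<noteq> w" using s' by auto
      then have "g v / (F v - F w) = k v / (v - w)" and "K v = (k v - k w) / (v - w)"
        by (simp_all add: k_def E_def K_def)
      then show "g v / (F v - F w) = K v + k w * (1 / (v - w))"
        by (simp add: diff_divide_distrib)
    qed
    also have "\<dots> = contour_integral (circlepath 0 s) K
         + contour_integral (circlepath 0 s) (\<lambda>v. k w * (1 / (v - w)))"
      using s' by (intro contour_integral_add continuous_on_contour_integrable_circlepath continuous_intros
          holomorphic_on_imp_continuous_on[OF holomorphic_on_subset[OF K]]) auto
    also have "contour_integral (circlepath 0 s) (\<lambda>v. k w * (1 / (v - w))) =
       k w * contour_integral (circlepath 0 s) (\<lambda>v. 1 / (v - w))"
      using s' by (intro contour_integral_lmul continuous_on_contour_integrable_circlepath continuous_intros) auto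
    finally show ?thesis .
  qed
  have "((\<lambda>u. 1 / (u - w)) has_contour_integral 2 * of_real pi * \<i> * 1) (circlepath 0 r2)"
    by (rule Cauchy_integral_circlepath) (use r in auto)
  then have i2: "contour_integral (circlepath 0 r2) (\<lambda>v. 1 / (v - w)) = 2 * of_real pi * \<i>"
    using contour_integral_unique by fastforce
  have "((\<lambda>u. 1 / (u - w)) has_contour_integral 0) (circlepath 0 r1)"
  proof (rule Cauchy_theorem_convex_simple[of _ "ball 0 (cmod w)"])
    show "(\<lambda>u. 1 / (u - w)) holomorphic_on ball 0 (cmod w)"
      by (intro holomorphic_intros) auto
  qed (use r path_image_circlepath_nonneg[of r1 0] in auto)
  then have i1: "contour_integral (circlepath 0 r1) (\<lambda>v. 1 / (v - w)) = 0"
    using contour_integral_unique by fastforce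
  have "contour_integral (circlepath 0 r1) K = contour_integral (circlepath 0 r2) K"
    by (rule circlepath_integral_shift[OF S K]) (use r sub in auto)
  moreover have "k w = g w / deriv F w"
    by (simp add: k_def E_def)
  ultimately show ?thesis
    using split[of r1] split[of r2] i1 i2 by simp
qed

lemma poly_expansion_degree:
  fixes p :: "nat \<Rightarrow> 'a::field poly"
  assumes p: "\<And>n. degree (p n) = n" "\<And>n. lead_coeff (p n) \<noteq> 0"
    and q: "degree q \<le> n"
  obtains c where "q = (\<Sum>k\<le>n. smult (c k) (p k))"
proof -
  have "\<exists>c. q = (\<Sum>k\<le>n. smult (c k) (p k))"
    using q
  proof (induction n arbitrary: q)
    case 0
    have "coeff (p 0) 0 \<noteq> 0" using p[of 0] by metis
    then have "q = smult (coeff q 0 / coeff (p 0) 0) (p 0)"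
      using 0 p(1)[of 0] by (intro poly_eqI) (metis coeff_smult coeff_eq_0 gr0I le_zero_eq mult_zero_right nonzero_eq_divide_eq)
    then show ?case
      by (intro exI[of _ "\<lambda>_. coeff q 0 / coeff (p 0) 0"]) simp
  next
    case (Suc n)
    define a where "a = coeff q (Suc n) / coeff (p (Suc n)) (Suc n)"
    have nz: "coeff (p (Suc n)) (Suc n) \<noteq> 0" using p[of "Suc n"] by metis
    have "degree (q - smult a (p (Suc n))) \<le> n"
    proof (rule degree_le, intro allI impI)
      fix i assume "n < i"
      then consider "i = Suc n" | "Suc n < i" by linarith
      then show "coeff (q - smult a (p (Suc n))) i = 0"
      proof cases
        case 1 then show ?thesis using nz by (simp add: a_def)
      next
        case 2 then show ?thesis using Suc.prems p(1)[of "Suc n"]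
          by (simp add: coeff_eq_0)
      qed
    qed
    then obtain c where c: "q - smult a (p (Suc n)) = (\<Sum>k\<le>n. smult (c k) (p k))"
      using Suc.IH by blast
    have "q = (\<Sum>k\<le>Suc n. smult ((c(Suc n := a)) k) (p k))"
      using c by (simp add: algebra_simps)
    then show ?case by blast
  qed
  with that show ?thesis by blast
qed

subsection \<open>Geometry of the exterior map\<close>

lemma Ext_eq: "Ext s = - cball 0 s"
  by (auto simp: Ext_def)

lemma open_Ext [simp]: "open (Ext s)"
  by (simp add: Ext_eq open_Compl)

lemma connected_Ext: "connected (Ext s)"
  unfolding Ext_eq by (intro connected_complement_bounded_convex) auto

lemma Ext_mono: "s \<le> t \<Longrightarrow> Ext t \<subseteq> Ext s"
  by (auto simp: Ext_def)

lemma closure_Ext: "0 < s \<Longrightarrow> closure (Ext s) = {w. s \<le> cmod w}"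
  by (auto simp: Ext_eq closure_complement)

lemma Ext_UN: "Ext s = (\<Union>t\<in>{s<..}. Ext t)"
  using dense by (fastforce simp: Ext_def)

text \<open>Radius 1 is admissible through \<open>\<psi>\<close> itself; the work lies in showing
  that univalent continuations survive the passage to the limiting radius.\<close>

lemma rho_hat_attained:
  assumes "\<psi> holomorphic_on Ext 1" "inj_on \<psi> (Ext 1)"
  shows "0 \<le> rho_hat \<psi>" "rho_hat \<psi> \<le> 1"
proof -
  define P where "P s \<longleftrightarrow> 0 \<le> s \<and>
     (\<exists>F. F holomorphic_on Ext s \<and> inj_on F (Ext s) \<and> (\<forall>w\<in>Ext 1. F w = \<psi> w))" for s
  have P1: "P 1"
    unfolding P_def using assms by (intro conjI exI[of _ \<psi>]) auto
  have up: "P t" if "P s" "s \<le> t" for s t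
  proof -
    have "Ext t \<subseteq> Ext s"
      using \<open>s \<le> t\<close> by (auto simp: Ext_def)
    with that show "P t"
      unfolding P_def by (meson holomorphic_on_subset inj_on_subset order_trans)
  qed
  have closed: "P s" if s: "0 \<le> s" "s < 1" "\<And>t. s < t \<Longrightarrow> P t" for s
  proof -
    have "\<forall>t\<in>{s<..}. \<exists>F. F holomorphic_on Ext t \<and> inj_on F (Ext t) \<and> (\<forall>w\<in>Ext 1. F w = \<psi> w)"
      using s by (auto simp: P_def)
    then obtain F where F: "\<And>t. s < t \<Longrightarrow> F t holomorphic_on Ext t"
      "\<And>t. s < t \<Longrightarrow> inj_on (F t) (Ext t)" "\<And>t w. s < t \<Longrightarrow> w \<in> Ext 1 \<Longrightarrow> F t w = \<psi> w"
      by (subst (asm) bchoice_iff) auto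
    obtain H where H: "H holomorphic_on (\<Union>t\<in>{s<..}. Ext t)"
      "\<And>t z. s < t \<Longrightarrow> z \<in> Ext t \<Longrightarrow> H z = F t z"
    proof (rule holomorphic_glue_decreasing[of s Ext "Ext 1" F \<psi>])
      show "Ext 1 \<inter> Ext t \<noteq> {}" if "s < t" for t
      proof -
        have "of_real (\<bar>t\<bar> + 2) \<in> Ext 1 \<inter> Ext t"
          unfolding Ext_def by (simp only: norm_of_real Int_iff mem_Collect_eq) linarith
        then show ?thesis by blast
      qed
          show "Ext t' \<subseteq> Ext t" if "t \<le> t'" for t t'
        using that by (auto simp: Ext_def)
    qed (use F connected_Ext in auto)
    have "inj_on H (Ext s)"
    proof (rule inj_onI)
      fix x y assume xy: "x \<in> Ext s" "y \<in> Ext s" "H x = H y"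
      \<comment> \<open>A radius strictly between \<open>s\<close> and both moduli, so that the
        injectivity of a single \<open>F t\<close> decides.\<close>
      define t where "t = (s + min (cmod x) (cmod y)) / 2"
      have "s < t" "x \<in> Ext t" "y \<in> Ext t"
        using xy by (auto simp: Ext_def t_def min_def)
      then show "x = y"
        using H(2)[of t] F(2)[of t] xy by (metis inj_onD)
    qed
    moreover have "H w = \<psi> w" if "w \<in> Ext 1" for w
      using H(2)[of 1 w] F(3)[of 1 w] that s by simp
    ultimately show "P s" using H(1) s(1) unfolding P_def Ext_UN[of s, symmetric] by auto
  qed
  have low: "0 \<le> t" if "P t" for t
    using that by (simp add: P_def)
  have "rho_hat \<psi> = (LEAST s. P s)"
    unfolding rho_hat_def P_def ..
  with Least_real_attained[of P, OF P1 low up closed] show "0 \<le> rho_hat \<psi>" "rho_hat \<psi> \<le> 1"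
    by (auto simp: P_def)
qed


section \<open>Level sets and inverse of the exterior map\<close>

locale exterior_curve =
  fixes L :: "complex set" and \<psi> :: "complex \<Rightarrow> complex"
  assumes compact_L: "compact L" and exterior_map: "exterior_map L \<psi>"
begin

abbreviation "\<rho>\<^sub>0 \<equiv> rho_hat \<psi>"

lemma psi_holo: "\<psi> holomorphic_on Ext \<rho>\<^sub>0" and psi_inj: "inj_on \<psi> (Ext \<rho>\<^sub>0)"
  and psi_at_infinity: "filterlim \<psi> at_infinity at_infinity"
  and Omega_1: "Omega \<psi> 1 = outside L"
  using exterior_map unfolding exterior_map_def conformal_onto_def Omega_def by auto

lemma rho_hat_ge_0: "0 \<le> \<rho>\<^sub>0" and rho_hat_le_1: "\<rho>\<^sub>0 \<le> 1"
  using exterior_map rho_hat_attained[of \<psi>] unfolding exterior_map_def conformal_onto_def by auto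

lemma psi_eq_iff: "\<rho>\<^sub>0 < cmod v \<Longrightarrow> \<rho>\<^sub>0 < cmod w \<Longrightarrow> \<psi> v = \<psi> w \<longleftrightarrow> v = w"
  using inj_on_eq_iff[OF psi_inj] by (simp add: Ext_def)

lemma psi_cont: "A \<subseteq> Ext \<rho>\<^sub>0 \<Longrightarrow> continuous_on A \<psi>"
  using psi_holo holomorphic_on_imp_continuous_on holomorphic_on_subset by blast

lemma deriv_psi_nz: "\<rho>\<^sub>0 < cmod w \<Longrightarrow> deriv \<psi> w \<noteq> 0"
  using holomorphic_injective_imp_regular[OF psi_holo open_Ext psi_inj] by (simp add: Ext_def)

lemma Omega_subset: "s \<le> t \<Longrightarrow> Omega \<psi> t \<subseteq> Omega \<psi> s"
  by (auto simp: Omega_def Ext_def)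

lemma open_Omega: "\<rho>\<^sub>0 \<le> s \<Longrightarrow> open (Omega \<psi> s)"
  unfolding Omega_def
  by (rule open_mapping_thm3[OF holomorphic_on_subset[OF psi_holo] _ inj_on_subset[OF psi_inj]])
     (use Ext_mono in auto)

lemma connected_Omega: "\<rho>\<^sub>0 \<le> s \<Longrightarrow> connected (Omega \<psi> s)"
  unfolding Omega_def
  by (intro connected_continuous_image psi_cont connected_Ext) (auto simp: Ext_def)

lemma psi_in_Omega_iff: "\<rho>\<^sub>0 < cmod w \<Longrightarrow> \<rho>\<^sub>0 \<le> s \<Longrightarrow> \<psi> w \<in> Omega \<psi> s \<longleftrightarrow> s < cmod w"
  using psi_eq_iff by (fastforce simp: Omega_def Ext_def)

text \<open>\<open>\<psi>\<close> is proper: it tends to infinity at infinity, so a convergent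
  sequence of images comes from a bounded sequence, and a limit point of that sequence still has
  modulus at least \<open>s\<close>, where \<open>\<psi>\<close> is continuous.\<close>

lemma closed_psi_image:
  assumes s: "\<rho>\<^sub>0 < s"
  shows "closed (\<psi> ` {w. s \<le> cmod w})"
  unfolding closed_sequential_limits
proof (intro allI impI, elim conjE)
  fix y z assume "\<forall>n. y n \<in> \<psi> ` {w. s \<le> cmod w}" and yz: "y \<longlonglongrightarrow> z"
  then obtain w where w: "\<And>n. s \<le> cmod (w n)" "\<And>n. y n = \<psi> (w n)"
    unfolding image_iff Bex_def by (metis (mono_tags, lifting) mem_Collect_eq)
  obtain B where B: "\<And>n. cmod (y n) \<le> B"
    using convergent_imp_bounded[OF yz] unfolding bounded_iff by auto
  obtain R where R: "\<And>v. R \<le> cmod v \<Longrightarrow> B + 1 \<le> cmod (\<psi> v)"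
    using psi_at_infinity unfolding filterlim_at_infinity_conv_norm_at_top filterlim_at_top
      eventually_at_infinity by meson
  have "cmod (w n) \<le> R" for n
    using R[of "w n"] B[of n] w(2)[of n] by force
  then have "bounded (range w)"
    by (auto simp: bounded_iff)
  then obtain l k where lk: "strict_mono k" "(w \<circ> k) \<longlonglongrightarrow> l"
    using bounded_imp_convergent_subsequence by blast
  have l: "s \<le> cmod l"
    using lk(2) w(1) by (intro Lim_norm_lbound[OF _ lk(2)]) auto
  have "isCont \<psi> l"
    using psi_cont[OF order_refl] l s continuous_on_eq_continuous_at[OF open_Ext, of "\<rho>\<^sub>0" \<psi>]
    by (simp add: Ext_def)
  then have "(\<lambda>n. \<psi> ((w \<circ> k) n)) \<longlonglongrightarrow> \<psi> l"
    using lk(2) isCont_tendsto_compose by blast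
  moreover have "(\<lambda>n. \<psi> ((w \<circ> k) n)) \<longlonglongrightarrow> z"
    using LIMSEQ_subseq_LIMSEQ[OF yz lk(1)] w(2) by (simp add: o_def)
  ultimately have "z = \<psi> l"
    using LIMSEQ_unique by blast
  with l show "z \<in> \<psi> ` {w. s \<le> cmod w}" by blast
qed

lemma closure_Omega:
  assumes s: "\<rho>\<^sub>0 < s"
  shows "closure (Omega \<psi> s) = \<psi> ` {w. s \<le> cmod w}"
proof
  show "closure (Omega \<psi> s) \<subseteq> \<psi> ` {w. s \<le> cmod w}"
    by (rule closure_minimal[OF _ closed_psi_image[OF s]]) (auto simp: Omega_def Ext_def)
  have "\<psi> ` closure (Ext s) \<subseteq> closure (Omega \<psi> s)"
    unfolding Omega_def
  proof (rule image_closure_subset)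
    show "continuous_on (closure (Ext s)) \<psi>"
      using s rho_hat_ge_0 closure_Ext[of s] by (intro psi_cont) (auto simp: Ext_def[of "\<rho>\<^sub>0"])
  qed (rule closed_closure, rule closure_subset)
  then show "\<psi> ` {w. s \<le> cmod w} \<subseteq> closure (Omega \<psi> s)"
    using s rho_hat_ge_0 by (simp add: closure_Ext)
qed

text \<open>The same gluing as for \<open>rho_hat\<close>, now with the nested sets
  \<open>Omega \<psi> t\<close>; the bound \<open>\<rho>\<^sub>0 \<le> t\<close> is what keeps them
  open and connected.\<close>

lemma rho_attained:
  assumes De: "De holomorphic_on Omega \<psi> 1"
  shows "\<rho>\<^sub>0 \<le> rho \<psi> De" "rho \<psi> De \<le> 1"
proof -
  define P where "P s \<longleftrightarrow> \<rho>\<^sub>0 \<le> s \<and>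
     (\<exists>F. F holomorphic_on Omega \<psi> s \<and> (\<forall>z\<in>Omega \<psi> 1. F z = De z))" for s
  have P1: "P 1"
    unfolding P_def using assms rho_hat_le_1 by (intro conjI exI[of _ De]) auto
  have up: "P t" if "P s" "s \<le> t" for s t
    using that Omega_subset[of s t] unfolding P_def by (meson holomorphic_on_subset order_trans)
  have closed: "P s" if s: "\<rho>\<^sub>0 \<le> s" "s < 1" "\<And>t. s < t \<Longrightarrow> P t" for s
  proof -
    have "\<forall>t\<in>{s<..}. \<exists>F. F holomorphic_on Omega \<psi> t \<and> (\<forall>z\<in>Omega \<psi> 1. F z = De z)"
      using s by (auto simp: P_def)
    then obtain F where F: "\<And>t. s < t \<Longrightarrow> F t holomorphic_on Omega \<psi> t"
      "\<And>t w. s < t \<Longrightarrow> w \<in> Omega \<psi> 1 \<Longrightarrow> F t w = De w"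
      by (subst (asm) bchoice_iff) auto
    obtain H where H: "H holomorphic_on (\<Union>t\<in>{s<..}. Omega \<psi> t)"
      "\<And>t z. s < t \<Longrightarrow> z \<in> Omega \<psi> t \<Longrightarrow> H z = F t z"
    proof (rule holomorphic_glue_decreasing[of s "Omega \<psi>" "Omega \<psi> 1" F De])
      show "Omega \<psi> 1 \<inter> Omega \<psi> t \<noteq> {}" if "s < t" for t
      proof -
        have "of_real (\<bar>t\<bar> + 2) \<in> Ext 1 \<inter> Ext t"
          unfolding Ext_def by (simp only: norm_of_real Int_iff mem_Collect_eq) linarith
        then show ?thesis unfolding Omega_def by blast
      qed
    qed (use F s connected_Omega open_Omega Omega_subset rho_hat_le_1 in auto)
    moreover have "Omega \<psi> s = (\<Union>t\<in>{s<..}. Omega \<psi> t)"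
      unfolding Omega_def Ext_UN[of s] by blast
    ultimately show "P s"
      using H(2)[of 1] F(2)[of 1] s unfolding P_def by auto
  qed
  have low: "\<rho>\<^sub>0 \<le> t" if "P t" for t
    using that by (simp add: P_def)
  have "rho \<psi> De = (LEAST s. P s)"
    unfolding rho_def P_def ..
  with Least_real_attained[of P, OF P1 low up closed] show "\<rho>\<^sub>0 \<le> rho \<psi> De" "rho \<psi> De \<le> 1"
    by (auto simp: P_def)
qed

lemma Lev_eq:
  assumes s: "\<rho>\<^sub>0 < s"
  shows "Lev \<psi> s = \<psi> ` sphere 0 s"
proof -
  have "interior (Omega \<psi> s) = Omega \<psi> s"
    using open_Omega s by (simp add: interior_open)
  then show ?thesis
    using s unfolding Lev_def frontier_def closure_Omega[OF s]
    by (auto simp: psi_in_Omega_iff)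
qed

lemma Lev_1_subset: "Lev \<psi> 1 \<subseteq> L"
  unfolding Lev_def Omega_1 using compact_L compact_imp_closed by (intro frontier_outside_subset)

lemma open_G: "open (G \<psi> s)"
  by (simp add: G_def open_Compl)

lemma in_G_iff: "\<rho>\<^sub>0 < s \<Longrightarrow> z \<in> G \<psi> s \<longleftrightarrow> z \<notin> \<psi> ` {w. s \<le> cmod w}"
  by (simp add: G_def closure_Omega)

lemma psi_in_G_iff: "\<rho>\<^sub>0 < cmod w \<Longrightarrow> \<rho>\<^sub>0 < s \<Longrightarrow> \<psi> w \<in> G \<psi> s \<longleftrightarrow> cmod w < s"
  using psi_eq_iff by (fastforce simp: in_G_iff)

lemma G_mono: "\<rho>\<^sub>0 < s \<Longrightarrow> s \<le> t \<Longrightarrow> G \<psi> s \<subseteq> G \<psi> t"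
  by (fastforce simp: in_G_iff)

text \<open>The bound is written as a product so that it covers \<open>\<rho>\<^sub>0 = 0\<close>,
  where the region is the whole plane, together with the case of a finite outer level curve.\<close>

lemma psi_in_G_recip:
  assumes "\<rho>\<^sub>0 < cmod w" "\<rho>\<^sub>0 * cmod w < 1"
  shows "\<psi> w \<in> G_recip \<psi> \<rho>\<^sub>0"
proof (cases "\<rho>\<^sub>0 = 0")
  case False
  then have "\<rho>\<^sub>0 * \<rho>\<^sub>0 < 1"
    using assms rho_hat_ge_0 mult_left_mono[of "\<rho>\<^sub>0" "cmod w" "\<rho>\<^sub>0"] by linarith
  then have "\<rho>\<^sub>0 < 1 / \<rho>\<^sub>0" "cmod w < 1 / \<rho>\<^sub>0"
    using False rho_hat_ge_0 assms by (auto simp: field_simps)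
  with False assms show ?thesis
    by (simp add: G_recip_def psi_in_G_iff)
qed (simp add: G_recip_def)

lemma phi_psi: "\<rho>\<^sub>0 < cmod w \<Longrightarrow> phi \<psi> (\<psi> w) = w"
  unfolding phi_def by (rule inv_into_f_f[OF psi_inj]) (simp add: Ext_def)

lemma phi_holo: "phi \<psi> holomorphic_on Omega \<psi> \<rho>\<^sub>0"
  and deriv_phi: "\<rho>\<^sub>0 < cmod w \<Longrightarrow> deriv (phi \<psi>) (\<psi> w) = 1 / deriv \<psi> w"
proof -
  obtain g where g: "g holomorphic_on Omega \<psi> \<rho>\<^sub>0"
    "\<And>z. z \<in> Ext \<rho>\<^sub>0 \<Longrightarrow> deriv \<psi> z * deriv g (\<psi> z) = 1" "\<And>z. z \<in> Ext \<rho>\<^sub>0 \<Longrightarrow> g (\<psi> z) = z"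
    using holomorphic_has_inverse[OF psi_holo open_Ext psi_inj] unfolding Omega_def by metis
  have eq: "g z = phi \<psi> z" if "z \<in> Omega \<psi> \<rho>\<^sub>0" for z
    using that g(3) phi_psi by (auto simp: Omega_def Ext_def)
  then show holo: "phi \<psi> holomorphic_on Omega \<psi> \<rho>\<^sub>0"
    using holomorphic_transform[OF g(1)] by blast
  show "deriv (phi \<psi>) (\<psi> w) = 1 / deriv \<psi> w" if w: "\<rho>\<^sub>0 < cmod w"
  proof -
    have "\<psi> w \<in> Omega \<psi> \<rho>\<^sub>0"
      using w by (simp add: psi_in_Omega_iff)
    then have "deriv (phi \<psi>) (\<psi> w) = deriv g (\<psi> w)"
      using complex_derivative_transform_within_open[OF holo g(1) open_Omega] eq by simp
    then show ?thesis
      using g(2)[of w] w deriv_psi_nz[OF w] by (simp add: Ext_def field_simps)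
  qed
qed

end

section \<open>Behaviour at infinity\<close>

locale analytic_exterior_curve = exterior_curve +
  assumes rho_hat_less_1: "\<rho>\<^sub>0 < 1"
begin

text \<open>The complement of \<open>outside L\<close> is bounded, so every far point is some
  \<open>\<psi> w\<close> with \<open>1 < |w|\<close>. It cannot come from the compact annulus up to
  radius \<open>R\<close>, whose image is bounded.\<close>

lemma psi_covers_infinity:
  obtains B where "\<And>z. B < cmod z \<Longrightarrow> \<exists>w. R < cmod w \<and> 1 < cmod w \<and> z = \<psi> w"
proof -
  have "compact {w. 1 \<le> cmod w \<and> cmod w \<le> R}"
  proof -
    have "{w. 1 \<le> cmod w \<and> cmod w \<le> R} = cball 0 R - ball 0 1" by auto
    then show ?thesis using compact_diff[of "cball (0::complex) R" "ball 0 1"] by simp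
  qed
  then have "bounded (\<psi> ` {w. 1 \<le> cmod w \<and> cmod w \<le> R})"
    using rho_hat_less_1
    by (intro compact_imp_bounded compact_continuous_image psi_cont) (auto simp: Ext_def)
  then obtain B1 where B1: "\<And>w. 1 \<le> cmod w \<Longrightarrow> cmod w \<le> R \<Longrightarrow> cmod (\<psi> w) \<le> B1"
    by (auto simp: bounded_iff)
  have "bounded (- outside L)"
    using compact_L by (intro cobounded_outside compact_imp_bounded)
  then obtain B2 where B2: "\<And>z. z \<notin> outside L \<Longrightarrow> cmod z \<le> B2"
    by (auto simp: bounded_iff)
  show thesis
  proof
    fix z assume z: "max B1 B2 < cmod z"
    then have "z \<in> Omega \<psi> 1"
      using B2[of z] Omega_1 by auto
    then obtain w where w: "1 < cmod w" "z = \<psi> w"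
      by (auto simp: Omega_def Ext_def)
    then have "R < cmod w"
      using B1[of w] z by (auto simp: not_less[symmetric])
    then show "\<exists>w. R < cmod w \<and> 1 < cmod w \<and> z = \<psi> w"
      using w by blast
  qed
qed

lemma phi_at_infinity: "filterlim (phi \<psi>) at_infinity at_infinity"
  unfolding filterlim_at_infinity[of 0, OF order_refl]
proof (intro allI impI)
  fix R :: real
  obtain B where "\<And>z. B < cmod z \<Longrightarrow> \<exists>w. R < cmod w \<and> 1 < cmod w \<and> z = \<psi> w"
    using psi_covers_infinity[of R] by blast
  then have "R \<le> cmod (phi \<psi> z)" if "B + 1 \<le> cmod z" for z
    using that phi_psi rho_hat_less_1 by (metis less_add_one less_le_trans less_imp_le less_trans)
  then show "\<forall>\<^sub>F z in at_infinity. R \<le> cmod (phi \<psi> z)"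
    unfolding eventually_at_infinity by blast
qed

lemma psi_phi_at_infinity: "\<forall>\<^sub>F z in at_infinity. 1 < cmod (phi \<psi> z) \<and> \<psi> (phi \<psi> z) = z"
proof -
  obtain B where "\<And>z. B < cmod z \<Longrightarrow> \<exists>w. 1 < cmod w \<and> 1 < cmod w \<and> z = \<psi> w"
    using psi_covers_infinity[of 1] by blast
  then have "1 < cmod (phi \<psi> z) \<and> \<psi> (phi \<psi> z) = z" if "B + 1 \<le> cmod z" for z
    using that phi_psi rho_hat_less_1 by (metis less_add_one less_le_trans less_trans)
  then show ?thesis
    unfolding eventually_at_infinity by blast
qed

text \<open>Both \<open>\<psi>\<close> and \<open>phi \<psi>\<close> tend to infinity at infinity
  and are mutually inverse near it, so values at infinity may be computed in either
  coordinate.\<close>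

lemma tendsto_at_infinity_psi_iff:
  "((\<lambda>w. f (\<psi> w)) \<longlongrightarrow> l) at_infinity \<longleftrightarrow> (f \<longlongrightarrow> l) at_infinity"
proof
  assume "((\<lambda>w. f (\<psi> w)) \<longlongrightarrow> l) at_infinity"
  then have "((\<lambda>z. f (\<psi> (phi \<psi> z))) \<longlongrightarrow> l) at_infinity"
    using phi_at_infinity filterlim_compose by blast
  then show "(f \<longlongrightarrow> l) at_infinity"
    by (rule Lim_transform_eventually) (use psi_phi_at_infinity in \<open>auto elim: eventually_mono\<close>)
next
  assume "(f \<longlongrightarrow> l) at_infinity"
  then show "((\<lambda>w. f (\<psi> w)) \<longlongrightarrow> l) at_infinity"
    using psi_at_infinity filterlim_compose by blast
qed

text \<open>The number \<open>\<psi>'(\<infinity>)\<close>, classically the logarithmic capacity of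
  the curve; \<open>phi'(\<infinity>)\<close> is its reciprocal.\<close>

definition "cap = (SOME c::real. 0 < c \<and> (deriv \<psi> \<longlongrightarrow> of_real c) at_infinity)"

lemma cap_pos: "0 < cap" and deriv_psi_tendsto: "(deriv \<psi> \<longlongrightarrow> of_real cap) at_infinity"
proof -
  have "\<exists>c::real. 0 < c \<and> (deriv \<psi> \<longlongrightarrow> of_real c) at_infinity"
    using exterior_map unfolding exterior_map_def positive_at_inf_def by blast
  then show "0 < cap" "(deriv \<psi> \<longlongrightarrow> of_real cap) at_infinity"
    unfolding cap_def by (metis (mono_tags, lifting) someI_ex)+
qed

lemma deriv_phi_tendsto: "(deriv (phi \<psi>) \<longlongrightarrow> of_real (1 / cap)) at_infinity"
proof -
  have "((\<lambda>w. 1 / deriv \<psi> w) \<longlongrightarrow> 1 / of_real cap) at_infinity"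
    using cap_pos by (intro tendsto_intros deriv_psi_tendsto) auto
  moreover have "\<forall>\<^sub>F w in at_infinity. 1 / deriv \<psi> w = deriv (phi \<psi>) (\<psi> w)"
    unfolding eventually_at_infinity using deriv_phi rho_hat_less_1
    by (intro exI[of _ 1]) force
  ultimately have "((\<lambda>w. deriv (phi \<psi>) (\<psi> w)) \<longlongrightarrow> of_real (1 / cap)) at_infinity"
    using Lim_transform_eventually by fastforce
  then show ?thesis
    by (simp only: tendsto_at_infinity_psi_iff)
qed

text \<open>Only the limit of the derivative is given. Integrating \<open>deriv \<psi> - cap\<close>
  outwards from a large circle bounds the error by a constant plus a small multiple of
  \<open>|w|\<close>, and division by \<open>w\<close> makes both small.\<close>

lemma psi_over_id_tendsto: "((\<lambda>w. \<psi> w / w) \<longlongrightarrow> of_real cap) at_infinity"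
proof (rule tendstoI)
  fix e :: real assume e: "0 < e"
  \<comment> \<open>The constant and the linear part of the error each contribute at most
    \<open>d\<close> after division by \<open>|w|\<close>, and \<open>2 d < e\<close>.\<close>
  define d where "d = e / 3"
  have d: "0 < d" using e by (simp add: d_def)
  obtain R0 where R0: "\<And>w. R0 \<le> cmod w \<Longrightarrow> cmod (deriv \<psi> w - of_real cap) < d"
    using tendstoD[OF deriv_psi_tendsto d] unfolding eventually_at_infinity dist_norm by blast
  define R where "R = max 1 R0"
  have R: "1 \<le> R" "R0 \<le> R" by (auto simp: R_def)
  have "bounded (\<psi> ` sphere 0 R)"
    using R rho_hat_less_1
    by (intro compact_imp_bounded compact_continuous_image psi_cont compact_sphere) (auto simp: Ext_def)
  then obtain B where "\<forall>w\<in>sphere 0 R. cmod (\<psi> w) \<le> B"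
    by (auto simp: bounded_iff)
  then have B: "\<And>w. cmod w = R \<Longrightarrow> cmod (\<psi> w) \<le> B"
    by simp
  have "0 \<le> B"
    using B[of "of_real R"] R norm_ge_zero order_trans by (metis abs_of_nonneg norm_of_real zero_le_one)
  have bound: "cmod (\<psi> w - of_real cap * w) \<le> B + cap * R + d * cmod w" if w: "R \<le> cmod w" for w
  proof -
    \<comment> \<open>Radial projection onto the circle of radius \<open>R\<close>; the segment from
      it to \<open>w\<close> stays where the derivative is close to \<open>cap\<close>.\<close>
    define w0 where "w0 = of_real (R / cmod w) * w"
    have w0: "cmod w0 = R"
      using w R by (auto simp: w0_def norm_mult norm_divide)
    have seg: "R \<le> cmod v" if "v \<in> closed_segment w0 w" for v
    proof -
      obtain u where u: "0 \<le> u" "u \<le> 1" "v = (1 - u) *\<^sub>R w0 + u *\<^sub>R w"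
        using \<open>v \<in> closed_segment w0 w\<close> by (auto simp: closed_segment_def)
      have "v = of_real ((1 - u) * (R / cmod w) + u) * w"
        using u(3) by (simp add: w0_def scaleR_conv_of_real algebra_simps)
      then have "cmod v = \<bar>(1 - u) * (R / cmod w) + u\<bar> * cmod w"
        by (simp only: norm_mult norm_of_real)
      also have "\<dots> = ((1 - u) * (R / cmod w) + u) * cmod w"
        using u R by simp
      also have "\<dots> = (1 - u) * R + u * cmod w"
        using w R by (auto simp: distrib_right)
      also have "\<dots> \<ge> (1 - u) * R + u * R"
        using u w by (intro add_left_mono mult_left_mono) auto
      finally show ?thesis by (simp add: algebra_simps)
    qed
    have "cmod ((\<psi> w - of_real cap * w) - (\<psi> w0 - of_real cap * w0)) \<le> d * cmod (w - w0)"
    proof (rule field_differentiable_bound[where f' = "\<lambda>v. deriv \<psi> v - of_real cap"])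
      fix v assume v: "v \<in> closed_segment w0 w"
      have "(\<psi> has_field_derivative deriv \<psi> v) (at v within closed_segment w0 w)"
        using seg[OF v] R rho_hat_less_1
        by (intro holomorphic_derivI[OF psi_holo open_Ext]) (auto simp: Ext_def)
      then show "((\<lambda>v. \<psi> v - of_real cap * v) has_field_derivative deriv \<psi> v - of_real cap)
          (at v within closed_segment w0 w)"
        by (auto intro!: derivative_eq_intros)
      show "cmod (deriv \<psi> v - of_real cap) \<le> d"
        using R0[of v] seg[OF v] R by auto
    qed auto
    also have "cmod (w - w0) \<le> cmod w"
    proof -
      have "w - w0 = of_real (1 - R / cmod w) * w"
        by (simp add: w0_def algebra_simps)
      then have "cmod (w - w0) = \<bar>1 - R / cmod w\<bar> * cmod w"
        by (simp only: norm_mult norm_of_real)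
      also have "\<dots> \<le> 1 * cmod w"
      proof (rule mult_right_mono)
        have "0 < cmod w" using w R by linarith
        then have "0 \<le> R / cmod w" "R / cmod w \<le> 1"
          using w R by (simp_all add: divide_le_eq_1_pos)
        then show "\<bar>1 - R / cmod w\<bar> \<le> 1" by simp
      qed simp
      finally show ?thesis by simp
    qed
    finally have "cmod ((\<psi> w - of_real cap * w) - (\<psi> w0 - of_real cap * w0)) \<le> d * cmod w"
      using d by simp
    moreover have "cmod (\<psi> w0 - of_real cap * w0) \<le> B + cap * R"
      using norm_triangle_ineq4[of "\<psi> w0" "of_real cap * w0"] B[OF w0] w0 cap_pos
      by (simp add: norm_mult)
    ultimately show ?thesis
      using norm_triangle_ineq[of "(\<psi> w - of_real cap * w) - (\<psi> w0 - of_real cap * w0)"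
          "\<psi> w0 - of_real cap * w0"] by simp
  qed
  have "dist (\<psi> w / w) (of_real cap) < e" if w: "max R ((B + cap * R) / d) \<le> cmod w" for w
  proof -
    have pos: "0 < cmod w" using w R by linarith
    have "\<psi> w / w - of_real cap = (\<psi> w - of_real cap * w) / w"
      using pos by (simp add: field_simps)
    then have "cmod (\<psi> w / w - of_real cap) = cmod (\<psi> w - of_real cap * w) / cmod w"
      by (simp add: norm_divide)
    also have "\<dots> \<le> (B + cap * R + d * cmod w) / cmod w"
      using bound[of w] w by (intro divide_right_mono) auto
    also have "\<dots> \<le> (d * cmod w + d * cmod w) / cmod w"
      using w d by (intro divide_right_mono add_right_mono) (auto simp: field_simps)
    also have "\<dots> = 2 * d" using pos by simp
    also have "\<dots> < e" using e by (simp add: d_def)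
    finally show ?thesis by (simp add: dist_norm)
  qed
  then show "\<forall>\<^sub>F w in at_infinity. dist (\<psi> w / w) (of_real cap) < e"
    unfolding eventually_at_infinity by blast
qed

end

subsection \<open>Szego functions and the kernel\<close>

text \<open>\<open>cnj \<circ> g \<circ> cnj\<close> is holomorphic, and composing it with
  \<open>1 / w\<close> gives the reflected function.\<close>

lemma holomorphic_on_circle_reflection:
  assumes "g holomorphic_on B" "open B" "\<And>w. w \<in> A \<Longrightarrow> w \<noteq> 0 \<and> 1 / cnj w \<in> B"
  shows "(\<lambda>w. cnj (g (1 / cnj w))) holomorphic_on A"
proof -
  have op: "open (cnj ` B)"
    unfolding image_cnj_conv_vimage_cnj
    by (intro open_vimage[OF assms(2)] continuous_intros)
  have "cnj ` cnj ` B = B"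
    by (simp add: image_image)
  then have "cnj \<circ> g \<circ> cnj holomorphic_on cnj ` B"
    using assms(1) op by (intro holomorphic_on_compose_cnj_cnj) auto
  moreover have "(\<lambda>w. 1 / w) ` A \<subseteq> cnj ` B"
  proof
    fix v assume "v \<in> (\<lambda>w. 1 / w) ` A"
    then obtain w where "w \<in> A" "v = cnj (1 / cnj w)" by auto
    then show "v \<in> cnj ` B" using assms(3) by blast
  qed
  moreover have "(\<lambda>w. 1 / w) holomorphic_on A"
    using assms(3) by (intro holomorphic_intros) auto
  ultimately have "(cnj \<circ> g \<circ> cnj) \<circ> (\<lambda>w. 1 / w) holomorphic_on A"
    by (meson holomorphic_on_compose holomorphic_on_subset)
  then show ?thesis by (simp add: o_def)
qed

text \<open>The interior map \<open>f\<close> and the root \<open>q\<close> of its derivative are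
  parameters, because every argument about \<open>W\<close> uses its factorisation through
  them.\<close>

locale szego_data = analytic_exterior_curve L \<psi>
  for L :: "complex set" and \<psi> :: "complex \<Rightarrow> complex" +
  fixes h sq De Di f q :: "complex \<Rightarrow> complex" and W :: "complex \<Rightarrow> complex \<Rightarrow> complex"
    and r :: real and n :: nat
  assumes sqrt_phi: "sqrt_phi_deriv \<psi> sq"
    and exterior_szego: "exterior_szego L h \<psi> De"
    and interior_szego: "interior_szego L h \<psi> Di"
    and interior_map: "interior_map \<psi> f"
    and q_holo: "q holomorphic_on G_recip \<psi> \<rho>\<^sub>0"
    and q_square: "\<And>z. z \<in> G_recip \<psi> \<rho>\<^sub>0 \<Longrightarrow> (q z)\<^sup>2 = deriv f z"
    and W_eq: "\<And>\<zeta> z. \<zeta> \<in> G_recip \<psi> \<rho>\<^sub>0 \<Longrightarrow> z \<in> G_recip \<psi> \<rho>\<^sub>0 \<Longrightarrow>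
      W \<zeta> z = q z * q \<zeta> / (f \<zeta> - f z)"
    and rho_less_r: "rho \<psi> De < r" and r_less_1: "r < 1"
    and contraction:
      "Lam \<psi> sq De Di r * Lam' \<psi> sq De Di r * Mker \<psi> W r * r ^ (2 * n) / (1 / r - r) < 1"
begin

abbreviation "\<rho> \<equiv> rho \<psi> De"

section \<open>The data in the exterior coordinate\<close>

definition "D w = De (\<psi> w)"
definition "S w = sq (\<psi> w)"
definition "iD w = inv_Di \<psi> De Di (\<psi> w)"
text \<open>The densities of the two transforms after the substitution \<open>z = \<psi> w\<close>, where
  \<open>S\<^sup>2 = 1 / \<psi>'\<close>.\<close>

definition "k1 w = D w * Di (\<psi> w) / S w * w ^ n"
definition "k2 w = iD w / (S w * D w * w ^ (n + 1))"

lemma rho_bounds: "\<rho>\<^sub>0 \<le> \<rho>" "\<rho> < r" "r < 1" "0 < r" "1 < 1 / r" "\<rho> < 1" "\<rho>\<^sub>0 < r" "\<rho>\<^sub>0 < 1" "0 \<le> \<rho>"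
  "\<rho>\<^sub>0 / r < 1" "\<rho> / r < 1" "\<rho>\<^sub>0 < 1 / r" "\<rho> < 1 / r"
proof -
  have "De holomorphic_on Omega \<psi> 1"
    using exterior_szego closure_subset holomorphic_on_subset analytic_imp_holomorphic
    unfolding exterior_szego_def by metis
  then show *: "\<rho>\<^sub>0 \<le> \<rho>" by (rule rho_attained)
  then show 1: "\<rho> < r" "r < 1" "0 < r" "\<rho> < 1" "\<rho>\<^sub>0 < r" "\<rho>\<^sub>0 < 1" "0 \<le> \<rho>" "1 < 1 / r"
    "\<rho>\<^sub>0 / r < 1" "\<rho> / r < 1"
    using rho_less_r r_less_1 rho_hat_ge_0 by auto
  show "\<rho>\<^sub>0 < 1 / r" "\<rho> < 1 / r"
    using 1 by linarith+
qed

lemma psi_comp_holo: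
  assumes "g holomorphic_on B" "\<And>w. w \<in> A \<Longrightarrow> \<rho>\<^sub>0 < cmod w \<and> \<psi> w \<in> B"
  shows "(\<lambda>w. g (\<psi> w)) holomorphic_on A"
proof -
  have "\<psi> holomorphic_on A"
    using assms(2) by (intro holomorphic_on_subset[OF psi_holo]) (auto simp: Ext_def)
  then have "g \<circ> \<psi> holomorphic_on A"
    using assms by (intro holomorphic_on_compose_gen[OF _ assms(1)]) auto
  then show ?thesis by (simp add: o_def)
qed

lemma De_holo: "De holomorphic_on Omega \<psi> \<rho>"
  using exterior_szego by (simp add: exterior_szego_def)

lemma D_holo: "D holomorphic_on Ext \<rho>"
  unfolding D_def using rho_bounds
  by (intro psi_comp_holo[OF De_holo]) (auto simp: Ext_def Omega_def)

lemma D_nz: "1 \<le> cmod w \<Longrightarrow> D w \<noteq> 0"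
  using exterior_szego rho_bounds closure_Omega[of 1]
  by (auto simp: exterior_szego_def D_def)

lemma sq_holo: "sq holomorphic_on Omega \<psi> \<rho>\<^sub>0"
  using sqrt_phi by (simp add: sqrt_phi_deriv_def)

lemma S_holo: "S holomorphic_on Ext \<rho>\<^sub>0"
  unfolding S_def by (intro psi_comp_holo[OF sq_holo]) (auto simp: Ext_def Omega_def)

lemma S_square: "\<rho>\<^sub>0 < cmod w \<Longrightarrow> (S w)\<^sup>2 = 1 / deriv \<psi> w"
  using sqrt_phi deriv_phi[of w] psi_in_Omega_iff[of w "\<rho>\<^sub>0"] by (auto simp: sqrt_phi_deriv_def S_def)

lemma S_nz: "\<rho>\<^sub>0 < cmod w \<Longrightarrow> S w \<noteq> 0"
  using S_square[of w] deriv_psi_nz[of w] by auto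

lemma deriv_psi_S: "\<rho>\<^sub>0 < cmod w \<Longrightarrow> deriv \<psi> w = 1 / (S w)\<^sup>2"
  using S_square[of w] by simp

definition "dinf = (SOME c::real. c > 0 \<and> (De \<longlongrightarrow> of_real c) at_infinity)"

lemma dinf: "0 < dinf" "(De \<longlongrightarrow> of_real dinf) at_infinity" "(D \<longlongrightarrow> of_real dinf) at_infinity"
proof -
  have "\<exists>c::real. 0 < c \<and> (De \<longlongrightarrow> of_real c) at_infinity"
    using exterior_szego unfolding exterior_szego_def positive_at_inf_def by blast
  then show "0 < dinf" and *: "(De \<longlongrightarrow> of_real dinf) at_infinity"
    unfolding dinf_def by (metis (mono_tags, lifting) someI_ex)+
  then show "(D \<longlongrightarrow> of_real dinf) at_infinity"
    unfolding D_def using tendsto_at_infinity_psi_iff[of De] by simp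
qed

text \<open>\<open>S_square\<close> fixes the limit up to sign only; the normalisation of the root
  at infinity selects the positive one.\<close>

lemma S_tendsto: "(S \<longlongrightarrow> of_real (sqrt (1 / cap))) at_infinity"
proof -
  obtain s :: real where s: "0 < s" "(sq \<longlongrightarrow> of_real s) at_infinity"
    using sqrt_phi unfolding sqrt_phi_deriv_def positive_at_inf_def by blast
  then have S: "(S \<longlongrightarrow> of_real s) at_infinity"
    unfolding S_def using tendsto_at_infinity_psi_iff[of sq] by simp
  then have "((\<lambda>w. (S w)\<^sup>2) \<longlongrightarrow> (of_real s)\<^sup>2) at_infinity"
    by (intro tendsto_intros)
  moreover have "\<forall>\<^sub>F w in at_infinity. (S w)\<^sup>2 = 1 / deriv \<psi> w"
    unfolding eventually_at_infinity using S_square rho_bounds by (intro exI[of _ 1]) auto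
  ultimately have "((\<lambda>w. 1 / deriv \<psi> w) \<longlongrightarrow> (of_real s)\<^sup>2) at_infinity"
    using Lim_transform_eventually by fastforce
  moreover have "((\<lambda>w. 1 / deriv \<psi> w) \<longlongrightarrow> 1 / of_real cap) at_infinity"
    using cap_pos by (intro tendsto_intros deriv_psi_tendsto) auto
  ultimately have "(of_real s)\<^sup>2 = (1 / of_real cap :: complex)"
    using tendsto_unique[OF trivial_limit_at_infinity] by blast
  then have "of_real (s\<^sup>2) = (of_real (1 / cap) :: complex)" by simp
  then have "s\<^sup>2 = 1 / cap" using of_real_eq_iff by blast
  then have "s = sqrt (1 / cap)"
    using s(1) by (metis less_imp_le real_sqrt_unique)
  then show ?thesis
    using S by auto
qed

text \<open>The points to be reached are those of the curve. As \<open>\<rho>\<^sub>0 < 1\<close>,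
  \<open>\<psi>\<close> is defined on both sides of the unit circle, and \<open>\<psi> w\<close> is
  approached by \<open>\<psi> v\<close> with \<open>|v|\<close> slightly below 1. The case
  distinction in \<open>inv_Di\<close> thereby becomes \<open>|w| \<le> 1\<close>.\<close>

lemma closure_G_1: "closure (G \<psi> 1) = - Omega \<psi> 1"
proof
  show "closure (G \<psi> 1) \<subseteq> - Omega \<psi> 1"
    using open_Omega[of 1] rho_bounds closure_subset[of "Omega \<psi> 1"]
    by (intro closure_minimal) (auto simp: G_def)
  show "- Omega \<psi> 1 \<subseteq> closure (G \<psi> 1)"
  proof
    fix z assume z: "z \<in> - Omega \<psi> 1"
    show "z \<in> closure (G \<psi> 1)"
    proof (cases "z \<in> G \<psi> 1")
      case True then show ?thesis using closure_subset by blast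
    next
      case False
      then obtain w where w: "1 \<le> cmod w" "z = \<psi> w"
        using in_G_iff[of 1 z] rho_bounds by auto
      with z have w1: "cmod w = 1"
        using psi_in_Omega_iff[of w 1] rho_bounds by auto
      show ?thesis
      proof (rule ccontr)
        assume "z \<notin> closure (G \<psi> 1)"
        then have "w \<in> Ext \<rho>\<^sub>0 \<inter> \<psi> -` (- closure (G \<psi> 1))"
          using w w1 rho_bounds by (simp add: Ext_def)
        moreover have "open (Ext \<rho>\<^sub>0 \<inter> \<psi> -` (- closure (G \<psi> 1)))"
          using psi_cont[OF order_refl] by (intro continuous_open_preimage) auto
        ultimately obtain e where e: "0 < e" "ball w e \<subseteq> Ext \<rho>\<^sub>0 \<inter> \<psi> -` (- closure (G \<psi> 1))"
          by (metis openE)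
        define d where "d = min (e / 2) ((1 - \<rho>\<^sub>0) / 2)"
        have d: "0 < d" "d < e" "d < 1" "\<rho>\<^sub>0 < 1 - d"
          using e rho_bounds rho_hat_ge_0 by (auto simp: d_def min_def field_simps)
        define v where "v = of_real (1 - d) * w"
        have v: "cmod v = 1 - d"
          using d w1 by (simp add: v_def norm_mult del: of_real_diff)
        have "w - v = of_real d * w"
          by (simp add: v_def algebra_simps)
        then have "dist w v = d"
          using d w1 by (simp add: dist_norm norm_mult)
        then have "\<psi> v \<notin> closure (G \<psi> 1)"
          using e d by (auto simp: subset_iff)
        moreover have "\<psi> v \<in> G \<psi> 1"
          using psi_in_G_iff[of v 1] v d rho_bounds by auto
        ultimately show False
          using closure_subset by blast
      qed
    qed
  qed
qed

lemma psi_in_closure_G_1: "\<rho>\<^sub>0 < cmod w \<Longrightarrow> \<psi> w \<in> closure (G \<psi> 1) \<longleftrightarrow> cmod w \<le> 1"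
  using psi_in_Omega_iff[of w 1] rho_bounds by (auto simp: closure_G_1)

lemma Di_nbhd:
  obtains N where "open N" "closure (G \<psi> 1) \<subseteq> N" "Di holomorphic_on N" "\<And>z. z \<in> N \<Longrightarrow> Di z \<noteq> 0"
proof -
  have "Di analytic_on closure (G \<psi> 1)" and nz: "\<And>z. z \<in> closure (G \<psi> 1) \<Longrightarrow> Di z \<noteq> 0"
    using interior_szego by (auto simp: interior_szego_def)
  then obtain N where N: "open N" "closure (G \<psi> 1) \<subseteq> N" "Di holomorphic_on N"
    unfolding analytic_on_holomorphic by auto
  have "N \<inter> Di -` (- {0}) = {z \<in> N. Di z \<noteq> 0}" by auto
  moreover have "open (N \<inter> Di -` (- {0}))"
    using N by (intro continuous_open_preimage holomorphic_on_imp_continuous_on) auto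
  ultimately have "open {z \<in> N. Di z \<noteq> 0}" by simp
  then show thesis
    by (rule that) (use N nz in \<open>auto intro: holomorphic_on_subset\<close>)
qed

lemma Di_holo: "Di holomorphic_on closure (G \<psi> 1)"
  using interior_szego analytic_imp_holomorphic by (auto simp: interior_szego_def)

lemma Di_nz: "z \<in> closure (G \<psi> 1) \<Longrightarrow> Di z \<noteq> 0"
  using interior_szego by (auto simp: interior_szego_def)

lemma weight_eq:
  assumes "cmod w = 1"
  shows "h (\<psi> w) = of_real (1 / (cmod (D w))\<^sup>2)" "h (\<psi> w) = of_real ((cmod (Di (\<psi> w)))\<^sup>2)"
proof -
  have "\<psi> w \<in> L"
    using assms Lev_1_subset Lev_eq[of 1] rho_bounds by auto
  then show "h (\<psi> w) = of_real (1 / (cmod (D w))\<^sup>2)" "h (\<psi> w) = of_real ((cmod (Di (\<psi> w)))\<^sup>2)"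
    using exterior_szego interior_szego by (auto simp: exterior_szego_def interior_szego_def D_def)
qed

lemma iD_inside: "\<rho>\<^sub>0 < cmod w \<Longrightarrow> cmod w \<le> 1 \<Longrightarrow> iD w = 1 / Di (\<psi> w)"
  by (simp add: iD_def inv_Di_def psi_in_closure_G_1)

lemma iD_outside:
  assumes "1 < cmod w"
  shows "iD w = D w * cnj (D (1 / cnj w)) * cnj (Di (\<psi> (1 / cnj w)))"
  using assms rho_bounds psi_in_closure_G_1[of w] phi_psi[of w]
  by (simp add: iD_def inv_Di_def refl_star_def D_def)

lemma open_annulus: "open {w::complex. a < cmod w \<and> a * cmod w < 1}"
  by (intro open_Collect_conj open_Collect_less continuous_intros)

text \<open>Schwarz reflection. On the unit circle the two formulas in \<open>inv_Di\<close> agree,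
  since there \<open>|De|^2 = 1 / h\<close> and \<open>|Di|^2 = h\<close>. Each is holomorphic on
  both sides of the circle, so the identity theorem makes them agree near it.\<close>

lemma iD_holo: "iD holomorphic_on {w. \<rho> < cmod w \<and> \<rho> * cmod w < 1}"
proof -
  let ?A = "{w. \<rho> < cmod w \<and> \<rho> * cmod w < 1}"
  obtain N where N: "open N" "closure (G \<psi> 1) \<subseteq> N" "Di holomorphic_on N" "\<And>z. z \<in> N \<Longrightarrow> Di z \<noteq> 0"
    using Di_nbhd by blast
  have refl: "1 / cnj w \<in> ?A" if "w \<in> ?A" for w
    using that rho_bounds by (auto simp: norm_divide divide_simps mult.commute)
  define P where "P w = 1 / Di (\<psi> w)" for w
  define R where "R w = D w * cnj (D (1 / cnj w)) * cnj (Di (\<psi> (1 / cnj w)))" for w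
  \<comment> \<open>\<open>Di\<close> is known to be analytic only on some neighbourhood of the
    closed interior. \<open>V\<close> and its mirror image \<open>V'\<close> are the open sets on
    which the inner and the outer formula make sense; they cover \<open>|w| \<le> 1\<close> and
    \<open>|w| \<ge> 1\<close> within the annulus.\<close>
  define V where "V = ?A \<inter> \<psi> -` N"
  define V' where "V' = ?A \<inter> (\<lambda>w. 1 / cnj w) -` V"
  have cont: "continuous_on ?A \<psi>"
    using rho_bounds by (intro psi_cont) (auto simp: Ext_def)
  have oV: "open V"
    unfolding V_def by (rule continuous_open_preimage[OF cont open_annulus N(1)])
  have oV': "open V'"
    unfolding V'_def using rho_bounds
    by (intro continuous_open_preimage[OF _ open_annulus oV] continuous_intros) auto
  have P: "P holomorphic_on V"
    unfolding P_def using N rho_bounds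
    by (intro holomorphic_intros psi_comp_holo[OF N(3)]) (auto simp: V_def)
  have Di_psi: "(\<lambda>w. Di (\<psi> w)) holomorphic_on V"
    using rho_bounds by (intro psi_comp_holo[OF N(3)]) (auto simp: V_def)
  have R: "R holomorphic_on V'"
    unfolding R_def
  proof (intro holomorphic_on_mult)
    have V': "w \<noteq> 0" "w \<in> Ext \<rho>" "1 / cnj w \<in> Ext \<rho>" "1 / cnj w \<in> V" if "w \<in> V'" for w
      using that rho_bounds refl[of w] by (auto simp: V'_def Ext_def)
    show "D holomorphic_on V'"
      using V' by (intro holomorphic_on_subset[OF D_holo]) blast
    show "(\<lambda>w. cnj (D (1 / cnj w))) holomorphic_on V'"
      by (rule holomorphic_on_circle_reflection[OF D_holo open_Ext]) (use V' in blast)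
    show "(\<lambda>w. cnj (Di (\<psi> (1 / cnj w)))) holomorphic_on V'"
      by (rule holomorphic_on_circle_reflection[OF Di_psi oV]) (use V' in blast)
  qed
  have inV: "w \<in> V" if "w \<in> ?A" "cmod w \<le> 1" for w
    using that N(2) psi_in_closure_G_1[of w] rho_bounds by (auto simp: V_def)
  have inV': "w \<in> V'" if "w \<in> ?A" "1 \<le> cmod w" for w
  proof -
    have "1 / cnj w \<in> V"
      using that rho_bounds by (intro inV refl) (auto simp: norm_divide divide_simps)
    then show ?thesis using that by (simp add: V'_def)
  qed
  have PR: "P w = R w" if w: "cmod w = 1" for w
  proof -
    have "w * cnj w = 1" using w by (simp add: complex_norm_square[symmetric])
    then have "1 / cnj w = w" by (metis div_by_1 mult_cancel_right2 nonzero_divide_eq_eq one_neq_zero mult_zero_right)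
    moreover have "Di (\<psi> w) \<noteq> 0"
      using w psi_in_closure_G_1[of w] rho_bounds by (intro Di_nz) auto
    moreover have "D w * cnj (D w) * (Di (\<psi> w) * cnj (Di (\<psi> w))) = 1"
      unfolding complex_norm_square[symmetric]
      using weight_eq[OF w] D_nz[of w] w by (auto simp: field_simps)
    ultimately show ?thesis
      by (simp add: P_def R_def field_simps)
  qed
  have "iD field_differentiable at w" if w: "w \<in> ?A" for w
  proof -
    consider "cmod w < 1" | "1 < cmod w" | "cmod w = 1" by linarith
    then show ?thesis
    proof cases
      case 1
      have "iD holomorphic_on ?A \<inter> ball 0 1"
        using inV rho_bounds iD_inside
        by (intro holomorphic_transform[OF holomorphic_on_subset[OF P]]) (auto simp: P_def)
      then show ?thesis
        using w 1 open_annulus by (elim holomorphic_on_imp_differentiable_at) auto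
    next
      case 2
      have "iD holomorphic_on ?A \<inter> Ext 1"
        using inV' iD_outside
        by (intro holomorphic_transform[OF holomorphic_on_subset[OF R]]) (auto simp: R_def Ext_def)
      then show ?thesis
        using w 2 open_Int[OF open_annulus open_Ext]
        by (elim holomorphic_on_imp_differentiable_at) (auto simp: Ext_def)
    next
      case 3
      have "w \<in> V \<inter> V'" using inV inV' w 3 by auto
      then obtain e where e: "0 < e" "ball w e \<subseteq> V \<inter> V'"
        using openE[of "V \<inter> V'" w] oV oV' by blast
      \<comment> \<open>The arc on which \<open>P\<close> and \<open>R\<close> agree accumulates at
        \<open>w\<close>, as the identity theorem requires.\<close>
      have lim: "w islimpt (sphere 0 1 \<inter> ball w e)"
      proof (rule islimpt_Int_eventually)
        show "w islimpt sphere 0 1"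
        proof (intro connected_imp_perfect connected_sphere)
          have "(1::complex) \<in> sphere 0 1" "(- 1 :: complex) \<in> sphere 0 1" by auto
          then show "sphere 0 1 \<noteq> {x}" for x :: complex
            by (metis one_neq_neg_one singletonD)
        qed (use 3 in auto)
        show "\<forall>\<^sub>F y in at w. y \<in> ball w e"
          using eventually_at_ball[OF e(1), of w UNIV] by simp
      qed
      have PR_holo: "P holomorphic_on ball w e" "R holomorphic_on ball w e"
        using e(2) by (auto intro: holomorphic_on_subset[OF P] holomorphic_on_subset[OF R])
      have eq: "P v = R v" if v: "v \<in> ball w e" for v
      proof -
        have "P v - R v = 0"
          by (rule analytic_continuation[of "\<lambda>v. P v - R v" "ball w e" "sphere 0 1 \<inter> ball w e" w])
             (use e v PR lim PR_holo in \<open>auto intro!: holomorphic_intros\<close>)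
        then show ?thesis by simp
      qed
      have "iD v = P v" if v: "v \<in> ball w e" for v
      proof (cases "cmod v \<le> 1")
        case True
        then show ?thesis using v e iD_inside[of v] rho_bounds by (auto simp: P_def V_def)
      next
        case False
        then show ?thesis using iD_outside[of v] eq[OF v] by (simp add: R_def)
      qed
      then have "iD holomorphic_on ball w e"
        by (intro holomorphic_transform[OF PR_holo(1)]) auto
      then show ?thesis
        using e by (elim holomorphic_on_imp_differentiable_at) auto
    qed
  qed
  then show ?thesis
    unfolding holomorphic_on_def by (simp add: field_differentiable_at_within)
qed


section \<open>The interior map and the kernel in the exterior coordinate\<close>

abbreviation "GR \<equiv> G_recip \<psi> \<rho>\<^sub>0"
abbreviation "Ann \<equiv> {w. \<rho>\<^sub>0 < cmod w \<and> \<rho>\<^sub>0 * cmod w < 1}"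

definition "F w = f (\<psi> w)"

lemma open_GR: "open GR"
  by (simp add: G_recip_def open_G)

lemma f_holo: "f holomorphic_on GR" and f_inj: "inj_on f GR"
  and f_disc: "f ` G \<psi> 1 = ball 0 1"
  using interior_map by (auto simp: interior_map_def conformal_onto_def)

lemma G_1_subset_GR: "G \<psi> 1 \<subseteq> GR"
proof (cases "\<rho>\<^sub>0 = 0")
  case False
  then show ?thesis
    using G_mono[of 1 "1 / \<rho>\<^sub>0"] rho_bounds rho_hat_ge_0 by (simp add: G_recip_def)
qed (simp add: G_recip_def)

lemma psi_Ann: "w \<in> Ann \<Longrightarrow> \<psi> w \<in> GR"
  by (simp add: psi_in_G_recip)

lemma sphere_Ann: "r \<le> cmod w \<Longrightarrow> cmod w \<le> 1 / r \<Longrightarrow> w \<in> Ann"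
proof -
  assume w: "r \<le> cmod w" "cmod w \<le> 1 / r"
  have "\<rho>\<^sub>0 * cmod w \<le> \<rho>\<^sub>0 * (1 / r)"
    using w rho_hat_ge_0 by (intro mult_left_mono) auto
  also have "\<dots> < 1" using rho_bounds by simp
  finally show ?thesis using w rho_bounds by auto
qed

lemma sphere_annulus: "r \<le> cmod w \<Longrightarrow> cmod w \<le> 1 / r \<Longrightarrow> \<rho> < cmod w \<and> \<rho> * cmod w < 1"
proof -
  assume w: "r \<le> cmod w" "cmod w \<le> 1 / r"
  have "\<rho> * cmod w \<le> \<rho> * (1 / r)"
    using w rho_bounds by (intro mult_left_mono) auto
  also have "\<dots> < 1" using rho_bounds by simp
  finally show ?thesis using w rho_bounds by auto
qed

lemma F_holo: "F holomorphic_on Ann"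
  unfolding F_def by (rule psi_comp_holo[OF f_holo]) (use psi_Ann in auto)

lemma qpsi_holo: "(\<lambda>w. q (\<psi> w)) holomorphic_on Ann"
  by (rule psi_comp_holo[OF q_holo]) (use psi_Ann in auto)

lemma F_inj: "inj_on F Ann"
proof (rule inj_onI)
  fix v w assume vw: "v \<in> Ann" "w \<in> Ann" "F v = F w"
  then have "\<psi> v = \<psi> w"
    using inj_onD[OF f_inj, of "\<psi> v" "\<psi> w"] psi_Ann by (simp add: F_def)
  then show "v = w" using vw psi_eq_iff by simp
qed

lemma deriv_F:
  assumes "w \<in> Ann"
  shows "deriv F w = (q (\<psi> w))\<^sup>2 * deriv \<psi> w"
proof -
  have "\<psi> field_differentiable at w"
    using holomorphic_on_imp_differentiable_at[OF psi_holo open_Ext] assms by (simp add: Ext_def)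
  moreover have "f field_differentiable at (\<psi> w)"
    using holomorphic_on_imp_differentiable_at[OF f_holo open_GR] psi_Ann[OF assms] by simp
  ultimately have "deriv (f \<circ> \<psi>) w = deriv f (\<psi> w) * deriv \<psi> w"
    by (rule deriv_chain)
  moreover have "f \<circ> \<psi> = F" by (auto simp: F_def)
  ultimately show ?thesis
    using q_square[OF psi_Ann[OF assms]] by simp
qed

text \<open>The neighbourhood on which \<open>Di\<close> is analytic is unspecified, hence the
  obtained \<open>V\<close>. Its bound \<open>1 / r\<close> keeps it off the circle across which
  \<open>eta\<close> will jump.\<close>

lemma k1_holo:
  obtains V where "open V" "{w. r \<le> cmod w \<and> cmod w \<le> 1} \<subseteq> V" "V \<subseteq> Ann" "k1 holomorphic_on V"
    "\<And>w. w \<in> V \<Longrightarrow> cmod w < 1 / r"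
proof -
  obtain N where N: "open N" "closure (G \<psi> 1) \<subseteq> N" "Di holomorphic_on N" "\<And>z. z \<in> N \<Longrightarrow> Di z \<noteq> 0"
    using Di_nbhd by blast
  define V where "V = (Ext \<rho> \<inter> ball 0 (1 / r)) \<inter> \<psi> -` N"
  have V: "w \<in> V \<longleftrightarrow> \<rho> < cmod w \<and> cmod w < 1 / r \<and> \<psi> w \<in> N" for w
    by (auto simp: V_def Ext_def)
  show thesis
  proof
    show "open V"
      unfolding V_def using rho_bounds N
      by (intro continuous_open_preimage psi_cont open_Int open_Ext) (auto simp: Ext_def)
    show "{w. r \<le> cmod w \<and> cmod w \<le> 1} \<subseteq> V"
    proof
      fix w assume w: "w \<in> {w. r \<le> cmod w \<and> cmod w \<le> 1}"
      then have "cmod w < 1 / r"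
        using rho_bounds(5) by (simp only: mem_Collect_eq) linarith
      then show "w \<in> V"
        using w N(2) psi_in_closure_G_1[of w] rho_bounds by (auto simp: V)
    qed
    show "V \<subseteq> Ann"
    proof
      fix w assume w: "w \<in> V"
      then have "\<rho>\<^sub>0 * cmod w \<le> \<rho>\<^sub>0 * (1 / r)"
        using rho_hat_ge_0 by (intro mult_left_mono) (auto simp: V)
      also have "\<dots> < 1" using rho_bounds by simp
      finally show "w \<in> Ann" using w rho_bounds by (auto simp: V)
    qed
    have "(\<lambda>w. Di (\<psi> w)) holomorphic_on V"
      by (rule psi_comp_holo[OF N(3)]) (use rho_bounds V in auto)
    then show "k1 holomorphic_on V"
      unfolding k1_def using rho_bounds S_nz
      by (intro holomorphic_intros holomorphic_on_subset[OF D_holo] holomorphic_on_subset[OF S_holo])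
         (auto simp: V Ext_def)
  qed (simp add: V)
qed

lemma k1_cont_sphere: "r \<le> s \<Longrightarrow> s \<le> 1 \<Longrightarrow> continuous_on (sphere 0 s) k1"
proof -
  assume s: "r \<le> s" "s \<le> 1"
  obtain V where V: "{w. r \<le> cmod w \<and> cmod w \<le> 1} \<subseteq> V" "k1 holomorphic_on V"
    using k1_holo by metis
  have "sphere 0 s \<subseteq> V" using V(1) s by auto
  then show ?thesis
    using V(2) by (meson holomorphic_on_imp_continuous_on holomorphic_on_subset)
qed

text \<open>\<open>De\<close> has no zeros on the closed exterior but may have some further in, so
  they are removed; zeros of the continued \<open>1 / Di\<close> sit in the numerator and do no
  harm.\<close>

lemma k2_holo: "k2 holomorphic_on {w. \<rho> < cmod w \<and> \<rho> * cmod w < 1 \<and> D w \<noteq> 0}" (is "_ holomorphic_on ?V")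
  and open_k2_domain: "open {w. \<rho> < cmod w \<and> \<rho> * cmod w < 1 \<and> D w \<noteq> 0}"
proof -
  have nz: "S w * D w * w ^ (n + 1) \<noteq> 0" if w: "w \<in> ?V" for w
  proof -
    have "\<rho>\<^sub>0 < cmod w" "w \<noteq> 0" "D w \<noteq> 0"
      using w rho_bounds by auto
    then show ?thesis using S_nz[of w] by simp
  qed
  have "?V \<subseteq> Ext \<rho>" "?V \<subseteq> Ext \<rho>\<^sub>0" "?V \<subseteq> {w. \<rho> < cmod w \<and> \<rho> * cmod w < 1}"
    using rho_bounds by (auto simp: Ext_def)
  then show "k2 holomorphic_on ?V"
    unfolding k2_def using nz
    by (intro holomorphic_on_divide holomorphic_on_mult holomorphic_on_power holomorphic_on_ident
        holomorphic_on_subset[OF D_holo] holomorphic_on_subset[OF S_holo] holomorphic_on_subset[OF iD_holo])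
  have "?V = {w. \<rho> < cmod w \<and> \<rho> * cmod w < 1} \<inter> D -` (- {0})" by auto
  moreover have "open \<dots>"
    using holomorphic_on_imp_continuous_on[OF D_holo]
    by (intro continuous_open_preimage[OF _ open_annulus]) (auto simp: Ext_def elim: continuous_on_subset)
  ultimately show "open ?V" by simp
qed

lemma k2_cont_sphere: "1 \<le> s \<Longrightarrow> s \<le> 1 / r \<Longrightarrow> continuous_on (sphere 0 s) k2"
proof -
  assume s: "1 \<le> s" "s \<le> 1 / r"
  have "\<rho> < cmod w \<and> \<rho> * cmod w < 1 \<and> D w \<noteq> 0" if "cmod w = s" for w
    using that s sphere_annulus[of w] D_nz[of w] rho_bounds by auto
  then show ?thesis
    by (intro holomorphic_on_imp_continuous_on holomorphic_on_subset[OF k2_holo]) auto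
qed

text \<open>\<open>W\<close> factors into \<open>q z\<close> and
  \<open>q (\<psi> w) / (F w - f z)\<close>, so the transform is \<open>q z\<close> times a
  Cauchy-type integral evaluated at \<open>f z\<close>. Injectivity of \<open>f\<close> keeps
  \<open>f z\<close> off the image of the contour.\<close>

lemma W_transform_holo:
  assumes d: "continuous_on (sphere 0 s) d" and s: "\<rho>\<^sub>0 < s" "\<rho>\<^sub>0 * s < 1"
  shows "(\<lambda>z. contour_integral (circlepath 0 s) (\<lambda>w. d w * W (\<psi> w) z)) holomorphic_on GR - \<psi> ` sphere 0 s"
proof -
  let ?U = "GR - \<psi> ` sphere 0 s"
  have s0: "0 < s" using s rho_hat_ge_0 by linarith
  have sub: "sphere 0 s \<subseteq> Ann" using s by auto
  have comp: "compact (F ` sphere 0 s)"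
    by (intro compact_continuous_image holomorphic_on_imp_continuous_on
        holomorphic_on_subset[OF F_holo] sub compact_sphere)
  have fU: "f z \<notin> F ` sphere 0 s" if "z \<in> ?U" for z
    using inj_onD[OF f_inj] that psi_Ann sub unfolding F_def by blast
  define H where "H u = contour_integral (circlepath 0 s) (\<lambda>w. d w * q (\<psi> w) / (F w - u))" for u
  have H: "H holomorphic_on - F ` sphere 0 s"
    unfolding H_def
    by (intro holomorphic_contour_integral_param continuous_intros d holomorphic_on_imp_continuous_on
        holomorphic_on_subset[OF qpsi_holo] holomorphic_on_subset[OF F_holo] sub)
       (use s0 comp in \<open>auto intro: compact_imp_closed\<close>)
  have "H \<circ> f holomorphic_on ?U"
    by (rule holomorphic_on_compose_gen[OF holomorphic_on_subset[OF f_holo] H]) (use fU in auto)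
  then have "(\<lambda>z. q z * (H \<circ> f) z) holomorphic_on ?U"
    by (intro holomorphic_on_mult holomorphic_on_subset[OF q_holo]) (auto simp: o_def)
  moreover have "q z * (H \<circ> f) z = contour_integral (circlepath 0 s) (\<lambda>w. d w * W (\<psi> w) z)"
    if z: "z \<in> ?U" for z
  proof -
    have "contour_integral (circlepath 0 s) (\<lambda>w. d w * W (\<psi> w) z) =
       contour_integral (circlepath 0 s) (\<lambda>w. q z * (d w * q (\<psi> w) / (F w - f z)))"
    proof (rule contour_integral_cong[OF refl])
      fix w assume "w \<in> path_image (circlepath 0 s)"
      then have "w \<in> Ann" using sub s0 path_image_circlepath_nonneg[of s 0] by auto
      then show "d w * W (\<psi> w) z = q z * (d w * q (\<psi> w) / (F w - f z))"
        using W_eq[OF psi_Ann, of w z] z by (simp add: F_def)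
    qed
    also have "\<dots> = q z * contour_integral (circlepath 0 s) (\<lambda>w. d w * q (\<psi> w) / (F w - f z))"
    proof (intro contour_integral_lmul continuous_on_contour_integrable_circlepath continuous_intros d
        holomorphic_on_imp_continuous_on holomorphic_on_subset[OF qpsi_holo] holomorphic_on_subset[OF F_holo] sub)
      show "\<forall>w\<in>sphere 0 s. F w - f z \<noteq> 0"
        using fU[OF z] by (metis eq_iff_diff_eq_0 imageI)
    qed (use s0 in auto)
    finally show ?thesis by (simp add: H_def)
  qed
  ultimately show ?thesis
    by (rule holomorphic_transform)
qed

lemma cauchy_transform_holo:
  assumes d: "continuous_on (sphere 0 s) d" and s: "0 < s"
  shows "(\<lambda>w. contour_integral (circlepath 0 s) (\<lambda>v. d v / (v - w))) holomorphic_on - sphere 0 s"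
  using s by (intro holomorphic_contour_integral_param d continuous_intros) auto

section \<open>The transforms as integrals over circles\<close>

abbreviation "g \<equiv> gtr \<psi> sq De Di W r n"

text \<open>The substitution brings in the factor \<open>\<psi>' = 1 / S^2\<close>, which turns
  \<open>sq\<close> into \<open>1 / S\<close>; this is why \<open>Lam\<close> has the root in its
  denominator.\<close>

lemma gtr_odd:
  "g (Suc (2 * k)) z = - (1 / (2 * of_real pi * \<i>)) *
     contour_integral (circlepath 0 r) (\<lambda>w. (g (2 * k) (\<psi> w) * k1 w) * W (\<psi> w) z)"
proof -
  have "contour_integral (Lev_path \<psi> r)
           (\<lambda>\<zeta>. g (2 * k) \<zeta> * De \<zeta> * Di \<zeta> * W \<zeta> z * sq \<zeta> * phi \<psi> \<zeta> ^ n) =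
        contour_integral (circlepath 0 r) (\<lambda>w. g (2 * k) (\<psi> w) * De (\<psi> w) * Di (\<psi> w) * W (\<psi> w) z
            * sq (\<psi> w) * phi \<psi> (\<psi> w) ^ n * deriv \<psi> w)"
    unfolding Lev_path_def
    by (rule contour_integral_comp_circlepath[OF open_Ext psi_holo]) (use rho_bounds in \<open>auto simp: Ext_def\<close>)
  also have "\<dots> = contour_integral (circlepath 0 r) (\<lambda>w. (g (2 * k) (\<psi> w) * k1 w) * W (\<psi> w) z)"
  proof (rule contour_integral_cong[OF refl])
    fix w assume "w \<in> path_image (circlepath 0 r)"
    then have w: "\<rho>\<^sub>0 < cmod w"
      using rho_bounds path_image_circlepath_nonneg[of r 0] by auto
    show "g (2 * k) (\<psi> w) * De (\<psi> w) * Di (\<psi> w) * W (\<psi> w) z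
            * sq (\<psi> w) * phi \<psi> (\<psi> w) ^ n * deriv \<psi> w = (g (2 * k) (\<psi> w) * k1 w) * W (\<psi> w) z"
      using S_nz[OF w] unfolding deriv_psi_S[OF w] phi_psi[OF w] k1_def D_def S_def[symmetric]
      by (simp add: power2_eq_square)
  qed
  finally show ?thesis by simp
qed

lemma gtr_even:
  assumes w: "\<rho>\<^sub>0 < cmod w"
  shows "g (Suc (Suc (2 * k))) (\<psi> w) = w / (2 * of_real pi * \<i>) *
     contour_integral (circlepath 0 (1 / r)) (\<lambda>v. g (Suc (2 * k)) (\<psi> v) * (k2 v / (v - w)))"
proof -
  have "contour_integral (Lev_path \<psi> (1 / r))
           (\<lambda>\<zeta>. g (Suc (2 * k)) \<zeta> * sq \<zeta> * inv_Di \<psi> De Di \<zeta>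
                / (phi \<psi> \<zeta> ^ (n + 1) * De \<zeta> * (phi \<psi> \<zeta> - w))) =
        contour_integral (circlepath 0 (1 / r)) (\<lambda>v. g (Suc (2 * k)) (\<psi> v) * sq (\<psi> v) * inv_Di \<psi> De Di (\<psi> v)
                / (phi \<psi> (\<psi> v) ^ (n + 1) * De (\<psi> v) * (phi \<psi> (\<psi> v) - w)) * deriv \<psi> v)"
    unfolding Lev_path_def
    by (rule contour_integral_comp_circlepath[OF open_Ext psi_holo]) (use rho_bounds in \<open>auto simp: Ext_def\<close>)
  also have "\<dots> = contour_integral (circlepath 0 (1 / r)) (\<lambda>v. g (Suc (2 * k)) (\<psi> v) * (k2 v / (v - w)))"
  proof (rule contour_integral_cong[OF refl])
    fix v assume "v \<in> path_image (circlepath 0 (1 / r))"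
    then have v: "\<rho>\<^sub>0 < cmod v"
      using rho_bounds path_image_circlepath_nonneg[of "1 / r" 0] by auto
    show "g (Suc (2 * k)) (\<psi> v) * sq (\<psi> v) * inv_Di \<psi> De Di (\<psi> v)
                / (phi \<psi> (\<psi> v) ^ (n + 1) * De (\<psi> v) * (phi \<psi> (\<psi> v) - w)) * deriv \<psi> v
          = g (Suc (2 * k)) (\<psi> v) * (k2 v / (v - w))"
      using S_nz[OF v]
      unfolding deriv_psi_S[OF v] phi_psi[OF v] k2_def D_def S_def[symmetric] iD_def
      by (simp add: power2_eq_square)
  qed
  finally show ?thesis using phi_psi[OF w] by simp
qed

end

subsection \<open>Convergence of the series\<close>

declare gtr.simps(2) [simp del]

lemma compact_SUP_upper:
  fixes g :: "'a::topological_space \<Rightarrow> real"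
  assumes "compact K" "continuous_on K g" "x \<in> K"
  shows "g x \<le> (SUP y\<in>K. g y)"
  using assms compact_imp_bounded[OF compact_continuous_image]
  by (intro cSUP_upper bounded_imp_bdd_above) auto

text \<open>From \<open>w / (v - w) = v / (v - w) - 1\<close>: the first part tends to zero because
  the contour is fixed, the second leaves the integral of \<open>d\<close>.\<close>

lemma cauchy_transform_at_infinity:
  assumes d: "continuous_on (sphere 0 s) d" and s: "0 < s"
  shows "((\<lambda>w. w * contour_integral (circlepath 0 s) (\<lambda>v. d v / (v - w))) \<longlongrightarrow>
      - contour_integral (circlepath 0 s) d) at_infinity"
proof -
  have img: "path_image (circlepath 0 s) = sphere 0 s"
    using s by (intro path_image_circlepath_nonneg) auto
  obtain B where B: "\<And>v. v \<in> sphere 0 s \<Longrightarrow> cmod (d v) \<le> B"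
    using compact_imp_bounded[OF compact_continuous_image[OF d compact_sphere]]
    unfolding bounded_iff by blast
  define R where "R w = contour_integral (circlepath 0 s) (\<lambda>v. v * d v / (v - w))" for w
  have split: "w * contour_integral (circlepath 0 s) (\<lambda>v. d v / (v - w)) =
      R w - contour_integral (circlepath 0 s) d" if w: "s < cmod w" for w
  proof -
    have ne: "\<forall>v\<in>sphere 0 s. v - w \<noteq> 0" using w by auto
    have "w * contour_integral (circlepath 0 s) (\<lambda>v. d v / (v - w)) =
       contour_integral (circlepath 0 s) (\<lambda>v. w * (d v / (v - w)))"
      using ne s by (intro contour_integral_lmul[symmetric] continuous_on_contour_integrable_circlepath
          continuous_intros d) auto
    also have "\<dots> = contour_integral (circlepath 0 s) (\<lambda>v. v * d v / (v - w) - d v)"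
    proof (rule contour_integral_cong[OF refl])
      fix v assume "v \<in> path_image (circlepath 0 s)"
      then have "v - w \<noteq> 0" using ne img by auto
      then show "w * (d v / (v - w)) = v * d v / (v - w) - d v"
        by (simp add: field_simps)
    qed
    also have "\<dots> = R w - contour_integral (circlepath 0 s) d"
      unfolding R_def using ne s
      by (intro contour_integral_diff continuous_on_contour_integrable_circlepath continuous_intros d) auto
    finally show ?thesis .
  qed
  have Rbound: "cmod (R w) \<le> (s * B * (2 * pi * s)) / (cmod w - s)" if w: "s < cmod w" for w
  proof -
    have "cmod (R w) \<le> (s * B / (cmod w - s)) * (2 * pi * s)"
      unfolding R_def
    proof (rule contour_integral_circlepath_bound[OF _ s])
      show "continuous_on (sphere 0 s) (\<lambda>v. v * d v / (v - w))"
        using w by (intro continuous_intros d) auto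
      fix v assume v: "cmod v = s"
      have "cmod w - s \<le> cmod (v - w)"
        using norm_triangle_ineq3[of v w] v by linarith
      then show "cmod (v * d v / (v - w)) \<le> s * B / (cmod w - s)"
        unfolding norm_mult norm_divide v using order_trans[OF norm_ge_zero B[of v]] B[of v] v w s
        by (intro frac_le mult_left_mono mult_nonneg_nonneg) auto
    qed
    then show ?thesis by simp
  qed
  have "(R \<longlongrightarrow> 0) at_infinity"
  proof (rule Lim_null_comparison)
    show "\<forall>\<^sub>F w in at_infinity. cmod (R w) \<le> (s * B * (2 * pi * s)) / (cmod w - s)"
      unfolding eventually_at_infinity using Rbound by (intro exI[of _ "s + 1"]) auto
    have "filterlim (\<lambda>w::complex. - s + cmod w) at_top at_infinity"
      by (rule filterlim_tendsto_add_at_top[OF tendsto_const filterlim_norm_at_top])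
    then show "((\<lambda>w::complex. (s * B * (2 * pi * s)) / (cmod w - s)) \<longlongrightarrow> 0) at_infinity"
      by (intro real_tendsto_divide_at_top[OF tendsto_const]) simp
  qed
  then have "((\<lambda>w. R w - contour_integral (circlepath 0 s) d) \<longlongrightarrow>
      0 - contour_integral (circlepath 0 s) d) at_infinity"
    by (intro tendsto_intros)
  moreover have "\<forall>\<^sub>F w in at_infinity. R w - contour_integral (circlepath 0 s) d =
      w * contour_integral (circlepath 0 s) (\<lambda>v. d v / (v - w))"
    unfolding eventually_at_infinity using split by (intro exI[of _ "s + 1"]) auto
  ultimately show ?thesis
    using Lim_transform_eventually by fastforce
qed

context szego_data
begin

section \<open>The constants and the contraction estimate\<close>

abbreviation "\<Lambda> \<equiv> Lam \<psi> sq De Di r"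
abbreviation "\<Lambda>' \<equiv> Lam' \<psi> sq De Di r"
abbreviation "M \<equiv> Mker \<psi> W r"

lemma k1_bound: "cmod w = r \<Longrightarrow> cmod (k1 w) \<le> \<Lambda> * r ^ n" and Lam_ge_0: "0 \<le> \<Lambda>"
proof -
  let ?g = "\<lambda>w. D w * Di (\<psi> w) / S w"
  have sub: "sphere 0 r \<subseteq> Ext \<rho>" "sphere 0 r \<subseteq> Ext \<rho>\<^sub>0"
    using rho_bounds by (auto simp: Ext_def)
  have "(\<lambda>w. Di (\<psi> w)) holomorphic_on sphere 0 r"
    by (rule psi_comp_holo[OF Di_holo]) (use rho_bounds psi_in_closure_G_1 in auto)
  then have cont: "continuous_on (sphere 0 r) ?g"
    using sub S_nz rho_bounds
    by (intro holomorphic_on_imp_continuous_on holomorphic_on_divide holomorphic_on_mult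
        holomorphic_on_subset[OF D_holo] holomorphic_on_subset[OF S_holo]) auto
  have "\<Lambda> = (SUP w\<in>sphere 0 r. cmod (?g w))"
    using Lev_eq[of r] rho_bounds unfolding Lam_def by (simp add: image_image D_def S_def)
  then have *: "cmod (?g w) \<le> \<Lambda>" if "cmod w = r" for w
    using compact_SUP_upper[of "sphere 0 r" "\<lambda>w. cmod (?g w)" w] continuous_on_norm[OF cont] that by simp
  then show "cmod (k1 w) \<le> \<Lambda> * r ^ n" if "cmod w = r"
    using that rho_bounds mult_right_mono[OF *[OF that], of "r ^ n"]
    by (simp add: k1_def norm_mult norm_divide norm_power)
  show "0 \<le> \<Lambda>"
    using *[of "of_real r"] rho_bounds norm_ge_zero order_trans
    by (metis abs_of_pos norm_of_real)
qed

lemma k2_bound: "cmod w = 1 / r \<Longrightarrow> cmod (k2 w) \<le> \<Lambda>' * r ^ (n + 1)" and Lam'_ge_0: "0 \<le> \<Lambda>'"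
proof -
  let ?g = "\<lambda>w. iD w / (S w * D w)"
  have s1: "1 < cmod w" "\<rho>\<^sub>0 < cmod w" "\<rho> < cmod w \<and> \<rho> * cmod w < 1" if "cmod w = 1 / r" for w
    using that rho_bounds sphere_annulus[of w] by auto
  have sub: "sphere 0 (1 / r) \<subseteq> Ext \<rho>" "sphere 0 (1 / r) \<subseteq> Ext \<rho>\<^sub>0"
     "sphere 0 (1 / r) \<subseteq> {w. \<rho> < cmod w \<and> \<rho> * cmod w < 1}"
    using s1 by (auto simp: Ext_def)
  have nz: "S w * D w \<noteq> 0" if "w \<in> sphere 0 (1 / r)" for w
    using S_nz[of w] D_nz[of w] s1[of w] that by auto
  have cont: "continuous_on (sphere 0 (1 / r)) ?g"
    using nz by (intro holomorphic_on_imp_continuous_on holomorphic_on_divide holomorphic_on_mult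
        holomorphic_on_subset[OF D_holo] holomorphic_on_subset[OF S_holo] holomorphic_on_subset[OF iD_holo] sub)
  have "\<Lambda>' = (SUP w\<in>sphere 0 (1 / r). cmod (?g w))"
    using Lev_eq[of "1 / r"] rho_bounds(12) unfolding Lam'_def by (simp add: image_image D_def S_def iD_def)
  then have *: "cmod (?g w) \<le> \<Lambda>'" if "cmod w = 1 / r" for w
    using compact_SUP_upper[of "sphere 0 (1 / r)" "\<lambda>w. cmod (?g w)" w] continuous_on_norm[OF cont] that by simp
  show "cmod (k2 w) \<le> \<Lambda>' * r ^ (n + 1)" if "cmod w = 1 / r"
  proof -
    have "k2 w = ?g w / w ^ (n + 1)" by (simp add: k2_def)
    then have "cmod (k2 w) = cmod (?g w) * r ^ (n + 1)"
      using that rho_bounds(4) by (simp only: norm_divide norm_power) (simp add: power_divide)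
    then show ?thesis
      using mult_right_mono[OF *[OF that], of "r ^ (n + 1)"] rho_bounds(4) by simp
  qed
  have "cmod (of_real (1 / r) :: complex) = 1 / r"
    using rho_bounds(4) by (simp del: of_real_divide)
  then show "0 \<le> \<Lambda>'"
    using * norm_ge_zero order_trans by blast
qed

text \<open>\<open>F\<close> is injective on \<open>Ann\<close>, so on disjoint sets the denominator
  of the kernel has no zero.\<close>

lemma W_cont:
  assumes "A \<subseteq> Ann" "B \<subseteq> Ann" "A \<inter> B = {}"
  shows "continuous_on (A \<times> B) (\<lambda>(v, w). W (\<psi> v) (\<psi> w))"
proof -
  have qc: "continuous_on Ann (\<lambda>w. q (\<psi> w))" and Fc: "continuous_on Ann F"
    using qpsi_holo F_holo by (simp_all add: holomorphic_on_imp_continuous_on)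
  have 1: "continuous_on (A \<times> B) (\<lambda>x. q (\<psi> (fst x)))" "continuous_on (A \<times> B) (\<lambda>x. F (fst x))"
    "continuous_on (A \<times> B) (\<lambda>x. q (\<psi> (snd x)))" "continuous_on (A \<times> B) (\<lambda>x. F (snd x))"
    using assms(1,2)
    by (intro continuous_on_compose2[OF qc] continuous_on_compose2[OF Fc] continuous_intros; force)+
  have 2: "\<forall>x\<in>A \<times> B. F (fst x) - F (snd x) \<noteq> 0"
  proof (rule ballI, rule notI)
    fix x assume x: "x \<in> A \<times> B" "F (fst x) - F (snd x) = 0"
    then have "fst x \<in> A" "snd x \<in> B" "F (fst x) = F (snd x)"
      by (auto simp: mem_Times_iff)
    moreover from this have "fst x = snd x"
      using inj_onD[OF F_inj, of "fst x" "snd x"] subsetD[OF assms(1)] subsetD[OF assms(2)] by simp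
    ultimately show False using assms(3) by (metis disjoint_iff)
  qed
  have "continuous_on (A \<times> B) (\<lambda>x. q (\<psi> (snd x)) * q (\<psi> (fst x)) / (F (fst x) - F (snd x)))"
    by (intro continuous_on_divide continuous_on_mult continuous_on_diff 1 2)
  moreover have "q (\<psi> (snd x)) * q (\<psi> (fst x)) / (F (fst x) - F (snd x)) =
      (case x of (v, w) \<Rightarrow> W (\<psi> v) (\<psi> w))" if "x \<in> A \<times> B" for x
    using W_eq[OF psi_Ann psi_Ann, of "fst x" "snd x"] subsetD[OF assms(1), of "fst x"]
      subsetD[OF assms(2), of "snd x"] that by (simp add: F_def case_prod_beta mem_Times_iff)
  ultimately show ?thesis
    by (rule continuous_on_eq)
qed

lemma sphere_subset_Ann: "r \<le> s \<Longrightarrow> s \<le> 1 / r \<Longrightarrow> sphere 0 s \<subseteq> Ann"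
proof
  fix w :: complex assume "r \<le> s" "s \<le> 1 / r" "w \<in> sphere 0 s"
  then show "w \<in> Ann" by (intro sphere_Ann) (simp_all only: mem_sphere_0)
qed

lemma W_bound: "cmod v = r \<Longrightarrow> cmod w = 1 / r \<Longrightarrow> cmod (W (\<psi> v) (\<psi> w)) \<le> M" and M_ge_0: "0 \<le> M"
proof -
  have rr: "r < 1 / r" using rho_bounds(3,5) by linarith
  have sub: "sphere 0 r \<subseteq> Ann" "sphere 0 (1 / r) \<subseteq> Ann"
    "sphere 0 r \<inter> sphere (0::complex) (1 / r) = {}"
    using sphere_subset_Ann[of r] sphere_subset_Ann[of "1 / r"] rr by auto
  have "M = (SUP x\<in>sphere 0 r \<times> sphere 0 (1 / r). cmod (case x of (v, w) \<Rightarrow> W (\<psi> v) (\<psi> w)))"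
    using Lev_eq[of r] Lev_eq[of "1 / r"] rho_bounds(7,12) unfolding Mker_def
    by (simp add: image_paired_Times[symmetric] image_image case_prod_beta)
  moreover have "compact (sphere (0::complex) r \<times> sphere (0::complex) (1 / r))"
    by (intro compact_Times compact_sphere)
  ultimately have *: "cmod (W (\<psi> v) (\<psi> w)) \<le> M" if "cmod v = r" "cmod w = 1 / r" for v w
    using compact_SUP_upper[OF _ continuous_on_norm[OF W_cont[OF sub]], of "(v, w)"] that by simp
  then show "cmod v = r \<Longrightarrow> cmod w = 1 / r \<Longrightarrow> cmod (W (\<psi> v) (\<psi> w)) \<le> M" .
  have "cmod (of_real (1 / r) :: complex) = 1 / r" "cmod (of_real r :: complex) = r"
    using rho_bounds(4) by (simp_all del: of_real_divide)
  then show "0 \<le> M"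
    using * norm_ge_zero order_trans by blast
qed

definition "ratio = \<Lambda> * \<Lambda>' * M * r ^ (2 * n) / (1 / r - r)"

lemma ratio: "0 \<le> ratio" "ratio < 1"
proof -
  have "r < 1 / r" using rho_bounds(3,5) by linarith
  then show "0 \<le> ratio"
    unfolding ratio_def using Lam_ge_0 Lam'_ge_0 M_ge_0 rho_bounds(4) by simp
qed (use contraction in \<open>simp add: ratio_def\<close>)

lemma sphere_eq: "0 < s \<Longrightarrow> path_image (circlepath 0 s) = sphere 0 s"
  by (simp add: path_image_circlepath_nonneg)

lemma psi_notin_Lev: "\<rho>\<^sub>0 < cmod w \<Longrightarrow> \<rho>\<^sub>0 < s \<Longrightarrow> cmod w \<noteq> s \<Longrightarrow> \<psi> w \<notin> \<psi> ` sphere 0 s"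
  using psi_eq_iff by auto

text \<open>Values on \<open>|w| = r\<close> go in and values on \<open>|w| = 1 / r\<close> come
  out, exactly where the next transform reads them. The length \<open>2 \<pi> r\<close> against the
  prefactor leaves one factor \<open>r\<close>.\<close>

lemma odd_step:
  assumes cont: "continuous_on (sphere 0 r) (\<lambda>w. g (2 * k) (\<psi> w))"
    and bound: "\<And>w. cmod w = r \<Longrightarrow> cmod (g (2 * k) (\<psi> w)) \<le> A"
  shows "g (Suc (2 * k)) holomorphic_on GR - \<psi> ` sphere 0 r"
    and "continuous_on (sphere 0 (1 / r)) (\<lambda>w. g (Suc (2 * k)) (\<psi> w))"
    and "cmod w = 1 / r \<Longrightarrow> cmod (g (Suc (2 * k)) (\<psi> w)) \<le> A * (\<Lambda> * r ^ n) * M * r"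
proof -
  have rr: "r < 1 / r" using rho_bounds(3,5) by linarith
  have dc: "continuous_on (sphere 0 r) (\<lambda>w. g (2 * k) (\<psi> w) * k1 w)"
    using rho_bounds by (intro continuous_on_mult cont k1_cont_sphere) auto
  have "(\<lambda>z. - (1 / (2 * of_real pi * \<i>)) *
     contour_integral (circlepath 0 r) (\<lambda>w. (g (2 * k) (\<psi> w) * k1 w) * W (\<psi> w) z))
     holomorphic_on GR - \<psi> ` sphere 0 r"
    using sphere_Ann[of "of_real r"] rho_bounds
    by (intro holomorphic_on_mult holomorphic_on_const W_transform_holo dc) auto
  then show holo: "g (Suc (2 * k)) holomorphic_on GR - \<psi> ` sphere 0 r"
    unfolding gtr_odd[symmetric] by simp
  have sA: "w \<in> Ann" if "cmod w = 1 / r" for w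
    using sphere_Ann[of w] that rr by simp
  have "(\<lambda>w. g (Suc (2 * k)) (\<psi> w)) holomorphic_on sphere 0 (1 / r)"
  proof (rule psi_comp_holo[OF holo])
    fix w :: complex assume "w \<in> sphere 0 (1 / r)"
    then have "cmod w = 1 / r" by simp
    then show "\<rho>\<^sub>0 < cmod w \<and> \<psi> w \<in> GR - \<psi> ` sphere 0 r"
      using sA[of w] psi_Ann[of w] psi_notin_Lev[of w r] rho_bounds(7) rr by auto
  qed
  then show "continuous_on (sphere 0 (1 / r)) (\<lambda>w. g (Suc (2 * k)) (\<psi> w))"
    by (rule holomorphic_on_imp_continuous_on)
  show "cmod (g (Suc (2 * k)) (\<psi> w)) \<le> A * (\<Lambda> * r ^ n) * M * r" if w: "cmod w = 1 / r"
  proof -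
    have "cmod (contour_integral (circlepath 0 r) (\<lambda>v. (g (2 * k) (\<psi> v) * k1 v) * W (\<psi> v) (\<psi> w)))
        \<le> (A * (\<Lambda> * r ^ n) * M) * (2 * pi * r)"
    proof (rule contour_integral_circlepath_bound[OF _ rho_bounds(4)])
      have "continuous_on (sphere 0 r \<times> {w}) (\<lambda>(v, w). W (\<psi> v) (\<psi> w))"
        using sA[OF w] sphere_subset_Ann[of r] rr w by (intro W_cont) auto
      then have "continuous_on (sphere 0 r) (\<lambda>v. (\<lambda>(v, w). W (\<psi> v) (\<psi> w)) (v, w))"
        by (rule continuous_on_compose2) (auto intro!: continuous_intros)
      then show "continuous_on (sphere 0 r) (\<lambda>v. (g (2 * k) (\<psi> v) * k1 v) * W (\<psi> v) (\<psi> w))"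
        by (intro continuous_on_mult[OF dc]) simp
      fix v assume v: "cmod v = r"
      show "cmod ((g (2 * k) (\<psi> v) * k1 v) * W (\<psi> v) (\<psi> w)) \<le> A * (\<Lambda> * r ^ n) * M"
        unfolding norm_mult using order_trans[OF norm_ge_zero bound[OF v]] Lam_ge_0 rho_bounds(4)
        by (intro mult_mono bound k1_bound W_bound v w mult_nonneg_nonneg) auto
    qed
    then show ?thesis
      unfolding gtr_odd by (simp add: norm_mult norm_divide field_simps)
  qed
qed

text \<open>\<open>1 / r - r\<close> is the distance between the two circles. The prefactor
  \<open>w\<close>, of modulus \<open>r\<close>, cancels the \<open>1 / r\<close> from the length of
  the contour.\<close>

lemma even_step:
  assumes cont: "continuous_on (sphere 0 (1 / r)) (\<lambda>w. g (Suc (2 * k)) (\<psi> w))"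
    and bound: "\<And>w. cmod w = 1 / r \<Longrightarrow> cmod (g (Suc (2 * k)) (\<psi> w)) \<le> B"
  shows "continuous_on (sphere 0 r) (\<lambda>w. g (Suc (Suc (2 * k))) (\<psi> w))"
    and "cmod w = r \<Longrightarrow> cmod (g (Suc (Suc (2 * k))) (\<psi> w)) \<le> B * (\<Lambda>' * r ^ (n + 1)) / (1 / r - r)"
proof -
  have rr: "r < 1 / r" using rho_bounds(3,5) by linarith
  have r': "0 < 1 / r" using rho_bounds(4) by simp
  have dc: "continuous_on (sphere 0 (1 / r)) (\<lambda>v. g (Suc (2 * k)) (\<psi> v) * k2 v)"
    using rho_bounds(5) by (intro continuous_on_mult cont k2_cont_sphere) auto
  have "(\<lambda>w. w / (2 * of_real pi * \<i>) *
     contour_integral (circlepath 0 (1 / r)) (\<lambda>v. (g (Suc (2 * k)) (\<psi> v) * k2 v) / (v - w)))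
     holomorphic_on - sphere 0 (1 / r)"
    by (intro holomorphic_intros cauchy_transform_holo dc r') auto
  then have "continuous_on (sphere 0 r) (\<lambda>w. w / (2 * of_real pi * \<i>) *
     contour_integral (circlepath 0 (1 / r)) (\<lambda>v. (g (Suc (2 * k)) (\<psi> v) * k2 v) / (v - w)))"
    using rr by (elim continuous_on_subset[OF holomorphic_on_imp_continuous_on]) auto
  then show "continuous_on (sphere 0 r) (\<lambda>w. g (Suc (Suc (2 * k))) (\<psi> w))"
  proof (rule continuous_on_eq)
    fix w assume "w \<in> sphere (0::complex) r"
    then have "\<rho>\<^sub>0 < cmod w" using rho_bounds(7) by simp
    then show "w / (2 * of_real pi * \<i>) *
     contour_integral (circlepath 0 (1 / r)) (\<lambda>v. (g (Suc (2 * k)) (\<psi> v) * k2 v) / (v - w))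
       = g (Suc (Suc (2 * k))) (\<psi> w)"
      by (simp only: gtr_even times_divide_eq_right)
  qed
  show "cmod (g (Suc (Suc (2 * k))) (\<psi> w)) \<le> B * (\<Lambda>' * r ^ (n + 1)) / (1 / r - r)" if w: "cmod w = r"
  proof -
    have "cmod (contour_integral (circlepath 0 (1 / r)) (\<lambda>v. g (Suc (2 * k)) (\<psi> v) * (k2 v / (v - w))))
        \<le> (B * ((\<Lambda>' * r ^ (n + 1)) / (1 / r - r))) * (2 * pi * (1 / r))"
    proof (rule contour_integral_circlepath_bound[OF _ r'])
      show "continuous_on (sphere 0 (1 / r)) (\<lambda>v. g (Suc (2 * k)) (\<psi> v) * (k2 v / (v - w)))"
        using rr w rho_bounds(5) by (intro continuous_intros cont k2_cont_sphere) auto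
      fix v assume v: "cmod v = 1 / r"
      have "1 / r - r \<le> cmod (v - w)"
        using norm_triangle_ineq2[of v w] v w by linarith
      then have "cmod (k2 v / (v - w)) \<le> (\<Lambda>' * r ^ (n + 1)) / (1 / r - r)"
        unfolding norm_divide using k2_bound[OF v] rr Lam'_ge_0 rho_bounds(4)
        by (intro frac_le) auto
      then show "cmod (g (Suc (2 * k)) (\<psi> v) * (k2 v / (v - w))) \<le> B * ((\<Lambda>' * r ^ (n + 1)) / (1 / r - r))"
        unfolding norm_mult using order_trans[OF norm_ge_zero bound[OF v]] 
        by (intro mult_mono bound v) auto
    qed
    then have "cmod w / (2 * pi) *
       cmod (contour_integral (circlepath 0 (1 / r)) (\<lambda>v. g (Suc (2 * k)) (\<psi> v) * (k2 v / (v - w))))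
       \<le> cmod w / (2 * pi) * ((B * ((\<Lambda>' * r ^ (n + 1)) / (1 / r - r))) * (2 * pi * (1 / r)))"
      by (intro mult_left_mono) auto
    also have "\<dots> = B * (\<Lambda>' * r ^ (n + 1)) / (1 / r - r)"
      using w rho_bounds(4) by simp
    finally show ?thesis
      using gtr_even[of w k] w rho_bounds(7) by (simp add: norm_mult norm_divide)
  qed
qed

lemma gtr_bounds:
  "continuous_on (sphere 0 r) (\<lambda>w. g (2 * k) (\<psi> w)) \<and> (\<forall>w. cmod w = r \<longrightarrow> cmod (g (2 * k) (\<psi> w)) \<le> ratio ^ k)"
proof (induction k)
  case 0
  then show ?case by simp
next
  case (Suc k)
  then have c: "continuous_on (sphere 0 r) (\<lambda>w. g (2 * k) (\<psi> w))"
    and b: "\<And>w. cmod w = r \<Longrightarrow> cmod (g (2 * k) (\<psi> w)) \<le> ratio ^ k" by auto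
  note odd = odd_step[OF c b]
  note even = even_step[OF odd(2,3)]
  \<comment> \<open>An odd and an even step together multiply the bound by \<open>ratio\<close>
    times a spare \<open>r\<^sup>2\<close>, which is then estimated by 1.\<close>
  have "ratio ^ k * (\<Lambda> * r ^ n) * M * r * (\<Lambda>' * r ^ (n + 1)) / (1 / r - r) =
      ratio ^ k * (\<Lambda> * \<Lambda>' * M * (r ^ n * r ^ n) / (1 / r - r)) * r\<^sup>2"
    by (simp add: power2_eq_square)
  also have "r ^ n * r ^ n = r ^ (2 * n)"
    by (simp add: mult_2 power_add)
  finally have "ratio ^ k * (\<Lambda> * r ^ n) * M * r * (\<Lambda>' * r ^ (n + 1)) / (1 / r - r) = ratio ^ Suc k * r\<^sup>2"
    unfolding ratio_def[symmetric] by simp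
  also have "\<dots> \<le> ratio ^ Suc k * 1"
    using ratio rho_bounds(3,4) by (intro mult_left_mono power_le_one) auto
  finally show ?case
    using even by (auto intro: order_trans)
qed

section \<open>The sums of the two series\<close>

text \<open>A pointwise sum, meant for \<open>|w| = r\<close>, where the terms are bounded by powers
  of \<open>ratio\<close>. By contrast \<open>beta\<close> and \<open>eta\<close> are defined as
  integrals, which makes them holomorphic off their contours; that the series converge to them is
  shown afterwards.\<close>

definition "alpha w = (\<Sum>k. g (2 * k) (\<psi> w))"
definition "beta z = - (1 / (2 * of_real pi * \<i>)) *
     contour_integral (circlepath 0 r) (\<lambda>w. (alpha w * k1 w) * W (\<psi> w) z)"
definition "eta w = 1 + w / (2 * of_real pi * \<i>) *
     contour_integral (circlepath 0 (1 / r)) (\<lambda>v. (beta (\<psi> v) * k2 v) / (v - w))"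

lemma summable_ratio: "summable (\<lambda>k. ratio ^ k)"
  using ratio by (intro summable_geometric) auto

lemma alpha_cont: "continuous_on (sphere 0 r) alpha"
  unfolding alpha_def
  by (rule sums_contour_integral_circlepath(2)[OF _ continuous_on_const rho_bounds(4) _ summable_ratio])
     (use gtr_bounds in auto)

lemma W_cont1:
  assumes "s = r \<or> s = 1" "z \<in> GR" "z \<notin> \<psi> ` sphere 0 s"
  shows "continuous_on (sphere 0 s) (\<lambda>w. W (\<psi> w) z)"
proof -
  have sub: "sphere 0 s \<subseteq> Ann"
    using assms(1) rho_bounds(3,5) by (intro sphere_subset_Ann) auto
  have "\<forall>w\<in>sphere 0 s. F w - f z \<noteq> 0"
  proof
    fix w assume w: "w \<in> sphere (0::complex) s"
    then have "\<psi> w \<noteq> z" using assms(3) by auto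
    then show "F w - f z \<noteq> 0"
      using inj_onD[OF f_inj, of "\<psi> w" z] psi_Ann sub w assms(2) unfolding F_def by auto
  qed
  then have "continuous_on (sphere 0 s) (\<lambda>w. q z * q (\<psi> w) / (F w - f z))"
    by (intro continuous_intros holomorphic_on_imp_continuous_on
        holomorphic_on_subset[OF qpsi_holo] holomorphic_on_subset[OF F_holo] sub)
  then show ?thesis
  proof (rule continuous_on_eq)
    fix w assume "w \<in> sphere (0::complex) s"
    then show "q z * q (\<psi> w) / (F w - f z) = W (\<psi> w) z"
      using W_eq[OF psi_Ann assms(2)] sub by (auto simp: F_def)
  qed
qed

lemma odd_sums:
  assumes z: "z \<in> GR" "z \<notin> \<psi> ` sphere 0 r"
  shows "(\<lambda>k. g (Suc (2 * k)) z) sums beta z"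
proof -
  have K: "continuous_on (sphere 0 r) (\<lambda>w. k1 w * W (\<psi> w) z)"
    using rho_bounds(3) W_cont1[OF _ z] by (intro continuous_on_mult k1_cont_sphere) auto
  have "(\<lambda>k. contour_integral (circlepath 0 r) (\<lambda>w. g (2 * k) (\<psi> w) * (k1 w * W (\<psi> w) z))) sums
     contour_integral (circlepath 0 r) (\<lambda>w. (\<Sum>k. g (2 * k) (\<psi> w)) * (k1 w * W (\<psi> w) z))"
    by (rule sums_contour_integral_circlepath(1)[OF _ K rho_bounds(4) _ summable_ratio])
       (use gtr_bounds in auto)
  from sums_mult[OF this, of "- (1 / (2 * of_real pi * \<i>))"] show ?thesis
    unfolding gtr_odd beta_def alpha_def mult.assoc .
qed

lemma beta_holo: "beta holomorphic_on GR - \<psi> ` sphere 0 r"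
proof -
  have "\<rho>\<^sub>0 * r < 1" using sphere_Ann[of "of_real r"] rho_bounds by auto
  moreover have "continuous_on (sphere 0 r) (\<lambda>w. alpha w * k1 w)"
    using rho_bounds(3) by (intro continuous_on_mult alpha_cont k1_cont_sphere) auto
  ultimately show ?thesis
    unfolding beta_def using rho_bounds(7)
    by (intro holomorphic_on_mult holomorphic_on_const W_transform_holo) auto
qed

lemma beta_psi_holo: "(\<lambda>w. beta (\<psi> w)) holomorphic_on {w \<in> Ann. cmod w \<noteq> r}"
  by (rule psi_comp_holo[OF beta_holo]) (use psi_Ann psi_notin_Lev rho_bounds(7) in auto)

lemma beta_k2_cont: "1 \<le> s \<Longrightarrow> s \<le> 1 / r \<Longrightarrow> continuous_on (sphere 0 s) (\<lambda>v. beta (\<psi> v) * k2 v)"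
  using rho_bounds(3) sphere_subset_Ann[of s]
  by (intro continuous_on_mult k2_cont_sphere holomorphic_on_imp_continuous_on
      holomorphic_on_subset[OF beta_psi_holo]) auto

text \<open>\<open>K\<close> is free for two uses: \<open>k2 v / (v - w)\<close> gives the values of
  the even terms at finite points, \<open>k2\<close> alone gives their values at infinity.\<close>

lemma even_sums_transform:
  assumes K: "continuous_on (sphere 0 (1 / r)) K"
  shows "(\<lambda>k. contour_integral (circlepath 0 (1 / r)) (\<lambda>v. g (Suc (2 * k)) (\<psi> v) * K v)) sums
     contour_integral (circlepath 0 (1 / r)) (\<lambda>v. beta (\<psi> v) * K v)"
proof -
  have r': "0 < 1 / r" using rho_bounds(4) by simp
  have rr: "r < 1 / r" using rho_bounds(3,5) by linarith
  have summ: "summable (\<lambda>k. ratio ^ k * (\<Lambda> * r ^ n) * M * r)"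
    by (intro summable_mult2 summable_ratio)
  have "(\<lambda>k. contour_integral (circlepath 0 (1 / r)) (\<lambda>v. g (Suc (2 * k)) (\<psi> v) * K v)) sums
     contour_integral (circlepath 0 (1 / r)) (\<lambda>v. (\<Sum>k. g (Suc (2 * k)) (\<psi> v)) * K v)"
    by (rule sums_contour_integral_circlepath(1)[OF _ K r' _ summ])
       (use gtr_bounds odd_step(2,3) in blast)+
  also have "contour_integral (circlepath 0 (1 / r)) (\<lambda>v. (\<Sum>k. g (Suc (2 * k)) (\<psi> v)) * K v) =
    contour_integral (circlepath 0 (1 / r)) (\<lambda>v. beta (\<psi> v) * K v)"
  proof (rule contour_integral_cong[OF refl])
    fix v assume "v \<in> path_image (circlepath 0 (1 / r))"
    then have v: "cmod v = 1 / r" unfolding sphere_eq[OF r'] by simp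
    have "(\<lambda>k. g (Suc (2 * k)) (\<psi> v)) sums beta (\<psi> v)"
      using sphere_Ann[of v] v rr psi_Ann[of v] psi_notin_Lev[of v r] rho_bounds(7)
      by (intro odd_sums) auto
    then show "(\<Sum>k. g (Suc (2 * k)) (\<psi> v)) * K v = beta (\<psi> v) * K v"
      by (simp add: sums_iff)
  qed
  finally show ?thesis .
qed

lemma even_sums:
  assumes w: "\<rho>\<^sub>0 < cmod w" "cmod w \<noteq> 1 / r"
  shows "(\<lambda>k. g (2 * k) (\<psi> w)) sums eta w"
proof -
  have "continuous_on (sphere 0 (1 / r)) (\<lambda>v. k2 v / (v - w))"
    using rho_bounds(5) w by (intro continuous_intros k2_cont_sphere) auto
  from sums_mult[OF even_sums_transform[OF this], of "w / (2 * of_real pi * \<i>)"]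
  have "(\<lambda>k. g (2 * Suc k) (\<psi> w)) sums (eta w - 1)"
    using gtr_even[OF w(1)] by (simp add: eta_def)
  then show ?thesis
    using sums_Suc[of "\<lambda>k. g (2 * k) (\<psi> w)" "eta w - 1"] by simp
qed

text \<open>Closes the system: the density of \<open>beta\<close> may be replaced by
  \<open>eta\<close>, which is holomorphic on the disc of radius \<open>1 / r\<close>, and with that
  the contour of \<open>beta\<close> can be moved.\<close>

lemma alpha_eq_eta: "cmod w = r \<Longrightarrow> alpha w = eta w"
proof -
  assume w: "cmod w = r"
  have "r \<noteq> 1 / r" using rho_bounds(3,5) by linarith
  then have "(\<lambda>k. g (2 * k) (\<psi> w)) sums eta w"
    using w rho_bounds(7) by (intro even_sums) auto
  then show ?thesis
    unfolding alpha_def by (simp add: sums_iff)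
qed

lemma beta_eq: "beta z = - (1 / (2 * of_real pi * \<i>)) *
     contour_integral (circlepath 0 r) (\<lambda>w. (eta w * k1 w) * W (\<psi> w) z)"
proof -
  have "contour_integral (circlepath 0 r) (\<lambda>w. (alpha w * k1 w) * W (\<psi> w) z) =
    contour_integral (circlepath 0 r) (\<lambda>w. (eta w * k1 w) * W (\<psi> w) z)"
    using sphere_eq[OF rho_bounds(4)] alpha_eq_eta by (intro contour_integral_cong[OF refl]) auto
  then show ?thesis by (simp add: beta_def)
qed

lemma eta_holo: "eta holomorphic_on - sphere 0 (1 / r)"
  unfolding eta_def using rho_bounds(4,5)
  by (intro holomorphic_intros cauchy_transform_holo beta_k2_cont) auto

text \<open>The prefactor \<open>w\<close> kills the integral at \<open>0\<close>, a point outside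
  the domain of \<open>\<psi>\<close> at which \<open>eta\<close> is nevertheless holomorphic. This
  value normalises the residue in \<open>eta_orthogonal\<close>.\<close>

lemma eta_0: "eta 0 = 1"
  by (simp add: eta_def)

definition "eta_inf = 1 - 1 / (2 * of_real pi * \<i>) *
    contour_integral (circlepath 0 (1 / r)) (\<lambda>v. beta (\<psi> v) * k2 v)"

lemma eta_tendsto: "(eta \<longlongrightarrow> eta_inf) at_infinity"
proof -
  have r': "0 < 1 / r" using rho_bounds(4) by simp
  have c: "continuous_on (sphere 0 (1 / r)) (\<lambda>v. beta (\<psi> v) * k2 v)"
    using rho_bounds(5) by (intro beta_k2_cont) auto
  have "((\<lambda>w. 1 + 1 / (2 * of_real pi * \<i>) * (w *
     contour_integral (circlepath 0 (1 / r)) (\<lambda>v. (beta (\<psi> v) * k2 v) / (v - w)))) \<longlongrightarrow>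
     1 + 1 / (2 * of_real pi * \<i>) * (- contour_integral (circlepath 0 (1 / r)) (\<lambda>v. beta (\<psi> v) * k2 v))) at_infinity"
    by (intro tendsto_intros cauchy_transform_at_infinity c r')
  then show ?thesis by (simp add: eta_def[abs_def] eta_inf_def)
qed

lemma at_inf_gtr_even:
  "at_inf (g (2 * Suc k)) = - (1 / (2 * of_real pi * \<i>)) *
     contour_integral (circlepath 0 (1 / r)) (\<lambda>v. g (Suc (2 * k)) (\<psi> v) * k2 v)"
proof -
  have r': "0 < 1 / r" using rho_bounds(4) by simp
  have "continuous_on (sphere 0 (1 / r)) (\<lambda>v. g (Suc (2 * k)) (\<psi> v))"
    using gtr_bounds odd_step(2) by blast
  then have c: "continuous_on (sphere 0 (1 / r)) (\<lambda>v. g (Suc (2 * k)) (\<psi> v) * k2 v)"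
    using rho_bounds(5) by (intro continuous_on_mult k2_cont_sphere) auto
  have "((\<lambda>w. 1 / (2 * of_real pi * \<i>) * (w *
     contour_integral (circlepath 0 (1 / r)) (\<lambda>v. (g (Suc (2 * k)) (\<psi> v) * k2 v) / (v - w)))) \<longlongrightarrow>
     1 / (2 * of_real pi * \<i>) * (- contour_integral (circlepath 0 (1 / r)) (\<lambda>v. g (Suc (2 * k)) (\<psi> v) * k2 v))) at_infinity"
    by (intro tendsto_intros cauchy_transform_at_infinity c r')
  moreover have "\<forall>\<^sub>F w in at_infinity. 1 / (2 * of_real pi * \<i>) * (w *
     contour_integral (circlepath 0 (1 / r)) (\<lambda>v. (g (Suc (2 * k)) (\<psi> v) * k2 v) / (v - w)))
     = g (2 * Suc k) (\<psi> w)"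
    unfolding eventually_at_infinity
  proof (intro exI[of _ 1] allI impI)
    fix w :: complex assume "1 \<le> cmod w"
    then have "\<rho>\<^sub>0 < cmod w" using rho_bounds(8) by linarith
    from gtr_even[OF this, of k] show "1 / (2 * of_real pi * \<i>) * (w *
     contour_integral (circlepath 0 (1 / r)) (\<lambda>v. (g (Suc (2 * k)) (\<psi> v) * k2 v) / (v - w)))
     = g (2 * Suc k) (\<psi> w)"
      by simp
  qed
  ultimately have "((\<lambda>w. g (2 * Suc k) (\<psi> w)) \<longlongrightarrow> 
     1 / (2 * of_real pi * \<i>) * (- contour_integral (circlepath 0 (1 / r)) (\<lambda>v. g (Suc (2 * k)) (\<psi> v) * k2 v))) at_infinity"
    by (rule Lim_transform_eventually)
  then have "(g (2 * Suc k) \<longlongrightarrow> 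
     1 / (2 * of_real pi * \<i>) * (- contour_integral (circlepath 0 (1 / r)) (\<lambda>v. g (Suc (2 * k)) (\<psi> v) * k2 v))) at_infinity"
    by (simp only: tendsto_at_infinity_psi_iff)
  then have "at_inf (g (2 * Suc k)) = 1 / (2 * of_real pi * \<i>) *
      (- contour_integral (circlepath 0 (1 / r)) (\<lambda>v. g (Suc (2 * k)) (\<psi> v) * k2 v))"
    unfolding at_inf_def by (rule tendsto_Lim[OF trivial_limit_at_infinity])
  then show ?thesis
    by (simp only: minus_mult_commute)
qed

text \<open>Limit and sum are interchanged by first turning each limit into an integral of the
  preceding odd term against \<open>k2\<close> and then summing under the integral.\<close>

lemma at_inf_sums: "(\<lambda>k. at_inf (g (2 * k))) sums eta_inf"
proof -
  have "continuous_on (sphere 0 (1 / r)) k2"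
    using rho_bounds(5) by (intro k2_cont_sphere) auto
  from sums_mult[OF even_sums_transform[OF this], of "- (1 / (2 * of_real pi * \<i>))"]
  have "(\<lambda>k. at_inf (g (2 * Suc k))) sums (eta_inf - 1)"
    unfolding at_inf_gtr_even eta_inf_def by simp
  moreover have "at_inf (g (2 * 0)) = 1"
    unfolding at_inf_def using tendsto_Lim[OF trivial_limit_at_infinity tendsto_const] by simp
  ultimately show ?thesis
    using sums_Suc[of "\<lambda>k. at_inf (g (2 * k))" "eta_inf - 1"] by simp
qed

end

subsection \<open>The entire function\<close>

context szego_data
begin

text \<open>The integrals of \<open>eta\<close> and \<open>beta\<close> with both contours moved to the unit circle: these continue
  \<open>eta\<close> inwards from the far exterior and \<open>beta\<close> outwards from the deep interior.\<close>

definition "eta1 w = 1 + w / (2 * of_real pi * \<i>) *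
     contour_integral (circlepath 0 1) (\<lambda>v. (beta (\<psi> v) * k2 v) / (v - w))"
definition "beta1 z = - (1 / (2 * of_real pi * \<i>)) *
     contour_integral (circlepath 0 1) (\<lambda>w. (eta w * k1 w) * W (\<psi> w) z)"

section \<open>Moving the contours to the unit circle\<close>

lemma beta_k2_holo:
  obtains V where "open V" "{w. 1 \<le> cmod w \<and> cmod w \<le> 1 / r} \<subseteq> V" "(\<lambda>v. beta (\<psi> v) * k2 v) holomorphic_on V"
proof
  let ?V = "{w. \<rho> < cmod w \<and> \<rho> * cmod w < 1 \<and> D w \<noteq> 0} \<inter> Ext r"
  show "open ?V" by (intro open_Int open_k2_domain open_Ext)
  show "{w. 1 \<le> cmod w \<and> cmod w \<le> 1 / r} \<subseteq> ?V"
  proof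
    fix w assume "w \<in> {w. 1 \<le> cmod w \<and> cmod w \<le> 1 / r}"
    then have w: "1 \<le> cmod w" "cmod w \<le> 1 / r" by simp_all
    then show "w \<in> ?V"
      using D_nz[of w] sphere_annulus[of w] rho_bounds(3) by (auto simp: Ext_def)
  qed
  have "?V \<subseteq> {w \<in> Ann. cmod w \<noteq> r}"
  proof
    fix w assume "w \<in> ?V"
    then have w: "\<rho> < cmod w" "\<rho> * cmod w < 1" "r < cmod w" by (auto simp: Ext_def)
    have "\<rho>\<^sub>0 * cmod w \<le> \<rho> * cmod w"
      using rho_bounds(1) by (intro mult_right_mono) auto
    then show "w \<in> {w \<in> Ann. cmod w \<noteq> r}"
      using w rho_bounds(1) by auto
  qed
  then show "(\<lambda>v. beta (\<psi> v) * k2 v) holomorphic_on ?V"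
    by (intro holomorphic_on_mult holomorphic_on_subset[OF beta_psi_holo] holomorphic_on_subset[OF k2_holo]) auto
qed

lemma eta_far:
  assumes w: "1 / r < cmod w"
  shows "eta w = eta1 w"
proof -
  obtain V where V: "open V" "{w. 1 \<le> cmod w \<and> cmod w \<le> 1 / r} \<subseteq> V"
    "(\<lambda>v. beta (\<psi> v) * k2 v) holomorphic_on V"
    by (rule beta_k2_holo)
  have "contour_integral (circlepath 0 1) (\<lambda>v. (beta (\<psi> v) * k2 v) / (v - w)) =
      contour_integral (circlepath 0 (1 / r)) (\<lambda>v. (beta (\<psi> v) * k2 v) / (v - w))"
  proof (rule circlepath_integral_shift)
    show "open (V - {w})" using V(1) by auto
    show "(\<lambda>v. (beta (\<psi> v) * k2 v) / (v - w)) holomorphic_on V - {w}"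
      by (intro holomorphic_on_divide holomorphic_on_subset[OF V(3)] holomorphic_intros) auto
    show "{w. 1 \<le> cmod w \<and> cmod w \<le> 1 / r} \<subseteq> V - {w}"
      using V(2) w by auto
  qed (use rho_bounds(5) in auto)
  then show ?thesis by (simp add: eta_def eta1_def)
qed

text \<open>Moving the contour inwards crosses the pole \<open>v = w\<close>. Multiplied by
  \<open>D\<close>, \<open>S\<close> and \<open>w ^ n\<close>, the residue term is exactly
  \<open>iD w\<close> times \<open>beta (\<psi> w)\<close>, the term subtracted in the middle
  region.\<close>

lemma eta_near:
  assumes w: "1 < cmod w" "cmod w < 1 / r"
  shows "eta w = eta1 w + w * (beta (\<psi> w) * k2 w)"
proof -
  obtain V where V: "open V" "{w. 1 \<le> cmod w \<and> cmod w \<le> 1 / r} \<subseteq> V"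
    "(\<lambda>v. beta (\<psi> v) * k2 v) holomorphic_on V"
    by (rule beta_k2_holo)
  have "contour_integral (circlepath 0 (1 / r)) (\<lambda>v. (beta (\<psi> v) * k2 v) / (v - w)) =
      contour_integral (circlepath 0 1) (\<lambda>v. (beta (\<psi> v) * k2 v) / (v - w)) +
      2 * of_real pi * \<i> * (beta (\<psi> w) * k2 w / deriv (\<lambda>v. v) w)"
    by (rule circlepath_integral_jump[OF V(1,3), where F = "\<lambda>v. v"]) (use w V(2) in auto)
  then show ?thesis by (simp add: eta_def eta1_def algebra_simps)
qed

lemma eta_k1_holo:
  obtains V where "open V" "{w. r \<le> cmod w \<and> cmod w \<le> 1} \<subseteq> V" "V \<subseteq> Ann"
    "(\<lambda>v. eta v * k1 v) holomorphic_on V"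
proof -
  obtain V where V: "open V" "{w. r \<le> cmod w \<and> cmod w \<le> 1} \<subseteq> V" "V \<subseteq> Ann" "k1 holomorphic_on V"
    "\<And>w. w \<in> V \<Longrightarrow> cmod w < 1 / r"
    using k1_holo by blast
  have "(\<lambda>v. eta v * k1 v) holomorphic_on V"
    by (intro holomorphic_on_mult V holomorphic_on_subset[OF eta_holo]) (use V(5) in force)
  with V(1,2,3) show thesis by (rule that)
qed

lemma W_integral_eq:
  assumes "0 < s" "sphere 0 s \<subseteq> Ann" "z \<in> GR"
  shows "contour_integral (circlepath 0 s) (\<lambda>w. (eta w * k1 w) * W (\<psi> w) z) =
    contour_integral (circlepath 0 s) (\<lambda>w. (eta w * k1 w) * (q z * q (\<psi> w)) / (F w - f z))"
proof (rule contour_integral_cong[OF refl])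
  fix w assume "w \<in> path_image (circlepath 0 s)"
  then have "w \<in> Ann" unfolding sphere_eq[OF assms(1)] by (rule subsetD[OF assms(2)])
  then show "(eta w * k1 w) * W (\<psi> w) z = (eta w * k1 w) * (q z * q (\<psi> w)) / (F w - f z)"
    using W_eq[OF psi_Ann assms(3)] by (simp add: F_def)
qed

text \<open>A point of \<open>G \<psi> r\<close> is no \<open>\<psi> v\<close> with
  \<open>r \<le> |v|\<close>, so by injectivity of \<open>f\<close> the contour sweeps over no zero
  of the denominator.\<close>

lemma beta_far:
  assumes z: "z \<in> G \<psi> r"
  shows "beta z = beta1 z"
proof -
  obtain V where V: "open V" "{w. r \<le> cmod w \<and> cmod w \<le> 1} \<subseteq> V" "V \<subseteq> Ann"
    "(\<lambda>v. eta v * k1 v) holomorphic_on V"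
    by (rule eta_k1_holo)
  have zG: "z \<in> GR"
    using z G_mono[of r 1] G_1_subset_GR rho_bounds by auto
  have Fz: "F v \<noteq> f z" if "v \<in> Ann" "r \<le> cmod v" for v
  proof
    assume "F v = f z"
    then have "\<psi> v = z"
      using inj_onD[OF f_inj, of "\<psi> v" z] psi_Ann[of v] that(1) zG by (simp add: F_def)
    then show False
      using z in_G_iff[OF rho_bounds(7), of z] that(2) by blast
  qed
  let ?V = "V \<inter> F -` (- {f z})"
  have "contour_integral (circlepath 0 r) (\<lambda>w. (eta w * k1 w) * (q z * q (\<psi> w)) / (F w - f z)) =
      contour_integral (circlepath 0 1) (\<lambda>w. (eta w * k1 w) * (q z * q (\<psi> w)) / (F w - f z))"
  proof (rule circlepath_integral_shift)
    show "open ?V"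
      using V by (intro continuous_open_preimage holomorphic_on_imp_continuous_on
          holomorphic_on_subset[OF F_holo]) auto
    show "(\<lambda>w. (eta w * k1 w) * (q z * q (\<psi> w)) / (F w - f z)) holomorphic_on ?V"
      using V(3) by (intro holomorphic_on_divide holomorphic_on_mult[OF holomorphic_on_subset[OF V(4)]]
          holomorphic_intros
          holomorphic_on_subset[OF F_holo] holomorphic_on_subset[OF qpsi_holo]) auto
    show "{w. r \<le> cmod w \<and> cmod w \<le> 1} \<subseteq> ?V"
      using V(2,3) Fz by blast
  qed (use rho_bounds in auto)
  then show ?thesis
    using W_integral_eq[OF rho_bounds(4) _ zG] W_integral_eq[OF zero_less_one _ zG]
      sphere_subset_Ann[of r] sphere_subset_Ann[of 1] rho_bounds(3,5)
    by (simp add: beta_eq beta1_def)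
qed

text \<open>The pole contributes \<open>eta k1 q^2 / deriv F\<close>, and
  \<open>deriv F = q^2 / S^2\<close>; the result is \<open>Di\<close> times the first term of the
  middle formula, so it cancels that term after multiplication by \<open>1 / Di\<close>.\<close>

lemma beta_near:
  assumes w: "r < cmod w" "cmod w < 1"
  shows "beta (\<psi> w) = beta1 (\<psi> w) + eta w * D w * Di (\<psi> w) * S w * w ^ n"
proof -
  obtain V where V: "open V" "{w. r \<le> cmod w \<and> cmod w \<le> 1} \<subseteq> V" "V \<subseteq> Ann"
    "(\<lambda>v. eta v * k1 v) holomorphic_on V"
    by (rule eta_k1_holo)
  have wV: "w \<in> V" using V(2) w by auto
  then have wA: "w \<in> Ann" using V(3) by blast
  have zG: "\<psi> w \<in> GR" using psi_Ann[OF wA] .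
  have "contour_integral (circlepath 0 1) (\<lambda>v. (eta v * k1 v) * (q (\<psi> w) * q (\<psi> v)) / (F v - F w)) =
      contour_integral (circlepath 0 r) (\<lambda>v. (eta v * k1 v) * (q (\<psi> w) * q (\<psi> v)) / (F v - F w)) +
      2 * of_real pi * \<i> * ((eta w * k1 w) * (q (\<psi> w) * q (\<psi> w)) / deriv F w)"
  proof (rule circlepath_integral_jump[OF V(1)])
    show "(\<lambda>v. (eta v * k1 v) * (q (\<psi> w) * q (\<psi> v))) holomorphic_on V"
      by (intro holomorphic_on_mult[OF V(4)] holomorphic_on_mult[OF holomorphic_on_const]
          holomorphic_on_subset[OF qpsi_holo] V(3))
    show "F holomorphic_on V" "inj_on F V"
      by (rule holomorphic_on_subset[OF F_holo V(3)] inj_on_subset[OF F_inj V(3)])+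
  qed (use V(2) w rho_bounds(4) in auto)
  moreover have "(eta w * k1 w) * (q (\<psi> w) * q (\<psi> w)) / deriv F w = eta w * D w * Di (\<psi> w) * S w * w ^ n"
  proof -
    have "S w \<noteq> 0" "\<rho>\<^sub>0 < cmod w" using S_nz wA by auto
    moreover have "q (\<psi> w) \<noteq> 0"
      using q_square[OF zG] holomorphic_injective_imp_regular[OF f_holo open_GR f_inj zG] by auto
    ultimately show ?thesis
      unfolding deriv_F[OF wA] deriv_psi_S[OF \<open>\<rho>\<^sub>0 < cmod w\<close>] k1_def
      by (simp add: power2_eq_square)
  qed
  ultimately show ?thesis
    using W_integral_eq[OF rho_bounds(4) _ zG] W_integral_eq[OF zero_less_one _ zG]
      sphere_subset_Ann[of r] sphere_subset_Ann[of 1] rho_bounds(3,5)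
    by (simp add: beta_eq beta1_def F_def algebra_simps)
qed

text \<open>Splitting along the curve itself makes the two large pieces holomorphic also on the
  level curves of index \<open>r\<close> and \<open>1 / r\<close>, which the three cases of the
  theorem leave out. The last branch supplies the values on the curve.\<close>

definition "Q z = (if z \<in> G \<psi> 1 then - beta1 z / Di z
   else if z \<in> Omega \<psi> 1 then De z * sq z * phi \<psi> z ^ n * eta1 (phi \<psi> z)
   else De z * sq z * phi \<psi> z ^ n * eta (phi \<psi> z) - inv_Di \<psi> De Di z * beta z)"

lemma Q_outer:
  assumes w: "1 / r < cmod w"
  shows "Q (\<psi> w) = D w * S w * w ^ n * eta w"
proof -
  have w1: "1 < cmod w" using w rho_bounds(5) by linarith
  then have "\<psi> w \<notin> G \<psi> 1" "\<psi> w \<in> Omega \<psi> 1"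
    using psi_in_G_iff[of w 1] psi_in_Omega_iff[of w 1] rho_bounds(8) by auto
  then show ?thesis
    using eta_far[OF w] phi_psi[of w] w1 rho_bounds(8) by (simp add: Q_def D_def S_def)
qed

lemma Q_middle:
  assumes w: "r < cmod w" "cmod w < 1 / r"
  shows "Q (\<psi> w) = D w * S w * w ^ n * eta w - iD w * beta (\<psi> w)"
proof -
  have w0: "\<rho>\<^sub>0 < cmod w" using w rho_bounds(7) by linarith
  note * = psi_in_G_iff[OF w0 rho_bounds(8)] psi_in_Omega_iff[OF w0 less_imp_le[OF rho_bounds(8)]] phi_psi[OF w0]
  consider "cmod w < 1" | "cmod w = 1" | "1 < cmod w" by linarith
  then show ?thesis
  proof cases
    case 1
    then have "Di (\<psi> w) \<noteq> 0"
      using Di_nz psi_in_closure_G_1[OF w0] by simp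
    moreover have "Q (\<psi> w) = - beta1 (\<psi> w) / Di (\<psi> w)"
      using 1 by (simp add: Q_def *)
    ultimately show ?thesis
      unfolding iD_inside[OF w0 less_imp_le[OF 1]] beta_near[OF w(1) 1] by (simp add: field_simps)
  next
    case 2
    then show ?thesis
      by (simp add: Q_def * D_def S_def iD_def)
  next
    case 3
    have "S w \<noteq> 0" "D w \<noteq> 0" "w \<noteq> 0" using S_nz[OF w0] D_nz 3 by auto
    then show ?thesis
      using 3 eta_near[OF 3 w(2)] by (simp add: Q_def * k2_def D_def[symmetric] S_def[symmetric] field_simps)
  qed
qed

lemma Q_inner:
  assumes z: "z \<in> G \<psi> r"
  shows "Q z = - inv_Di \<psi> De Di z * beta z"
proof -
  have "z \<in> G \<psi> 1" using z G_mono[of r 1] rho_bounds by auto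
  then show ?thesis
    using beta_far[OF z] closure_subset[of "G \<psi> 1"] by (auto simp: Q_def inv_Di_def)
qed

text \<open>Three open sets cover the plane: the interior, the exterior and the band
  \<open>r < |w| < 1 / r\<close> around the curve, on which \<open>Q_middle\<close> gives a single
  formula.\<close>

lemma Q_holo: "Q holomorphic_on UNIV"
proof -
  have s1: "sphere 0 1 \<subseteq> Ann"
    using rho_bounds(3,5) by (intro sphere_subset_Ann) auto
  have Q1: "Q holomorphic_on G \<psi> 1"
  proof (rule holomorphic_transform)
    have "continuous_on (sphere 0 1) (\<lambda>w. eta w * k1 w)"
      using rho_bounds(3,5)
      by (intro continuous_on_mult k1_cont_sphere holomorphic_on_imp_continuous_on
          holomorphic_on_subset[OF eta_holo]) auto
    then have "(\<lambda>z. contour_integral (circlepath 0 1) (\<lambda>w. (eta w * k1 w) * W (\<psi> w) z))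
        holomorphic_on GR - \<psi> ` sphere 0 1"
      using rho_bounds(8) by (intro W_transform_holo) auto
    moreover have "G \<psi> 1 \<subseteq> GR - \<psi> ` sphere 0 1"
      using G_1_subset_GR in_G_iff[OF rho_bounds(8)] by auto
    ultimately have "beta1 holomorphic_on G \<psi> 1"
      unfolding beta1_def by (intro holomorphic_on_mult holomorphic_on_const) (rule holomorphic_on_subset)
    then show "(\<lambda>z. - beta1 z / Di z) holomorphic_on G \<psi> 1"
      using Di_nz closure_subset[of "G \<psi> 1"]
      by (intro holomorphic_intros holomorphic_on_subset[OF Di_holo]) auto
  qed (simp add: Q_def)
  have phi: "phi \<psi> holomorphic_on A" if "A \<subseteq> Omega \<psi> \<rho>\<^sub>0" for A
    by (rule holomorphic_on_subset[OF phi_holo that])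
  have Q2: "Q holomorphic_on Omega \<psi> 1"
  proof (rule holomorphic_transform)
    have sub: "Omega \<psi> 1 \<subseteq> Omega \<psi> \<rho>\<^sub>0" "Omega \<psi> 1 \<subseteq> Omega \<psi> \<rho>"
      using Omega_subset rho_bounds by (auto simp del: less_imp_le intro: less_imp_le)
    have "eta1 holomorphic_on - sphere 0 1"
      unfolding eta1_def using rho_bounds(3,5)
      by (intro holomorphic_intros cauchy_transform_holo beta_k2_cont) auto
    then have "eta1 \<circ> phi \<psi> holomorphic_on Omega \<psi> 1"
      by (rule holomorphic_on_compose_gen[OF phi[OF sub(1)]])
         (use phi_psi rho_bounds(8) in \<open>auto simp: Omega_def Ext_def\<close>)
    then show "(\<lambda>z. De z * sq z * phi \<psi> z ^ n * eta1 (phi \<psi> z)) holomorphic_on Omega \<psi> 1"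
      unfolding o_def using sub
      by (intro holomorphic_on_mult holomorphic_on_power phi holomorphic_on_subset[OF De_holo]
          holomorphic_on_subset[OF sq_holo])
    fix z assume z: "z \<in> Omega \<psi> 1"
    then have "z \<notin> G \<psi> 1"
      using closure_subset by (auto simp: G_def)
    then show "De z * sq z * phi \<psi> z ^ n * eta1 (phi \<psi> z) = Q z"
      using z by (simp add: Q_def)
  qed
  let ?B = "{w. r < cmod w \<and> cmod w < 1 / r}"
  have oB: "open ?B" by (intro open_Collect_conj open_Collect_less continuous_intros)
  have BA: "w \<in> Ann" "\<rho> < cmod w \<and> \<rho> * cmod w < 1" if "w \<in> ?B" for w
    using that sphere_Ann[of w] sphere_annulus[of w] by auto
  have BE: "?B \<subseteq> Ext \<rho>\<^sub>0" "?B \<subseteq> Ext \<rho>" using BA by (auto simp: Ext_def)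
  have oP: "open (\<psi> ` ?B)"
    using BE by (intro open_mapping_thm3[OF holomorphic_on_subset[OF psi_holo] oB inj_on_subset[OF psi_inj]]) auto
  have Q3: "Q holomorphic_on \<psi> ` ?B"
  proof (rule holomorphic_transform)
    let ?H = "\<lambda>w. D w * S w * w ^ n * eta w - iD w * beta (\<psi> w)"
    have sub: "?B \<subseteq> Ext \<rho>" "?B \<subseteq> Ext \<rho>\<^sub>0" "?B \<subseteq> - sphere 0 (1 / r)"
      "?B \<subseteq> {w. \<rho> < cmod w \<and> \<rho> * cmod w < 1}" "?B \<subseteq> {w \<in> Ann. cmod w \<noteq> r}"
      using BE BA by auto
    have H: "?H holomorphic_on ?B"
      by (intro holomorphic_on_diff holomorphic_on_mult holomorphic_on_power holomorphic_on_ident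
          holomorphic_on_subset[OF D_holo] holomorphic_on_subset[OF S_holo] holomorphic_on_subset[OF eta_holo]
          holomorphic_on_subset[OF iD_holo] holomorphic_on_subset[OF beta_psi_holo] sub)
    have "?H \<circ> phi \<psi> holomorphic_on \<psi> ` ?B"
      by (rule holomorphic_on_compose_gen[OF phi H])
         (use BA phi_psi in \<open>auto simp: Omega_def Ext_def\<close>)
    then show "(\<lambda>z. ?H (phi \<psi> z)) holomorphic_on \<psi> ` ?B"
      by (simp add: o_def)
    fix z assume "z \<in> \<psi> ` ?B"
    then obtain w where w: "w \<in> ?B" "z = \<psi> w" by blast
    then show "?H (phi \<psi> z) = Q z"
      using Q_middle[of w] phi_psi[of w] BA(1)[of w] by simp
  qed
  have "Q field_differentiable at z" for z
  proof -
    have "z \<in> G \<psi> 1 \<or> z \<in> Omega \<psi> 1 \<or> z \<in> \<psi> ` ?B"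
    proof (cases "z \<in> G \<psi> 1")
      case False
      then obtain w where w: "1 \<le> cmod w" "z = \<psi> w"
        using in_G_iff[OF rho_bounds(8)] by auto
      show ?thesis
      proof (cases "cmod w = 1")
        case True
        then have "w \<in> ?B" using rho_bounds(3,5) by auto
        then show ?thesis using w(2) by blast
      next
        case False
        then show ?thesis using w by (auto simp: Omega_def Ext_def)
      qed
    qed simp
    then show ?thesis
      using Q1 Q2 Q3 open_G open_Omega[of 1] oP rho_bounds(8)
      by (auto intro: holomorphic_on_imp_differentiable_at)
  qed
  then show ?thesis by (simp add: holomorphic_on_def)
qed

section \<open>Growth at infinity and reduction to a polynomial\<close>

definition "sinf = sqrt (1 / cap)"

lemma sinf: "0 < sinf" "sinf\<^sup>2 = 1 / cap"
  using cap_pos by (simp_all add: sinf_def)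

text \<open>Far out \<open>Q\<close> contains \<open>w ^ n\<close>, and \<open>\<psi> w / w\<close>
  tends to \<open>cap\<close>; dividing by \<open>z ^ n\<close> instead costs
  \<open>cap ^ n\<close>.\<close>

lemma Q_growth: "((\<lambda>z. Q z / z ^ n) \<longlongrightarrow> of_real (dinf * sinf / cap ^ n) * eta_inf) at_infinity"
proof -
  have "((\<lambda>w. D w * S w * eta w / (\<psi> w / w) ^ n) \<longlongrightarrow>
      of_real dinf * of_real sinf * eta_inf / of_real cap ^ n) at_infinity"
    unfolding sinf_def using cap_pos
    by (intro tendsto_intros dinf(3) S_tendsto eta_tendsto psi_over_id_tendsto) auto
  moreover have "\<forall>\<^sub>F w in at_infinity. D w * S w * eta w / (\<psi> w / w) ^ n = Q (\<psi> w) / \<psi> w ^ n"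
    unfolding eventually_at_infinity
    by (intro exI[of _ "1 / r + 1"]) (use Q_outer in \<open>simp add: power_divide mult_ac\<close>)
  ultimately have "((\<lambda>w. Q (\<psi> w) / \<psi> w ^ n) \<longlongrightarrow> of_real (dinf * sinf / cap ^ n) * eta_inf) at_infinity"
    using Lim_transform_eventually by fastforce
  then show ?thesis
    using tendsto_at_infinity_psi_iff[of "\<lambda>z. Q z / z ^ n"] by simp
qed

end

lemma poly_over_power_tendsto:
  fixes p :: "complex poly"
  assumes "degree p \<le> n"
  shows "((\<lambda>z. poly p z / z ^ n) \<longlongrightarrow> coeff p n) at_infinity"
proof -
  have "((\<lambda>z. \<Sum>k\<le>n. coeff p k * (inverse z) ^ (n - k)) \<longlongrightarrow> (\<Sum>k\<le>n. coeff p k * 0 ^ (n - k))) at_infinity"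
    by (intro tendsto_intros tendsto_inverse_0)
  moreover have "(\<Sum>k\<le>n. coeff p k * 0 ^ (n - k)) = (\<Sum>k\<le>n. if k = n then coeff p n else 0)"
    by (intro sum.cong) auto
  moreover have "\<forall>\<^sub>F z in at_infinity. (\<Sum>k\<le>n. coeff p k * (inverse z) ^ (n - k)) = poly p z / z ^ n"
    unfolding eventually_at_infinity
  proof (intro exI[of _ 1] allI impI)
    fix z :: complex assume "1 \<le> norm z"
    then have z: "z \<noteq> 0" by auto
    have "poly p z = (\<Sum>k\<le>n. coeff p k * z ^ k)"
      unfolding poly_altdef using assms
      by (intro sum.mono_neutral_left) (auto simp: coeff_eq_0)
    then have "poly p z / z ^ n = (\<Sum>k\<le>n. coeff p k * z ^ k / z ^ n)"
      by (simp add: sum_divide_distrib)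
    also have "\<dots> = (\<Sum>k\<le>n. coeff p k * (inverse z) ^ (n - k))"
    proof (rule sum.cong[OF refl])
      fix k assume "k \<in> {..n}"
      then have "z ^ n = z ^ k * z ^ (n - k)"
        by (simp flip: power_add)
      then show "coeff p k * z ^ k / z ^ n = coeff p k * (inverse z) ^ (n - k)"
        using z by (simp add: field_simps)
    qed
    finally show "(\<Sum>k\<le>n. coeff p k * (inverse z) ^ (n - k)) = poly p z / z ^ n" by simp
  qed
  ultimately show ?thesis
    using Lim_transform_eventually by fastforce
qed

lemma entire_growth_poly:
  assumes "Q holomorphic_on UNIV" "((\<lambda>z. Q z / z ^ n) \<longlongrightarrow> l) at_infinity"
  obtains p :: "complex poly" where "\<And>z. poly p z = Q z" "degree p \<le> n" "coeff p n = l"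
proof -
  have "\<forall>\<^sub>F z in at_infinity. dist (Q z / z ^ n) l < 1"
    using assms(2) by (rule tendstoD) simp
  then obtain A where A: "\<And>z. A \<le> cmod z \<Longrightarrow> dist (Q z / z ^ n) l < 1"
    unfolding eventually_at_infinity by blast
  have bound: "cmod (Q z) \<le> (cmod l + 1) * cmod z ^ n" if "max A 1 \<le> cmod z" for z
  proof -
    have "cmod (Q z / z ^ n) \<le> cmod l + 1"
      using A[of z] that norm_triangle_ineq2[of "Q z / z ^ n" l] by (simp add: dist_norm)
    moreover have "0 < cmod z ^ n"
    proof (rule zero_less_power)
      have "1 \<le> cmod z" using that by simp
      then show "0 < cmod z" by linarith
    qed
    ultimately show ?thesis
      by (simp add: norm_divide norm_power divide_le_eq)
  qed
  define p where "p = (\<Sum>k\<le>n. monom ((deriv ^^ k) Q 0 / fact k) k)"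
  have p: "poly p z = Q z" for z
    using Liouville_polynomial[OF assms(1), where A = "max A 1", OF bound, of z] by (simp add: p_def poly_sum poly_monom)
  have deg: "degree p \<le> n"
    unfolding p_def by (intro degree_sum_le) (auto intro: order_trans[OF degree_monom_le])
  have "coeff p n = l"
    using tendsto_unique[OF trivial_limit_at_infinity poly_over_power_tendsto[OF deg]] assms(2) p by simp
  with p deg show thesis by (rule that)
qed

subsection \<open>Orthogonality\<close>

text \<open>For \<open>w = exp (2 \<pi> \<i> t)\<close> the differential
  \<open>dw / (2 \<pi> \<i> w)\<close> is the real measure \<open>dt\<close>, so conjugation passes
  under the integral.\<close>

lemma cnj_contour_integral_unit_circle:
  "cnj (contour_integral (circlepath 0 1) (\<lambda>w. H w / (2 * of_real pi * \<i> * w))) =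
   contour_integral (circlepath 0 1) (\<lambda>w. cnj (H w) / (2 * of_real pi * \<i> * w))"
proof -
  have *: "contour_integral (circlepath 0 1) (\<lambda>w. H w / (2 * of_real pi * \<i> * w)) =
      integral {0..1} (\<lambda>t. H (circlepath 0 1 t))" for H
    unfolding contour_integral_integral
    by (intro integral_cong) (simp add: vector_derivative_circlepath, simp add: circlepath)
  show ?thesis unfolding * integral_cnj ..
qed

text \<open>For \<open>X = w F'(w) cnj (F w)\<close>, the derivative of \<open>|F|^2\<close> along
  the circle is \<open>-2 Im X\<close> and vanishes; the outward radial derivative is
  \<open>2 Re X\<close> and cannot be negative; and \<open>|X| = |F'(w)|\<close> because
  \<open>w\<close> and \<open>F w\<close> are unimodular.\<close>

lemma unit_circle_radial_derivative:
  assumes S: "open S" and F: "F holomorphic_on S" and w: "w \<in> S" "cmod w = 1"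
    and on_circle: "\<And>v. v \<in> S \<Longrightarrow> cmod v = 1 \<Longrightarrow> cmod (F v) = 1"
    and inside: "\<And>v. v \<in> S \<Longrightarrow> cmod v < 1 \<Longrightarrow> cmod (F v) < 1"
  shows "w * deriv F w * cnj (F w) = of_real (cmod (deriv F w))"
proof -
  define X where "X = w * deriv F w * cnj (F w)"
  have dF: "(F has_field_derivative deriv F w) (at w)"
    using holomorphic_derivI[OF F S w(1)] .
  have sq: "cmod (F v) ^ 2 = Re (F v * cnj (F v))" for v
    by (simp add: complex_mult_cnj cmod_power2)
  have curve: "((\<lambda>t::real. (cmod (F (c t)))\<^sup>2) has_real_derivative 2 * Re (c' * deriv F w * cnj (F w))) (at t0)"
    if c: "(c has_vector_derivative c') (at t0)" "c t0 = w" for c c' t0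
  proof -
    have 1: "((\<lambda>t. F (c t)) has_vector_derivative c' * deriv F w) (at t0)"
      using field_vector_diff_chain_at[of c c' t0 F "deriv F w"] c dF by (simp add: o_def)
    have "((\<lambda>t. F (c t) * cnj (F (c t))) has_vector_derivative
        F (c t0) * cnj (c' * deriv F w) + c' * deriv F w * cnj (F (c t0))) (at t0)"
      by (intro has_vector_derivative_mult 1 has_vector_derivative_cnj)
    then have "((\<lambda>t. Re (F (c t) * cnj (F (c t)))) has_vector_derivative
        Re (F (c t0) * cnj (c' * deriv F w) + c' * deriv F w * cnj (F (c t0)))) (at t0)"
      by (rule bounded_linear.has_vector_derivative[OF bounded_linear_Re])
    then show ?thesis
      unfolding sq[symmetric] has_real_derivative_iff_has_vector_derivative
      by (rule has_vector_derivative_eq_rhs) (simp add: c(2) algebra_simps)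
  qed
  obtain e where e: "0 < e" "ball w e \<subseteq> S" using openE[OF S w(1)] by blast
  have "Im X = 0"
  proof -
    let ?c = "\<lambda>t::real. w * exp (\<i> * of_real t)"
    have "((\<lambda>z. w * exp (\<i> * z)) has_field_derivative w * \<i>) (at (of_real 0))"
      by (auto intro!: derivative_eq_intros)
    then have "(?c has_vector_derivative w * \<i>) (at 0)"
      by (rule has_vector_derivative_real_field)
    then have d: "((\<lambda>t::real. (cmod (F (?c t)))\<^sup>2) has_real_derivative 2 * Re (w * \<i> * deriv F w * cnj (F w))) (at 0)"
      by (rule curve) simp
    have "isCont ?c 0" by (intro continuous_intros)
    then have "\<forall>\<^sub>F t in at 0. ?c t \<in> S"
      using S w(1) by (auto simp: isCont_def intro: topological_tendstoD)
    then have "\<forall>\<^sub>F t in nhds 0. ?c t \<in> S"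
      using w(1) by (simp add: eventually_nhds_conv_at)
    then have "\<forall>\<^sub>F t in nhds 0. (cmod (F (?c t)))\<^sup>2 = 1"
      by eventually_elim (use on_circle w(2) in \<open>simp add: norm_mult\<close>)
    then have "((\<lambda>t::real. (cmod (F (?c t)))\<^sup>2) has_real_derivative 0) (at 0)"
      using DERIV_cong_ev[of 0 0 "\<lambda>t::real. (cmod (F (?c t)))\<^sup>2" "\<lambda>_. 1" 0 0] by simp
    then have "2 * Re (w * \<i> * deriv F w * cnj (F w)) = 0"
      using d DERIV_unique by blast
    moreover have "w * \<i> * deriv F w * cnj (F w) = \<i> * X" by (simp add: X_def)
    ultimately show ?thesis by simp
  qed
  moreover have "0 \<le> Re X"
  proof (rule ccontr)
    assume "\<not> 0 \<le> Re X"
    then have neg: "2 * Re X < 0" by simp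
    let ?c = "\<lambda>t::real. of_real t * w"
    have "(?c has_vector_derivative w) (at 1)"
      by (auto intro!: derivative_eq_intros simp: has_vector_derivative_def scaleR_conv_of_real)
    then have "((\<lambda>t::real. (cmod (F (?c t)))\<^sup>2) has_real_derivative 2 * Re X) (at 1)"
      unfolding X_def by (rule curve) simp
    \<comment> \<open>A negative radial derivative would push \<open>|F|\<close> above 1 just inside
      the circle.\<close>
    from DERIV_neg_dec_left[OF this neg] obtain d where d: "0 < d"
      "\<And>h. 0 < h \<Longrightarrow> h < d \<Longrightarrow> (cmod (F (?c 1)))\<^sup>2 < (cmod (F (?c (1 - h))))\<^sup>2" by auto
    define h where "h = min (d / 2) (min (e / 2) (1 / 2))"
    have h: "0 < h" "h < d" "h < e" "h < 1"
      using d(1) e(1) by (auto simp: h_def)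
    have cm: "cmod (?c (1 - h)) = 1 - h"
      using h w(2) by (simp add: norm_mult del: of_real_diff)
    have "w - ?c (1 - h) = of_real h * w" by (simp add: algebra_simps)
    then have "dist w (?c (1 - h)) = h"
      using h w(2) by (simp only: dist_norm norm_mult norm_of_real)
    then have "?c (1 - h) \<in> S" using e(2) h by auto
    then have "cmod (F (?c (1 - h))) < 1"
      using inside cm h by auto
    then have "(cmod (F (?c (1 - h))))\<^sup>2 < 1"
      by (simp add: abs_square_less_1)
    moreover have "cmod (F (?c 1)) = 1" using on_circle w by simp
    ultimately show False using d(2)[OF h(1,2)] by simp
  qed
  moreover have "cmod X = cmod (deriv F w)"
    using on_circle[OF w] w(2) by (simp add: X_def norm_mult)
  ultimately show ?thesis
    unfolding X_def[symmetric] by (auto simp: complex_eq_iff cmod_def)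
qed

context szego_data
begin

section \<open>Boundary behaviour of the interior map\<close>

lemma F_less_1: "\<rho>\<^sub>0 < cmod w \<Longrightarrow> cmod w < 1 \<Longrightarrow> cmod (F w) < 1"
  using f_disc psi_in_G_iff[of w 1] rho_bounds(8) by (auto simp: F_def)

text \<open>The reflection rule in \<open>interior_map\<close> is a quotient; since \<open>f\<close>
  has no zero where the reflection lands, it becomes a product identity, with no division by zero
  hidden in it.\<close>

lemma F_reflection:
  assumes w: "w \<in> Ann" "1 < cmod w"
  shows "F w * cnj (F (1 / cnj w)) = 1"
proof -
  have w0: "\<rho>\<^sub>0 < cmod w" using w by simp
  have "cmod (1 / cnj w) = 1 / cmod w" by (simp add: norm_divide)
  moreover have "\<rho>\<^sub>0 < 1 / cmod w" "1 / cmod w < 1"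
    using w less_trans[OF zero_less_one w(2)] by (simp_all add: pos_less_divide_eq)
  ultimately have "\<psi> (1 / cnj w) \<in> Omega \<psi> \<rho>\<^sub>0 \<inter> G \<psi> 1"
    using psi_in_Omega_iff[of "1 / cnj w" "\<rho>\<^sub>0"] psi_in_G_iff[of "1 / cnj w" 1] rho_bounds(8) by auto
  then have "F (1 / cnj w) \<noteq> 0"
    using interior_map unfolding interior_map_def F_def by blast
  moreover have "\<psi> w \<in> GR - closure (G \<psi> 1)"
    using psi_Ann[OF w(1)] psi_in_closure_G_1[OF w0] w by auto
  then have "F w = 1 / cnj (F (1 / cnj w))"
    using interior_map phi_psi[OF w0] unfolding interior_map_def F_def refl_star_def by auto
  ultimately show ?thesis by simp
qed

text \<open>The reflection rule concerns points strictly outside the curve. Letting \<open>t\<close>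
  decrease to 1 along the ray through \<open>w\<close> carries it to the circle, where
  \<open>1 / cnj w = w\<close>.\<close>

lemma F_unimodular:
  assumes w: "cmod w = 1"
  shows "cmod (F w) = 1"
proof -
  have inv: "1 / cnj v \<in> Ann" if "v \<in> Ann" for v
  proof -
    have "0 < cmod v" using that rho_hat_ge_0 by auto
    then show ?thesis using that by (auto simp: norm_divide field_simps)
  qed
  have wA: "w \<in> Ann" using w rho_bounds(8) by simp
  have oA: "open Ann" by (rule open_annulus)
  have "continuous_on Ann (\<lambda>v. F v * cnj (F (1 / cnj v)))"
    using inv rho_hat_ge_0
    by (intro continuous_intros holomorphic_on_imp_continuous_on[OF F_holo]
        continuous_on_compose2[OF holomorphic_on_imp_continuous_on[OF F_holo]]) auto
  then have "isCont (\<lambda>v. F v * cnj (F (1 / cnj v))) w"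
    using continuous_on_eq_continuous_at[OF oA] wA by blast
  moreover have lim: "((\<lambda>t::real. of_real t * w) \<longlongrightarrow> w) (at_right 1)"
    by (rule tendsto_eq_intros | simp)+
  ultimately have l1: "((\<lambda>t::real. F (of_real t * w) * cnj (F (1 / cnj (of_real t * w)))) \<longlongrightarrow>
      F w * cnj (F (1 / cnj w))) (at_right 1)"
    by (rule isCont_tendsto_compose)
  have ev: "\<forall>\<^sub>F t in at_right 1. F (of_real t * w) * cnj (F (1 / cnj (of_real t * w))) = 1"
  proof -
    have "\<forall>\<^sub>F t in at_right 1. of_real t * w \<in> Ann"
      using topological_tendstoD[OF lim oA wA] .
    moreover have "\<forall>\<^sub>F t::real in at_right 1. 1 < t"
      by (rule eventually_at_right_less)
    ultimately show ?thesis
      by eventually_elim (intro F_reflection, use w in \<open>auto simp: norm_mult\<close>)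
  qed
  have "F w * cnj (F (1 / cnj w)) = 1"
    by (rule tendsto_unique[OF trivial_limit_at_right_real l1 tendsto_eventually[OF ev]])
  moreover have "w * cnj w = 1" using w by (simp add: complex_norm_square[symmetric])
  then have "1 / cnj w = w" by (metis div_by_1 mult_cancel_right2 nonzero_divide_eq_eq one_neq_zero mult_zero_right)
  ultimately have "of_real ((cmod (F w))\<^sup>2) = (1 :: complex)"
    by (simp add: complex_norm_square[symmetric])
  then have "(cmod (F w))\<^sup>2 = 1" using of_real_eq_1_iff by blast
  then show ?thesis by (simp add: power2_eq_1_iff) (use norm_ge_zero in smt)
qed

lemma q_nz: "z \<in> GR \<Longrightarrow> q z \<noteq> 0"
  using q_square[of z] holomorphic_injective_imp_regular[OF f_holo open_GR f_inj, of z] by auto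

text \<open>On the curve, \<open>conj q \<bar>dz\<bar>\<close> is a holomorphic differential, since the conformal map \<open>f\<close> has
  modulus 1 there.\<close>

lemma cnj_q_arclength:
  assumes w: "cmod w = 1"
  shows "cnj (q (\<psi> w)) * of_real (cmod (deriv \<psi> w)) = w * q (\<psi> w) * deriv \<psi> w * cnj (F w)"
proof -
  have wA: "w \<in> Ann" using w rho_bounds(8) by simp
  have "w * deriv F w * cnj (F w) = of_real (cmod (deriv F w))"
    by (rule unit_circle_radial_derivative[OF open_annulus F_holo wA w])
       (use F_unimodular F_less_1 in auto)
  then have "w * ((q (\<psi> w))\<^sup>2 * deriv \<psi> w) * cnj (F w) = of_real ((cmod (q (\<psi> w)))\<^sup>2) * of_real (cmod (deriv \<psi> w))"
    unfolding deriv_F[OF wA] by (simp add: norm_mult norm_power)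
  also have "of_real ((cmod (q (\<psi> w)))\<^sup>2) = q (\<psi> w) * cnj (q (\<psi> w))"
    by (rule complex_norm_square)
  finally have "q (\<psi> w) * (w * q (\<psi> w) * deriv \<psi> w * cnj (F w)) =
      q (\<psi> w) * (cnj (q (\<psi> w)) * of_real (cmod (deriv \<psi> w)))"
    by (simp add: power2_eq_square mult_ac)
  then show ?thesis
    using q_nz[OF psi_Ann[OF wA]] by (metis mult_left_cancel)
qed

section \<open>Cauchy's theorem in the interior and orthogonality of the kernel\<close>

text \<open>\<open>Omega \<psi> 1\<close> is connected, unbounded and misses the curve, so it lies
  in the outer component of its complement.\<close>

lemma Lev_path_winding:
  assumes z: "z \<in> Omega \<psi> 1"
  shows "winding_number (\<psi> \<circ> circlepath 0 1) z = 0"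
proof -
  have sub: "sphere 0 1 \<subseteq> Ext \<rho>\<^sub>0" using rho_bounds(8) by (auto simp: Ext_def)
  have img: "path_image (\<psi> \<circ> circlepath 0 1) = \<psi> ` sphere 0 1"
    using sphere_eq[of 1] by (simp add: path_image_compose)
  have disj: "Omega \<psi> 1 \<subseteq> - (\<psi> ` sphere 0 1)"
    using psi_in_Omega_iff[OF _ less_imp_le[OF rho_bounds(8)]] sub by (fastforce simp: Ext_def)
  have "\<not> bounded (Omega \<psi> 1)"
  proof
    assume "bounded (Omega \<psi> 1)"
    moreover have "bounded (- outside L)"
      using compact_L by (intro cobounded_outside compact_imp_bounded)
    ultimately have "bounded (Omega \<psi> 1 \<union> - outside L)" by simp
    then have "bounded (UNIV :: complex set)" unfolding Omega_1 by (simp add: Un_commute)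
    then show False using not_bounded_UNIV by blast
  qed
  moreover have "Omega \<psi> 1 \<subseteq> connected_component_set (- (\<psi> ` sphere 0 1)) z"
    using z disj connected_Omega rho_bounds(8) by (intro connected_component_maximal) auto
  ultimately have "\<not> bounded (connected_component_set (- (\<psi> ` sphere 0 1)) z)"
    using bounded_subset by blast
  then have "z \<in> outside (path_image (\<psi> \<circ> circlepath 0 1))"
    unfolding img outside by simp
  moreover have "path (\<psi> \<circ> circlepath 0 1)"
    using sphere_eq[of 1] sub by (intro path_continuous_image path_circlepath psi_cont) auto
  ultimately show ?thesis
    by (intro winding_number_zero_in_outside) (auto simp: pathfinish_compose pathstart_compose)
qed

text \<open>The homological form of Cauchy's theorem applies: a point missed by \<open>N\<close>
  lies in the exterior, where the winding number vanishes. This takes the place of simple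
  connectivity of the interior.\<close>

lemma Cauchy_G_1:
  assumes "open N" "closure (G \<psi> 1) \<subseteq> N" "H holomorphic_on N"
  shows "contour_integral (circlepath 0 1) (\<lambda>w. H (\<psi> w) * deriv \<psi> w) = 0"
proof -
  have sub: "sphere 0 1 \<subseteq> Ext \<rho>\<^sub>0" using rho_bounds(8) by (auto simp: Ext_def)
  have "(H has_contour_integral 0) (\<psi> \<circ> circlepath 0 1)"
  proof (rule Cauchy_theorem_global[OF assms(1,3)])
    show "valid_path (\<psi> \<circ> circlepath 0 1)"
      using sphere_eq[of 1] sub
      by (intro valid_path_compose_holomorphic[OF _ psi_holo open_Ext]) auto
    show "path_image (\<psi> \<circ> circlepath 0 1) \<subseteq> N"
    proof -
      have "\<psi> ` sphere 0 1 \<subseteq> closure (G \<psi> 1)"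
        using psi_in_closure_G_1 rho_bounds(8) by auto
      then show ?thesis using assms(2) sphere_eq[of 1] by (simp add: path_image_compose)
    qed
    show "winding_number (\<psi> \<circ> circlepath 0 1) w = 0" if "w \<notin> N" for w
      using that assms(2) closure_G_1 by (intro Lev_path_winding) auto
  qed (simp add: pathfinish_compose pathstart_compose)
  then have "contour_integral (\<psi> \<circ> circlepath 0 1) H = 0"
    by (rule contour_integral_unique)
  then show ?thesis
    using contour_integral_comp_circlepath[OF open_Ext psi_holo sub] by simp
qed

text \<open>After conjugation \<open>cnj_q_arclength\<close> removes the conjugate from
  \<open>q\<close>, and \<open>cnj (F w) = 1 / F w\<close> makes the kernel proportional to
  \<open>1 / (cnj (F v) F w - 1)\<close>. This is holomorphic up to the curve because
  \<open>|F v| < 1\<close>, so Cauchy's theorem gives zero.\<close>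

lemma W_orthogonal:
  assumes v: "cmod v = r"
  shows "contour_integral (circlepath 0 1)
    (\<lambda>w. W (\<psi> v) (\<psi> w) * (cnj (Di (\<psi> w) * poly u (\<psi> w)) * of_real (cmod (deriv \<psi> w)))
        / (2 * of_real pi * \<i> * w)) = 0"
proof -
  have vA: "v \<in> Ann" using sphere_Ann[of v] v rho_bounds(3,5) by auto
  have Fv: "cmod (F v) < 1" using F_less_1 v rho_bounds by auto
  obtain N where N: "open N" "closure (G \<psi> 1) \<subseteq> N" "Di holomorphic_on N" "\<And>z. z \<in> N \<Longrightarrow> Di z \<noteq> 0"
    using Di_nbhd by blast
  \<comment> \<open>Discards the zeros of the denominator of \<open>H\<close>; the closed interior
    contains none, since \<open>|f| \<le> 1\<close> there.\<close>
  define N' where "N' = (N \<inter> GR) \<inter> (\<lambda>z. cnj (F v) * f z) -` (- {1})"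
  have contf: "continuous_on (N \<inter> GR) f"
    using f_holo holomorphic_on_imp_continuous_on holomorphic_on_subset by blast
  have N': "open N'"
    unfolding N'_def using N(1) open_GR
    by (intro continuous_open_preimage continuous_intros contf) auto
  have sub: "closure (G \<psi> 1) \<subseteq> N'"
  proof
    fix z assume z: "z \<in> closure (G \<psi> 1)"
    have "z \<in> GR \<and> cmod (f z) \<le> 1"
    proof (cases "z \<in> G \<psi> 1")
      case True
      then have "f z \<in> ball 0 1" unfolding f_disc[symmetric] by (rule imageI)
      then show ?thesis using True G_1_subset_GR by auto
    next
      case False
      then obtain w where w: "1 \<le> cmod w" "z = \<psi> w"
        using in_G_iff[OF rho_bounds(8)] by auto
      then have "cmod w = 1"
        using z psi_in_closure_G_1[of w] rho_bounds(8) by auto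
      then show ?thesis
        using w psi_Ann[of w] F_unimodular[of w] rho_bounds(8) by (auto simp: F_def)
    qed
    moreover from this have "cmod (cnj (F v) * f z) < 1"
      using Fv mult_left_le[of "cmod (f z)" "cmod (F v)"] by (auto simp: norm_mult intro: le_less_trans)
    ultimately show "z \<in> N'"
      using z N(2) by (auto simp: N'_def)
  qed
  define H where "H z = cnj (q (\<psi> v)) / (2 * of_real pi * \<i>) * (q z * Di z * poly u z / (cnj (F v) * f z - 1))" for z
  have "(\<lambda>z. poly u z) holomorphic_on N'"
    by (intro holomorphic_intros)
  then have H: "H holomorphic_on N'"
    unfolding H_def
    by (intro holomorphic_intros holomorphic_on_subset[OF q_holo] holomorphic_on_subset[OF N(3)]
        holomorphic_on_subset[OF f_holo]) (auto simp: N'_def)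
  have "cnj (contour_integral (circlepath 0 1)
    (\<lambda>w. W (\<psi> v) (\<psi> w) * (cnj (Di (\<psi> w) * poly u (\<psi> w)) * of_real (cmod (deriv \<psi> w)))
        / (2 * of_real pi * \<i> * w))) =
    contour_integral (circlepath 0 1) (\<lambda>w. H (\<psi> w) * deriv \<psi> w)"
    unfolding cnj_contour_integral_unit_circle
  proof (rule contour_integral_cong[OF refl])
    fix w assume "w \<in> path_image (circlepath 0 1)"
    then have w: "cmod w = 1" using sphere_eq[of 1] by simp
    then have wA: "w \<in> Ann" "w \<noteq> 0" using rho_bounds(8) by auto
    have Fw: "F w * cnj (F w) = 1"
      using F_unimodular[OF w] by (simp add: complex_norm_square[symmetric])
    then have "F w \<noteq> 0" by auto
    with Fw have Fw0: "F w \<noteq> 0" "cnj (F w) = 1 / F w"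
      by (simp_all add: nonzero_eq_divide_eq mult.commute)
    have "\<psi> w \<in> N'" using sub psi_in_closure_G_1[of w] wA w by auto
    then have ne: "cnj (F v) * F w - 1 \<noteq> 0" by (auto simp: N'_def F_def)
    have "cnj (W (\<psi> v) (\<psi> w)) * of_real (cmod (deriv \<psi> w)) =
       (cnj (q (\<psi> w)) * of_real (cmod (deriv \<psi> w))) * cnj (q (\<psi> v)) / (cnj (F v) - cnj (F w))"
      using W_eq[OF psi_Ann[OF vA] psi_Ann[OF wA(1)]] by (simp add: F_def)
    also have "\<dots> = w * q (\<psi> w) * deriv \<psi> w * cnj (q (\<psi> v)) * (cnj (F w) / (cnj (F v) - cnj (F w)))"
      unfolding cnj_q_arclength[OF w] by simp
    also have "cnj (F w) / (cnj (F v) - cnj (F w)) = 1 / (cnj (F v) * F w - 1)"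
      unfolding Fw0(2) using Fw0(1) ne by (simp add: field_simps)
    finally have *: "cnj (W (\<psi> v) (\<psi> w)) * of_real (cmod (deriv \<psi> w)) =
        w * q (\<psi> w) * deriv \<psi> w * cnj (q (\<psi> v)) * (1 / (cnj (F v) * F w - 1))" .
    have "cnj (W (\<psi> v) (\<psi> w) * (cnj (Di (\<psi> w) * poly u (\<psi> w)) * of_real (cmod (deriv \<psi> w)))) =
        (cnj (W (\<psi> v) (\<psi> w)) * of_real (cmod (deriv \<psi> w))) * (Di (\<psi> w) * poly u (\<psi> w))"
      by simp
    also have "\<dots> / (2 * of_real pi * \<i> * w) = H (\<psi> w) * deriv \<psi> w"
      unfolding * using wA(2) by (simp add: H_def F_def mult_ac)
    finally show "cnj (W (\<psi> v) (\<psi> w) * (cnj (Di (\<psi> w) * poly u (\<psi> w)) * of_real (cmod (deriv \<psi> w))))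
        / (2 * of_real pi * \<i> * w) = H (\<psi> w) * deriv \<psi> w" .
  qed
  also have "\<dots> = 0" by (rule Cauchy_G_1[OF N' sub H])
  finally show ?thesis by simp
qed

text \<open>\<open>beta\<close> superposes the kernels \<open>W (\<psi> v)\<close> with
  \<open>|v| = r\<close>, and Fubini reduces the claim to each of them. The factor
  \<open>cnj (Di)\<close> is what remains of \<open>h = |Di|^2\<close> after division by
  \<open>Di\<close>.\<close>

lemma beta_orthogonal:
  "contour_integral (circlepath 0 1)
    (\<lambda>w. beta (\<psi> w) * (cnj (Di (\<psi> w) * poly u (\<psi> w)) * of_real (cmod (deriv \<psi> w)))
        / (2 * of_real pi * \<i> * w)) = 0"
proof -
  define P where "P w = cnj (Di (\<psi> w) * poly u (\<psi> w)) * of_real (cmod (deriv \<psi> w)) / (2 * of_real pi * \<i> * w)" for w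
  have sub: "sphere 0 1 \<subseteq> Ann" "sphere 0 1 \<subseteq> Ext \<rho>\<^sub>0" "sphere 0 r \<subseteq> Ann"
    using sphere_subset_Ann[of 1] sphere_subset_Ann[of r] rho_bounds(3,5,8) by (auto simp: Ext_def)
  have "(\<lambda>w. Di (\<psi> w)) holomorphic_on sphere 0 1"
    by (rule psi_comp_holo[OF Di_holo]) (use psi_in_closure_G_1 rho_bounds(8) in auto)
  then have P: "continuous_on (sphere 0 1) P"
    unfolding P_def using sub(2) psi_holo
    by (intro continuous_intros holomorphic_on_imp_continuous_on
        holomorphic_on_subset[OF holomorphic_deriv[OF psi_holo open_Ext]]) (auto intro: holomorphic_on_subset)
  have ek: "continuous_on (sphere 0 r) (\<lambda>v. eta v * k1 v)"
  proof -
    have "r \<noteq> 1 / r" using rho_bounds(3,5) by linarith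
    then show ?thesis
      using rho_bounds(3) by (intro continuous_on_mult k1_cont_sphere holomorphic_on_imp_continuous_on
          holomorphic_on_subset[OF eta_holo]) auto
  qed
  define f2 where "f2 v w = - (1 / (2 * of_real pi * \<i>)) * (eta v * k1 v) * W (\<psi> v) (\<psi> w) * P w" for v w
  have f2: "continuous_on (sphere 0 r \<times> sphere 0 1) (\<lambda>(v, w). f2 v w)"
  proof -
    have 1: "continuous_on (sphere 0 r \<times> sphere 0 1) (\<lambda>x. W (\<psi> (fst x)) (\<psi> (snd x)))"
    proof -
      have "continuous_on (sphere 0 r \<times> sphere 0 1) (\<lambda>(v, w). W (\<psi> v) (\<psi> w))"
        using sub rho_bounds(3) by (intro W_cont) auto
      then show ?thesis by (simp add: case_prod_beta)
    qed
    have 2: "continuous_on (sphere 0 r \<times> sphere (0::complex) 1) (\<lambda>x. eta (fst x) * k1 (fst x))"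
      "continuous_on (sphere (0::complex) r \<times> sphere 0 1) (\<lambda>x. P (snd x))"
      by (rule continuous_on_compose2[OF ek] continuous_on_compose2[OF P]; force intro!: continuous_intros)+
    show ?thesis
      unfolding f2_def case_prod_beta
      by (rule continuous_on_mult[OF continuous_on_mult[OF continuous_on_mult[OF continuous_on_const 2(1)] 1] 2(2)])
  qed
  have vd: "continuous_on {0..1} (\<lambda>t. vector_derivative (circlepath 0 s) (at t))" for s
    unfolding vector_derivative_circlepath by (intro continuous_intros)
  have "contour_integral (circlepath 0 1) (\<lambda>w. beta (\<psi> w) * P w) =
     contour_integral (circlepath 0 1) (\<lambda>w. contour_integral (circlepath 0 r) (\<lambda>v. f2 v w))"
  proof (rule contour_integral_cong[OF refl])
    fix w assume "w \<in> path_image (circlepath 0 1)"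
    then have w: "w \<in> sphere 0 1" using sphere_eq[of 1] by simp
    have c: "continuous_on (sphere 0 r) (\<lambda>v. (eta v * k1 v) * W (\<psi> v) (\<psi> w))"
    proof (intro continuous_on_mult[OF ek] W_cont1)
      show "\<psi> w \<in> GR" using psi_Ann sub(1) w by blast
      show "\<psi> w \<notin> \<psi> ` sphere 0 r" using psi_notin_Lev[of w r] w rho_bounds by auto
    qed simp
    have "beta (\<psi> w) * P w = (- (1 / (2 * of_real pi * \<i>)) * P w) *
        contour_integral (circlepath 0 r) (\<lambda>v. (eta v * k1 v) * W (\<psi> v) (\<psi> w))"
      by (simp add: beta_eq)
    also have "\<dots> = contour_integral (circlepath 0 r) (\<lambda>v. (- (1 / (2 * of_real pi * \<i>)) * P w) *
        ((eta v * k1 v) * W (\<psi> v) (\<psi> w)))"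
      using c rho_bounds(4)
      by (intro contour_integral_lmul[symmetric] continuous_on_contour_integrable_circlepath) auto
    also have "\<dots> = contour_integral (circlepath 0 r) (\<lambda>v. f2 v w)"
      by (intro contour_integral_cong[OF refl]) (simp add: f2_def)
    finally show "beta (\<psi> w) * P w = contour_integral (circlepath 0 r) (\<lambda>v. f2 v w)" .
  qed
  also have "contour_integral (circlepath 0 1) (\<lambda>w. contour_integral (circlepath 0 r) (\<lambda>v. f2 v w)) =
     contour_integral (circlepath 0 r) (\<lambda>v. contour_integral (circlepath 0 1) (f2 v))"
    by (rule contour_integral_swap[symmetric])
       (use f2 vd sphere_eq[of 1] sphere_eq[OF rho_bounds(4)] in auto)
  also have "\<dots> = contour_integral (circlepath 0 r) (\<lambda>v. 0)"
  proof (rule contour_integral_cong[OF refl])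
    fix v assume "v \<in> path_image (circlepath 0 r)"
    then have v: "cmod v = r" using rho_bounds(4) sphere_eq[OF rho_bounds(4)] by simp
    have "contour_integral (circlepath 0 1) (f2 v) =
       contour_integral (circlepath 0 1) (\<lambda>w. (- (1 / (2 * of_real pi * \<i>)) * (eta v * k1 v)) *
         (W (\<psi> v) (\<psi> w) * P w))"
      by (simp add: f2_def[abs_def] mult.assoc)
    also have "\<dots> = (- (1 / (2 * of_real pi * \<i>)) * (eta v * k1 v)) * contour_integral (circlepath 0 1) (\<lambda>w. W (\<psi> v) (\<psi> w) * P w)"
    proof (intro contour_integral_lmul continuous_on_contour_integrable_circlepath continuous_on_mult P)
      have "continuous_on ({v} \<times> sphere 0 1) (\<lambda>(v, w). W (\<psi> v) (\<psi> w))"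
        using sub v rho_bounds(3) by (intro W_cont) auto
      then have "continuous_on (sphere 0 1) (\<lambda>w. (\<lambda>(v, w). W (\<psi> v) (\<psi> w)) (v, w))"
        by (rule continuous_on_compose2) (auto intro!: continuous_intros)
      then show "continuous_on (sphere 0 1) (\<lambda>w. W (\<psi> v) (\<psi> w))" by simp
    qed simp
    also have "contour_integral (circlepath 0 1) (\<lambda>w. W (\<psi> v) (\<psi> w) * P w) = 0"
      using W_orthogonal[OF v, of u] by (simp add: P_def)
    finally show "contour_integral (circlepath 0 1) (f2 v) = 0" by simp
  qed
  finally show ?thesis by (simp add: P_def)
qed


section \<open>The inner product on the unit circle\<close>

text \<open>The inner product for the weight \<open>h\<close> on the curve:
  \<open>dw / (2 \<pi> \<i> w)\<close> is normalised arc length on the circle, and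
  \<open>|\<psi>'|\<close> carries it to the curve.\<close>

definition "ip a b = contour_integral (circlepath 0 1)
  (\<lambda>w. poly a (\<psi> w) * cnj (poly b (\<psi> w)) * h (\<psi> w) * of_real (cmod (deriv \<psi> w)) / (2 * of_real pi * \<i> * w))"

lemma ip_arclength:
  "1 / (2 * of_real pi) * arclength_integral (Lev_path \<psi> 1) (\<lambda>z. poly a z * cnj (poly b z) * h z) = ip a b"
proof -
  have "arclength_integral (Lev_path \<psi> 1) (\<lambda>z. poly a z * cnj (poly b z) * h z) =
    integral {0..1} (\<lambda>t. 2 * of_real pi * (poly a (\<psi> (circlepath 0 1 t)) * cnj (poly b (\<psi> (circlepath 0 1 t)))
      * h (\<psi> (circlepath 0 1 t)) * of_real (cmod (deriv \<psi> (circlepath 0 1 t)))))"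
    unfolding arclength_integral_def Lev_path_def
  proof (rule integral_cong)
    fix t :: real assume t: "t \<in> {0..1}"
    have "cmod (circlepath 0 1 t) = 1" by (simp add: circlepath)
    then have "(\<psi> has_field_derivative deriv \<psi> (circlepath 0 1 t)) (at (circlepath 0 1 t))"
      using rho_bounds(8) by (intro holomorphic_derivI[OF psi_holo open_Ext]) (simp add: Ext_def)
    then have "((\<psi> \<circ> circlepath 0 1) has_vector_derivative
        (2 * pi * \<i> * 1 * exp (2 * of_real pi * \<i> * t)) * deriv \<psi> (circlepath 0 1 t)) (at t)"
      using has_vector_derivative_circlepath[of 0 1 t UNIV] by (intro field_vector_diff_chain_at) simp_all
    then have "vector_derivative (\<psi> \<circ> circlepath 0 1) (at t within {0..1}) =
        (2 * pi * \<i> * 1 * exp (2 * of_real pi * \<i> * t)) * deriv \<psi> (circlepath 0 1 t)"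
      using t by (intro vector_derivative_at_within_ivl) auto
    then show "poly a ((\<psi> \<circ> circlepath 0 1) t) * cnj (poly b ((\<psi> \<circ> circlepath 0 1) t)) * h ((\<psi> \<circ> circlepath 0 1) t) *
        of_real (cmod (vector_derivative (\<psi> \<circ> circlepath 0 1) (at t within {0..1}))) =
      2 * of_real pi * (poly a (\<psi> (circlepath 0 1 t)) * cnj (poly b (\<psi> (circlepath 0 1 t)))
      * h (\<psi> (circlepath 0 1 t)) * of_real (cmod (deriv \<psi> (circlepath 0 1 t))))"
      by (simp add: norm_mult)
  qed
  also have "\<dots> = 2 * of_real pi * ip a b"
    unfolding ip_def contour_integral_integral integral_mult_right[symmetric]
    by (intro integral_cong) (simp add: vector_derivative_circlepath, simp add: circlepath)
  finally show ?thesis by simp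
qed

lemma h_weight_cont: "continuous_on (sphere 0 1) (\<lambda>w. h (\<psi> w) * of_real (cmod (deriv \<psi> w)) / (2 * of_real pi * \<i> * w))"
proof -
  have sub: "sphere 0 1 \<subseteq> Ext \<rho>\<^sub>0" "sphere 0 1 \<subseteq> Ext \<rho>" using rho_bounds by (auto simp: Ext_def)
  have "continuous_on (sphere 0 1) (\<lambda>w. of_real (1 / (cmod (D w))\<^sup>2) * of_real (cmod (deriv \<psi> w)) / (2 * of_real pi * \<i> * w) :: complex)"
    using D_nz sub
    by (intro continuous_intros holomorphic_on_imp_continuous_on holomorphic_on_subset[OF D_holo]
        holomorphic_on_subset[OF holomorphic_deriv[OF psi_holo open_Ext]]) auto
  then show ?thesis
    by (rule continuous_on_eq) (simp add: weight_eq(1))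
qed

lemma ip_integrable:
  "(\<lambda>w. poly a (\<psi> w) * cnj (poly b (\<psi> w)) * h (\<psi> w) * of_real (cmod (deriv \<psi> w)) / (2 * of_real pi * \<i> * w))
     contour_integrable_on circlepath 0 1"
proof (rule continuous_on_contour_integrable_circlepath)
  have "continuous_on (sphere 0 1) \<psi>"
    using rho_bounds(8) by (intro psi_cont) (auto simp: Ext_def)
  then have "continuous_on (sphere 0 1) (\<lambda>w. poly a (\<psi> w) * cnj (poly b (\<psi> w)) *
      (h (\<psi> w) * of_real (cmod (deriv \<psi> w)) / (2 * of_real pi * \<i> * w)))"
    by (intro continuous_on_mult continuous_on_cnj continuous_on_poly h_weight_cont)
  then show "continuous_on (sphere 0 1) (\<lambda>w. poly a (\<psi> w) * cnj (poly b (\<psi> w)) *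
      h (\<psi> w) * of_real (cmod (deriv \<psi> w)) / (2 * of_real pi * \<i> * w))"
    by (simp add: mult.assoc)
qed simp

lemma ip_sum:
  assumes "finite K"
  shows "ip (\<Sum>k\<in>K. smult (c k) (p k)) b = (\<Sum>k\<in>K. c k * ip (p k) b)"
proof -
  have "ip (\<Sum>k\<in>K. smult (c k) (p k)) b = contour_integral (circlepath 0 1)
    (\<lambda>w. \<Sum>k\<in>K. c k * (poly (p k) (\<psi> w) * cnj (poly b (\<psi> w)) * h (\<psi> w) * of_real (cmod (deriv \<psi> w))
      / (2 * of_real pi * \<i> * w)))"
    unfolding ip_def poly_sum poly_smult sum_distrib_right sum_divide_distrib
    by (simp add: mult.assoc)
  also have "\<dots> = (\<Sum>k\<in>K. contour_integral (circlepath 0 1)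
    (\<lambda>w. c k * (poly (p k) (\<psi> w) * cnj (poly b (\<psi> w)) * h (\<psi> w) * of_real (cmod (deriv \<psi> w))
      / (2 * of_real pi * \<i> * w))))"
    by (intro contour_integral_sum assms contour_integrable_lmul ip_integrable)
  also have "\<dots> = (\<Sum>k\<in>K. c k * ip (p k) b)"
    unfolding ip_def by (intro sum.cong refl contour_integral_lmul ip_integrable)
  finally show ?thesis .
qed

text \<open>The reciprocal of \<open>De(\<infinity>) phi'(\<infinity>)^(n + 1/2)\<close>; see
  \<open>normalisation\<close>.\<close>

definition "kap = cap ^ n / (dinf * sinf)"

text \<open>On the unit circle \<open>w = 1 / cnj w\<close>, so \<open>w ^ n\<close> times the
  conjugated quotient equals \<open>J\<close>, which reflection continues holomorphically into the
  disc. \<open>K v\<close> grows at most like \<open>v ^ n\<close>, so \<open>J\<close> is finite at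
  \<open>0\<close>, and Cauchy's formula there sees only \<open>J 0\<close> and
  \<open>eta 0 = 1\<close>.\<close>

lemma eta_orthogonal:
  assumes u: "degree u \<le> n"
  shows "contour_integral (circlepath 0 1)
    (\<lambda>w. eta w * (w ^ n * cnj (poly u (\<psi> w) / (D w * S w))) / (2 * of_real pi * \<i> * w)) =
     cnj (coeff u n) * of_real kap" (is ?integral)
    and "(\<lambda>w. eta w * (w ^ n * cnj (poly u (\<psi> w) / (D w * S w))) / (2 * of_real pi * \<i> * w))
      contour_integrable_on circlepath 0 1" (is ?integrable)
proof -
  define K where "K v = poly u (\<psi> v) / (D v * S v)" for v
  \<comment> \<open>The value at \<open>0\<close> is the conjugate of the limit of
    \<open>K v / v ^ n\<close> at infinity, computed in \<open>Klim\<close>.\<close>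
  define J where "J w = (if w = 0 then cnj (coeff u n) * of_real kap else w ^ n * cnj (K (1 / cnj w)))" for w
  define B where "B = Ext \<rho> \<inter> D -` (- {0})"
  have oB: "open B"
    unfolding B_def by (intro continuous_open_preimage holomorphic_on_imp_continuous_on D_holo) auto
  have "(\<lambda>v. poly u (\<psi> v)) holomorphic_on B"
    by (rule psi_comp_holo[of _ UNIV]) (use rho_bounds in \<open>auto simp: B_def Ext_def intro!: holomorphic_intros\<close>)
  then have K: "K holomorphic_on B"
    unfolding K_def using S_nz rho_bounds
    by (intro holomorphic_on_divide holomorphic_on_mult holomorphic_on_subset[OF D_holo] holomorphic_on_subset[OF S_holo])
       (auto simp: B_def Ext_def)
  have Klim: "((\<lambda>v. K v / v ^ n) \<longlongrightarrow> coeff u n * of_real kap) at_infinity"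
  proof -
    have "((\<lambda>v. poly u (\<psi> v) / \<psi> v ^ n) \<longlongrightarrow> coeff u n) at_infinity"
      using poly_over_power_tendsto[OF u] tendsto_at_infinity_psi_iff[of "\<lambda>z. poly u z / z ^ n"] by simp
    then have "((\<lambda>v. (poly u (\<psi> v) / \<psi> v ^ n) * (\<psi> v / v) ^ n / (D v * S v)) \<longlongrightarrow>
        coeff u n * of_real cap ^ n / (of_real dinf * of_real sinf)) at_infinity"
      unfolding sinf_def using cap_pos dinf(1)
      by (intro tendsto_intros dinf(3) S_tendsto psi_over_id_tendsto) auto
    moreover have "\<forall>\<^sub>F v in at_infinity. \<psi> v \<noteq> 0"
    proof -
      have "\<forall>\<^sub>F v in at_infinity. 1 \<le> cmod (\<psi> v)"
        using psi_at_infinity unfolding filterlim_at_infinity[of 0, OF order_refl] by simp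
      then show ?thesis by (auto elim!: eventually_mono)
    qed
    then have "\<forall>\<^sub>F v in at_infinity. (poly u (\<psi> v) / \<psi> v ^ n) * (\<psi> v / v) ^ n / (D v * S v) = K v / v ^ n"
      by eventually_elim (simp add: K_def power_divide)
    ultimately have "((\<lambda>v. K v / v ^ n) \<longlongrightarrow> coeff u n * of_real cap ^ n / (of_real dinf * of_real sinf)) at_infinity"
      by (rule Lim_transform_eventually)
    then show ?thesis by (simp add: kap_def)
  qed
  define A where "A = (- {0}) \<inter> (\<lambda>w. 1 / cnj w) -` B"
  have oA: "open A"
    unfolding A_def by (intro continuous_open_preimage continuous_intros oB) auto
  have inA: "w \<in> A" if "w \<noteq> 0" "cmod w \<le> 1" for w
  proof -
    have "1 \<le> cmod (1 / cnj w)" using that by (simp add: norm_divide le_divide_eq)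
    then show ?thesis
      using that D_nz[of "1 / cnj w"] rho_bounds by (auto simp: A_def B_def Ext_def)
  qed
  have "(\<lambda>w. w ^ n * cnj (K (1 / cnj w))) holomorphic_on A"
    by (intro holomorphic_intros holomorphic_on_circle_reflection[OF K oB]) (auto simp: A_def)
  then have JA: "J holomorphic_on A"
    by (rule holomorphic_transform) (auto simp: J_def A_def)
  have J: "J holomorphic_on A \<union> ball 0 1"
  proof (rule no_isolated_singularity'[where K = "{0}"])
    show "J holomorphic_on A \<union> ball 0 1 - {0}"
    proof (rule holomorphic_on_subset[OF JA], rule subsetI)
      fix x assume "x \<in> A \<union> ball 0 1 - {0}"
      then show "x \<in> A" using inA[of x] by auto
    qed
    have "filterlim (\<lambda>w::complex. 1 / cnj w) at_infinity (at 0)"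
    proof (rule filterlim_divide_at_infinity[OF tendsto_const])
      show "filterlim cnj (at 0) (at (0::complex))"
        unfolding filterlim_at by (auto simp: eventually_at_filter intro!: tendsto_eq_intros)
    qed simp
    then have "((\<lambda>w. K (1 / cnj w) / (1 / cnj w) ^ n) \<longlongrightarrow> coeff u n * of_real kap) (at 0)"
      using Klim filterlim_compose by blast
    then have "((\<lambda>w. cnj (K (1 / cnj w) / (1 / cnj w) ^ n)) \<longlongrightarrow> cnj (coeff u n * of_real kap)) (at 0)"
      by (rule tendsto_cnj)
    moreover have "\<forall>\<^sub>F w in at 0. cnj (K (1 / cnj w) / (1 / cnj w) ^ n) = J w"
      unfolding eventually_at_filter by (rule always_eventually) (simp add: J_def power_divide mult.commute)
    ultimately have J0: "(J \<longlongrightarrow> J 0) (at 0)"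
      using Lim_transform_eventually by (fastforce simp: J_def)
    then show "(J \<longlongrightarrow> J z) (at z within A \<union> ball 0 1)" if "z \<in> {0}" for z
      using that tendsto_within_subset[OF J0 subset_UNIV] by simp
  qed (use oA in auto)
  have cb: "cball 0 1 \<subseteq> A \<union> ball 0 1"
  proof
    fix x :: complex assume "x \<in> cball 0 1"
    then show "x \<in> A \<union> ball 0 1" using inA[of x] by (cases "x = 0") auto
  qed
  have eta: "eta holomorphic_on cball 0 1"
    by (rule holomorphic_on_subset[OF eta_holo]) (use rho_bounds(3,5) in auto)
  have "((\<lambda>w. eta w * J w / (w - 0)) has_contour_integral 2 * of_real pi * \<i> * (eta 0 * J 0)) (circlepath 0 1)"
    by (rule Cauchy_integral_circlepath_simple) (auto intro!: holomorphic_intros eta holomorphic_on_subset[OF J cb])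
  then have "((\<lambda>w. 1 / (2 * of_real pi * \<i>) * (eta w * J w / (w - 0))) has_contour_integral
      1 / (2 * of_real pi * \<i>) * (2 * of_real pi * \<i> * (eta 0 * J 0))) (circlepath 0 1)"
    by (rule has_contour_integral_lmul)
  then have "((\<lambda>w. 1 / (2 * of_real pi * \<i>) * (eta w * J w / (w - 0))) has_contour_integral
      cnj (coeff u n) * of_real kap) (circlepath 0 1)"
    by (simp add: eta_0 J_def)
  then have "((\<lambda>w. eta w * (w ^ n * cnj (poly u (\<psi> w) / (D w * S w))) / (2 * of_real pi * \<i> * w))
     has_contour_integral cnj (coeff u n) * of_real kap) (circlepath 0 1)"
  proof (rule has_contour_integral_eq)
    fix w assume "w \<in> path_image (circlepath 0 1)"
    then have w: "cmod w = 1" using sphere_eq[of 1] by simp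
    have "w * cnj w = 1" using w by (simp add: complex_norm_square[symmetric])
    then have "1 / cnj w = w" by (metis div_by_1 mult_cancel_right2 nonzero_divide_eq_eq one_neq_zero mult_zero_right)
    moreover have "w \<noteq> 0" using w by auto
    ultimately show "1 / (2 * of_real pi * \<i>) * (eta w * J w / (w - 0)) =
        eta w * (w ^ n * cnj (poly u (\<psi> w) / (D w * S w))) / (2 * of_real pi * \<i> * w)"
      by (simp add: J_def K_def)
  qed
  then show ?integral ?integrable
    using contour_integral_unique has_contour_integral_integrable by blast+
qed

text \<open>The weight is written in two ways: \<open>h = 1 / |D|^2\<close>, together with
  \<open>|\<psi>'| = 1 / |S|^2\<close>, cancels \<open>D S\<close> in the \<open>eta\<close> term,
  and \<open>h = |Di|^2\<close> absorbs \<open>1 / Di\<close> in the \<open>beta\<close> term. Both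
  pairings are then already known.\<close>

lemma Q_orthogonal:
  assumes Qp: "\<And>z. poly Qp z = Q z" and u: "degree u \<le> n"
  shows "ip Qp u = cnj (coeff u n) * of_real kap"
proof -
  let ?T1 = "\<lambda>w. eta w * (w ^ n * cnj (poly u (\<psi> w) / (D w * S w))) / (2 * of_real pi * \<i> * w)"
  let ?T2 = "\<lambda>w. beta (\<psi> w) * (cnj (Di (\<psi> w) * poly u (\<psi> w)) * of_real (cmod (deriv \<psi> w)))
        / (2 * of_real pi * \<i> * w)"
  have eq: "poly Qp (\<psi> w) * cnj (poly u (\<psi> w)) * h (\<psi> w) * of_real (cmod (deriv \<psi> w)) / (2 * of_real pi * \<i> * w)
      = ?T1 w - ?T2 w" if "w \<in> path_image (circlepath 0 1)" for w
  proof -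
    have w: "cmod w = 1" using that sphere_eq[of 1] by simp
    then have w0: "\<rho>\<^sub>0 < cmod w" "w \<noteq> 0" using rho_bounds(8) by auto
    have nz: "D w \<noteq> 0" "S w \<noteq> 0" "Di (\<psi> w) \<noteq> 0"
      using D_nz[of w] S_nz[OF w0(1)] Di_nz psi_in_closure_G_1[OF w0(1)] w by auto
    have h1: "h (\<psi> w) = 1 / (D w * cnj (D w))"
      unfolding weight_eq(1)[OF w] by (simp add: complex_norm_square[symmetric])
    have h2: "h (\<psi> w) = Di (\<psi> w) * cnj (Di (\<psi> w))"
      unfolding weight_eq(2)[OF w] by (rule complex_norm_square)
    have dp: "of_real (cmod (deriv \<psi> w)) = 1 / (S w * cnj (S w))"
      unfolding deriv_psi_S[OF w0(1)] norm_divide norm_power by (simp add: complex_norm_square[symmetric])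
    have "poly Qp (\<psi> w) = D w * S w * w ^ n * eta w - iD w * beta (\<psi> w)"
      unfolding Qp using Q_middle[of w] w rho_bounds(3,5) by simp
    then have "poly Qp (\<psi> w) * cnj (poly u (\<psi> w)) * h (\<psi> w) * of_real (cmod (deriv \<psi> w)) / (2 * of_real pi * \<i> * w) =
      (D w * S w * w ^ n * eta w) * cnj (poly u (\<psi> w)) * h (\<psi> w) * of_real (cmod (deriv \<psi> w)) / (2 * of_real pi * \<i> * w) -
      (iD w * beta (\<psi> w)) * cnj (poly u (\<psi> w)) * h (\<psi> w) * of_real (cmod (deriv \<psi> w)) / (2 * of_real pi * \<i> * w)"
      by (simp only: left_diff_distrib diff_divide_distrib)
    also have "(D w * S w * w ^ n * eta w) * cnj (poly u (\<psi> w)) * h (\<psi> w) * of_real (cmod (deriv \<psi> w)) / (2 * of_real pi * \<i> * w)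
       = ?T1 w"
      unfolding h1 dp using nz by simp
    also have "(iD w * beta (\<psi> w)) * cnj (poly u (\<psi> w)) * h (\<psi> w) * of_real (cmod (deriv \<psi> w)) / (2 * of_real pi * \<i> * w)
       = ?T2 w"
      unfolding h2 using nz iD_inside[OF w0(1)] w by simp
    finally show ?thesis .
  qed
  have T1: "?T1 contour_integrable_on circlepath 0 1" by (rule eta_orthogonal(2)[OF u])
  have "(\<lambda>w. ?T1 w - (poly Qp (\<psi> w) * cnj (poly u (\<psi> w)) * h (\<psi> w) * of_real (cmod (deriv \<psi> w)) / (2 * of_real pi * \<i> * w)))
      contour_integrable_on circlepath 0 1"
    by (rule contour_integrable_diff[OF T1 ip_integrable])
  then have T2: "?T2 contour_integrable_on circlepath 0 1"
    by (rule contour_integrable_eq) (simp add: eq)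
  have "ip Qp u = contour_integral (circlepath 0 1) (\<lambda>w. ?T1 w - ?T2 w)"
    unfolding ip_def by (rule contour_integral_cong[OF refl eq])
  also have "\<dots> = contour_integral (circlepath 0 1) ?T1 - contour_integral (circlepath 0 1) ?T2"
    by (rule contour_integral_diff[OF T1 T2])
  finally show ?thesis
    unfolding eta_orthogonal(1)[OF u] beta_orthogonal by simp
qed

section \<open>Identification with the orthogonal polynomial and the constants\<close>

text \<open>In the expansion of \<open>Q\<close> by \<open>p 0\<close>, ..., \<open>p n\<close>, the
  coefficient of \<open>p j\<close> is \<open>kap\<close> times the conjugated coefficient of
  \<open>z ^ n\<close> in \<open>p j\<close>, hence zero for \<open>j < n\<close>. Comparing the
  coefficient of \<open>z ^ n\<close> with the growth limit gives the second identity.\<close>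

lemma Q_eq_orthogonal_poly:
  assumes p: "orthonormal_polys \<psi> h p"
  shows "poly (smult (lead_coeff (p n) * of_real kap) (p n)) z = Q z"
    and "(lead_coeff (p n))\<^sup>2 * of_real kap = of_real (dinf * sinf / cap ^ n) * eta_inf"
proof -
  have deg: "degree (p k) = k" and lc: "\<exists>c::real. c > 0 \<and> lead_coeff (p k) = of_real c" for k
    using p unfolding orthonormal_polys_def by blast+
  have orth: "ip (p i) (p j) = (if i = j then 1 else 0)" for i j
    using p unfolding orthonormal_polys_def ip_arclength by blast
  have lc0: "lead_coeff (p k) \<noteq> 0" for k
    using lc[of k] by auto
  obtain Qp where Qp: "\<And>z. poly Qp z = Q z" "degree Qp \<le> n" "coeff Qp n = of_real (dinf * sinf / cap ^ n) * eta_inf"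
    using entire_growth_poly[OF Q_holo Q_growth] by metis
  obtain c where c: "Qp = (\<Sum>k\<le>n. smult (c k) (p k))"
    using poly_expansion_degree[of p Qp n, OF deg lc0 Qp(2)] by blast
  have cj: "c j = cnj (coeff (p j) n) * of_real kap" if "j \<le> n" for j
  proof -
    have "ip Qp (p j) = (\<Sum>k\<le>n. c k * ip (p k) (p j))"
      unfolding c by (rule ip_sum) simp
    also have "\<dots> = c j"
      using that by (simp add: orth if_distrib cong: if_cong)
    finally show ?thesis
      using Q_orthogonal[OF Qp(1), of "p j"] deg[of j] that by simp
  qed
  have "c j = 0" if "j < n" for j
    using cj[of j] that deg[of j] by (simp add: coeff_eq_0)
  then have "Qp = (\<Sum>k\<le>n. if k = n then smult (c n) (p n) else 0)"
    unfolding c by (intro sum.cong) auto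
  then have "Qp = smult (c n) (p n)" by simp
  moreover have "c n = lead_coeff (p n) * of_real kap"
    using cj[of n] deg[of n] lc[of n] by auto
  ultimately have *: "Qp = smult (lead_coeff (p n) * of_real kap) (p n)" by simp
  then show "poly (smult (lead_coeff (p n) * of_real kap) (p n)) z = Q z"
    using Qp(1) by simp
  show "(lead_coeff (p n))\<^sup>2 * of_real kap = of_real (dinf * sinf / cap ^ n) * eta_inf"
    unfolding Qp(3)[symmetric] * using deg[of n] by (simp add: power2_eq_square)
qed

lemma at_inf_values: "at_inf De = of_real dinf" "at_inf (deriv (phi \<psi>)) = of_real (1 / cap)"
  unfolding at_inf_def
  by (intro tendsto_Lim[OF trivial_limit_at_infinity] dinf(2) deriv_phi_tendsto)+

lemma normalisation: "of_real dinf * of_real (1 / cap) powr (of_nat n + 1 / 2) = (1 / of_real kap :: complex)"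
proof -
  have "of_real (1 / cap) powr (of_nat n + 1 / 2 :: complex) = of_real (1 / cap) powr of_real (of_nat n + 1 / 2)"
    by simp
  also have "\<dots> = of_real ((1 / cap) powr (of_nat n + 1 / 2))"
    using cap_pos by (intro powr_of_real) auto
  also have "(1 / cap) powr (of_nat n + 1 / 2) = (1 / cap) ^ n * sinf"
    using cap_pos by (simp add: powr_add powr_realpow powr_half_sqrt sinf_def)
  finally show ?thesis
    by (simp add: kap_def power_divide)
qed

lemma orthogonal_poly_formula:
  assumes p: "orthonormal_polys \<psi> h p"
  shows "(lead_coeff (p n))\<^sup>2 * poly (monic_poly p n) z
        / (at_inf De * at_inf (deriv (phi \<psi>)) powr (of_nat n + 1 / 2)) = Q z"
proof -
  have "lead_coeff (p n) \<noteq> 0"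
    using p unfolding orthonormal_polys_def by (metis of_real_eq_0_iff less_irrefl)
  then show ?thesis
    unfolding at_inf_values normalisation Q_eq_orthogonal_poly(1)[OF p, symmetric] monic_poly_def
    by (simp add: power2_eq_square)
qed

text \<open>\<open>dinf sinf / cap ^ n\<close> is itself \<open>1 / kap\<close>, so solving for the
  squared leading coefficient makes this factor appear squared.\<close>

lemma lead_coeff_formula:
  assumes p: "orthonormal_polys \<psi> h p"
  shows "(lead_coeff (p n))\<^sup>2 = (at_inf De)\<^sup>2 * at_inf (deriv (phi \<psi>)) ^ (2 * n + 1) * eta_inf"
proof -
  have "kap \<noteq> 0" using cap_pos dinf(1) sinf(1) by (simp add: kap_def)
  then have "(lead_coeff (p n))\<^sup>2 = (lead_coeff (p n))\<^sup>2 * of_real kap / of_real kap"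
    by simp
  also have "\<dots> = of_real (dinf * sinf / cap ^ n / kap) * eta_inf"
    unfolding Q_eq_orthogonal_poly(2)[OF p] by simp
  also have "dinf * sinf / cap ^ n / kap = dinf\<^sup>2 * sinf\<^sup>2 / (cap ^ n * cap ^ n)"
    by (simp add: kap_def power2_eq_square)
  also have "\<dots> = dinf\<^sup>2 * (1 / cap) ^ (2 * n + 1)"
    unfolding sinf(2) by (simp add: power_divide mult_2 power_add)
  finally show ?thesis
    unfolding at_inf_values by simp
qed

end

theorem theorem1p2:
  fixes L :: "complex set"
    and h \<psi> sq De Di :: "complex \<Rightarrow> complex"
    and W :: "complex \<Rightarrow> complex \<Rightarrow> complex"
    and p :: "nat \<Rightarrow> complex poly"
    and r :: real
    and n :: nat
  assumes "analytic_jordan_curve L"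
    and "positive_weight L h"
    and "exterior_map L \<psi>"
    and "sqrt_phi_deriv \<psi> sq"
    and "orthonormal_polys \<psi> h p"
    and "exterior_szego L h \<psi> De"
    and "interior_szego L h \<psi> Di"
    and "is_kernel \<psi> W"
    and "rho \<psi> De < r" and "r < 1"
    and "Lam \<psi> sq De Di r * Lam' \<psi> sq De Di r * Mker \<psi> W r * r ^ (2 * n) / (1 / r - r) < 1"
  shows "(\<forall>z \<in> Omega \<psi> (1 / r).
      summable (\<lambda>k. gtr \<psi> sq De Di W r n (2 * k) z) \<and>
      (lead_coeff (p n))\<^sup>2 * poly (monic_poly p n) z
        / (at_inf De * at_inf (deriv (phi \<psi>)) powr (of_nat n + 1 / 2))
      = De z * sq z * phi \<psi> z ^ n * (\<Sum>k. gtr \<psi> sq De Di W r n (2 * k) z)) \<and>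
    (\<forall>z \<in> Omega \<psi> r \<inter> G \<psi> (1 / r).
      summable (\<lambda>k. gtr \<psi> sq De Di W r n (2 * k) z) \<and>
      summable (\<lambda>k. gtr \<psi> sq De Di W r n (2 * k + 1) z) \<and>
      (lead_coeff (p n))\<^sup>2 * poly (monic_poly p n) z
        / (at_inf De * at_inf (deriv (phi \<psi>)) powr (of_nat n + 1 / 2))
      = De z * sq z * phi \<psi> z ^ n * (\<Sum>k. gtr \<psi> sq De Di W r n (2 * k) z)
        - inv_Di \<psi> De Di z * (\<Sum>k. gtr \<psi> sq De Di W r n (2 * k + 1) z)) \<and>
    (\<forall>z \<in> G \<psi> r.
      summable (\<lambda>k. gtr \<psi> sq De Di W r n (2 * k + 1) z) \<and>
      (lead_coeff (p n))\<^sup>2 * poly (monic_poly p n) z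
        / (at_inf De * at_inf (deriv (phi \<psi>)) powr (of_nat n + 1 / 2))
      = - inv_Di \<psi> De Di z * (\<Sum>k. gtr \<psi> sq De Di W r n (2 * k + 1) z)) \<and>
    (summable (\<lambda>k. at_inf (gtr \<psi> sq De Di W r n (2 * k))) \<and>
      (lead_coeff (p n))\<^sup>2
      = (at_inf De)\<^sup>2 * at_inf (deriv (phi \<psi>)) ^ (2 * n + 1)
        * (\<Sum>k. at_inf (gtr \<psi> sq De Di W r n (2 * k))))"
proof -
  obtain A B where A: "sphere 0 1 \<subseteq> A" "B holomorphic_on A" "L = B ` sphere (0::complex) 1"
    using assms(1) unfolding analytic_jordan_curve_def by blast
  have compact: "compact L"
    unfolding A(3)
    by (intro compact_continuous_image compact_sphere holomorphic_on_imp_continuous_on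
        holomorphic_on_subset[OF A(2)] A(1))
  interpret exterior_curve L \<psi>
    by standard (use compact assms(3) in auto)
  have "De holomorphic_on Omega \<psi> 1"
    using assms(6) closure_subset holomorphic_on_subset analytic_imp_holomorphic
    unfolding exterior_szego_def by metis
  \<comment> \<open>The chain \<open>rho_hat \<psi> \<le> rho \<psi> De < r < 1\<close> makes
    \<open>\<psi>\<close> available on both sides of the unit circle.\<close>
  from rho_attained[OF this] assms(9,10) have "\<rho>\<^sub>0 < 1" by linarith
  moreover obtain f q where "interior_map \<psi> f" "q holomorphic_on G_recip \<psi> \<rho>\<^sub>0"
    "\<And>z. z \<in> G_recip \<psi> \<rho>\<^sub>0 \<Longrightarrow> (q z)\<^sup>2 = deriv f z"
    "\<And>\<zeta> z. \<zeta> \<in> G_recip \<psi> \<rho>\<^sub>0 \<Longrightarrow> z \<in> G_recip \<psi> \<rho>\<^sub>0 \<Longrightarrow> W \<zeta> z = q z * q \<zeta> / (f \<zeta> - f z)"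
    using assms(8) unfolding is_kernel_def by blast
  ultimately interpret szego_data L \<psi> h sq De Di f q W r n
    using assms(4,6,7,9-11) by unfold_locales
  note formula = orthogonal_poly_formula[OF assms(5)]
  have lev: "\<rho>\<^sub>0 < 1 / r" "r < 1 / r"
    using rho_bounds(3,5,12) by linarith+
  \<comment> \<open>The points excluded here and in \<open>odd\<close> lie on the contour of the
    respective transform; no case of the theorem evaluates a series there.\<close>
  have even: "summable (\<lambda>k. g (2 * k) (\<psi> w))" "(\<Sum>k. g (2 * k) (\<psi> w)) = eta w"
    if "\<rho>\<^sub>0 < cmod w" "cmod w \<noteq> 1 / r" for w
    using even_sums[OF that] by (simp_all add: sums_iff)
  have odd: "summable (\<lambda>k. g (2 * k + 1) z)" "(\<Sum>k. g (2 * k + 1) z) = beta z"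
    if "z \<in> GR" "z \<notin> \<psi> ` sphere 0 r" for z
    using odd_sums[OF that] by (simp_all add: sums_iff)
  show ?thesis
  proof (intro conjI ballI)
    fix z assume "z \<in> Omega \<psi> (1 / r)"
    then obtain w where w: "1 / r < cmod w" "z = \<psi> w"
      by (auto simp: Omega_def Ext_def)
    then have w0: "\<rho>\<^sub>0 < cmod w" "cmod w \<noteq> 1 / r" using lev by auto
    show "summable (\<lambda>k. g (2 * k) z)"
      unfolding w(2) by (rule even(1)[OF w0])
    show "(lead_coeff (p n))\<^sup>2 * poly (monic_poly p n) z
        / (at_inf De * at_inf (deriv (phi \<psi>)) powr (of_nat n + 1 / 2))
      = De z * sq z * phi \<psi> z ^ n * (\<Sum>k. g (2 * k) z)"
      unfolding formula w(2) even(2)[OF w0] Q_outer[OF w(1)] phi_psi[OF w0(1)] by (simp add: D_def S_def)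
  next
    fix z assume "z \<in> Omega \<psi> r \<inter> G \<psi> (1 / r)"
    then obtain w where w: "r < cmod w" "z = \<psi> w" and zG: "z \<in> G \<psi> (1 / r)"
      by (auto simp: Omega_def Ext_def)
    then have w0: "\<rho>\<^sub>0 < cmod w" using rho_bounds(7) by linarith
    then have w1: "cmod w < 1 / r"
      using zG w(2) psi_in_G_iff lev(1) by simp
    then have w2: "cmod w \<noteq> 1 / r" by simp
    have z: "z \<in> GR" "z \<notin> \<psi> ` sphere 0 r"
      using psi_Ann[OF sphere_Ann[of w]] psi_notin_Lev[OF w0 rho_bounds(7)] w w1 by auto
    show "summable (\<lambda>k. g (2 * k) z)"
      unfolding w(2) by (rule even(1)[OF w0 w2])
    show "summable (\<lambda>k. g (2 * k + 1) z)"
      by (rule odd(1)[OF z])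
    show "(lead_coeff (p n))\<^sup>2 * poly (monic_poly p n) z
        / (at_inf De * at_inf (deriv (phi \<psi>)) powr (of_nat n + 1 / 2))
      = De z * sq z * phi \<psi> z ^ n * (\<Sum>k. g (2 * k) z)
        - inv_Di \<psi> De Di z * (\<Sum>k. g (2 * k + 1) z)"
      unfolding formula odd(2)[OF z]
      unfolding w(2) even(2)[OF w0 w2] Q_middle[OF w(1) w1] phi_psi[OF w0] by (simp add: D_def S_def iD_def)
  next
    fix z assume zG: "z \<in> G \<psi> r"
    have z: "z \<in> GR" "z \<notin> \<psi> ` sphere 0 r"
      using zG G_mono[of r 1] G_1_subset_GR in_G_iff[OF rho_bounds(7)] rho_bounds by auto
    show "summable (\<lambda>k. g (2 * k + 1) z)"
      by (rule odd(1)[OF z])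
    show "(lead_coeff (p n))\<^sup>2 * poly (monic_poly p n) z
        / (at_inf De * at_inf (deriv (phi \<psi>)) powr (of_nat n + 1 / 2))
      = - inv_Di \<psi> De Di z * (\<Sum>k. g (2 * k + 1) z)"
      unfolding formula odd(2)[OF z] by (rule Q_inner[OF zG])
  next
    show "summable (\<lambda>k. at_inf (g (2 * k)))"
      using at_inf_sums by (simp add: sums_iff)
    show "(lead_coeff (p n))\<^sup>2 = (at_inf De)\<^sup>2 * at_inf (deriv (phi \<psi>)) ^ (2 * n + 1)
        * (\<Sum>k. at_inf (g (2 * k)))"
      using at_inf_sums lead_coeff_formula[OF assms(5)] by (simp add: sums_iff)
  qed
qed

end
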